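(* Let $n\ge2$, let $\Omega\subset\mathbb{R}^n$ be open and bounded, let $1<p\le n$ and $p<q\le\frac{np}{n-p}$ (interpreted as $q\in(p,\infty)$ when $p=n$), and let $\mu$ be a positive, finite Borel measure supported on $\Omega$ such that for some $C>0$, $\big(\int_\Omega|\varphi|^q\,d\mu\big)^{1/q}\le C\big(\int_\Omega|\nabla\varphi|^p\,dx\big)^{1/p}$ for all $\varphi\in C_0^\infty(\Omega)$. Then every $(p,\mu)$-eigenvalue $\lambda$ is strictly positive, and there exists a smallest $(p,\mu)$-eigenvalue $\lambda>0$ together with a corresponding eigenfunction $u\in W_0^{1,p}(\Omega)$.
   Context: A real number $\lambda$ is a $(p,\mu)$-eigenvalue if there exists a nonzero $u\in W_0^{1,p}(\Omega)$ (a $(p,\mu)$-eigenfunction) such that $\int_\Omega|\nabla u|^{p-2}\nabla u\cdot\nabla\varphi\,dx=\lambda\int_\Omega|u|^{p-2}u\,\varphi\,d\mu$ for all $\varphi\in C_0^\infty(\Omega)$ (here $u$ is understood via the continuous extension of the embedding $W_0^{1,p}(\Omega)\to L^q(\Omega,\mu)$). *)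

theory Defs
  imports "HOL-Analysis.Analysis"
begin

definition pd :: "'n::finite \<Rightarrow> (real^'n \<Rightarrow> real) \<Rightarrow> (real^'n \<Rightarrow> real)" where
  "pd i f = (\<lambda>x. frechet_derivative f (at x) (axis i 1))"

definition grad :: "(real^'n::finite \<Rightarrow> real) \<Rightarrow> real^'n \<Rightarrow> real^'n" where
  "grad f x = (\<chi> i. pd i f x)"

definition smooth_fun :: "(real^'n::finite \<Rightarrow> real) \<Rightarrow> bool" where
  "smooth_fun f \<longleftrightarrow> (\<forall>is :: 'n list. \<forall>x. (foldr pd is f) differentiable (at x))"

definition test_fun :: "(real^'n::finite) set \<Rightarrow> (real^'n \<Rightarrow> real) \<Rightarrow> bool" where
  "test_fun \<Omega> f \<longleftrightarrow> smooth_fun f \<and> compact (closure {x. f x \<noteq> 0}) \<and>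
      closure {x. f x \<noteq> 0} \<subseteq> \<Omega>"

text \<open>u is an element of W_0^{1,p}(Omega) with weak gradient G, and v is its image under the
  continuous extension of the embedding into L^q(mu): there is a sequence of test functions
  converging to u in L^p(Omega), whose gradients converge to G in L^p(Omega), and which
  converges to v in L^q(mu).\<close>
definition W0_trace ::
  "(real^'n::finite) set \<Rightarrow> real \<Rightarrow> real \<Rightarrow> (real^'n) measure \<Rightarrow>
     (real^'n \<Rightarrow> real) \<Rightarrow> (real^'n \<Rightarrow> real^'n) \<Rightarrow> (real^'n \<Rightarrow> real) \<Rightarrow> bool" where
  "W0_trace \<Omega> p q \<mu> u G v \<longleftrightarrow>
     u \<in> borel_measurable lebesgue \<and> G \<in> borel_measurable lebesgue \<and> v \<in> borel_measurable \<mu> \<and>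
     (\<exists>\<phi>. (\<forall>k. test_fun \<Omega> (\<phi> k)) \<and>
        (\<lambda>k. \<integral>\<^sup>+x\<in>\<Omega>. ennreal (\<bar>\<phi> k x - u x\<bar> powr p) \<partial>lebesgue) \<longlonglongrightarrow> 0 \<and>
        (\<lambda>k. \<integral>\<^sup>+x\<in>\<Omega>. ennreal (norm (grad (\<phi> k) x - G x) powr p) \<partial>lebesgue) \<longlonglongrightarrow> 0 \<and>
        (\<lambda>k. \<integral>\<^sup>+x. ennreal (\<bar>\<phi> k x - v x\<bar> powr q) \<partial>\<mu>) \<longlonglongrightarrow> 0)"

definition p_mu_eigenfunction ::
  "(real^'n::finite) set \<Rightarrow> real \<Rightarrow> real \<Rightarrow> (real^'n) measure \<Rightarrow> real \<Rightarrow> (real^'n \<Rightarrow> real) \<Rightarrow> bool" where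
  "p_mu_eigenfunction \<Omega> p q \<mu> lam u \<longleftrightarrow>
     (\<exists>G v. W0_trace \<Omega> p q \<mu> u G v \<and>
        \<not> (AE x in lebesgue. x \<in> \<Omega> \<longrightarrow> u x = 0) \<and>
        (\<forall>\<phi>. test_fun \<Omega> \<phi> \<longrightarrow>
           (LINT x:\<Omega>|lebesgue. norm (G x) powr (p - 2) * (G x \<bullet> grad \<phi> x))
             = lam * (\<integral>x. \<bar>v x\<bar> powr (p - 2) * v x * \<phi> x \<partial>\<mu>)))"

definition p_mu_eigenvalue ::
  "(real^'n::finite) set \<Rightarrow> real \<Rightarrow> real \<Rightarrow> (real^'n) measure \<Rightarrow> real \<Rightarrow> bool" where
  "p_mu_eigenvalue \<Omega> p q \<mu> lam \<longleftrightarrow> (\<exists>u. p_mu_eigenfunction \<Omega> p q \<mu> lam u)"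

end

theory Submission
  imports Defs "HOL-Complex_Analysis.Great_Picard"
begin

text \<open>The smallest eigenvalue is the infimum of the Rayleigh quotient
  \<open>\<integral>|\<nabla>\<phi>|^p dx / \<integral>|\<phi>|^p d\<mu>\<close>. Since \<open>p \<le> n\<close>, points have zero capacity, so \<open>\<mu>\<close> has no
  atoms and \<open>\<mu>(B(z,\<delta>)) \<rightarrow> 0\<close> uniformly in \<open>z\<close>. As \<open>q > p\<close>, Hoelder's inequality on small balls turns
  the embedding into \<open>\<integral>|\<phi>|^p d\<mu> \<le> \<epsilon> \<integral>|\<nabla>\<phi>|^p dx + K(\<epsilon>) \<integral>|\<phi>|^p dx\<close>; with Rellich's theorem a minimizing
  sequence has a subsequence that is Cauchy in \<open>L^p(\<mu>)\<close>. Its midpoints are then almost minimizing as well,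
  and uniform convexity makes the gradients Cauchy in \<open>L^p(\<Omega>)\<close>, so the sequence converges strongly and
  no weak compactness is needed. Testing the equation with the eigenfunction itself gives
  positivity and the comparison with any other eigenvalue.\<close>

section \<open>Smooth functions and test functions\<close>

text \<open>The exponent q may be critical, and then the embedding into L^q(\<mu>) need not be
  compact (take Lebesgue measure on \<Omega> and q = np/(n-p) with p < n). Compactness is therefore
  sought only in L^p(\<mu>), the exponent of the Rayleigh quotient. Convergence in L^q(\<mu>), which
  \<open>W0_trace\<close> demands, is recovered by applying the embedding to differences whose
  gradients are already Cauchy. A second obstacle: \<mu> may be singular to Lebesgue measure, so u
  and its trace v are separate functions, linked only through the approximating test functions.
  Inequalities are thus proved for test functions and passed to the triple (u, G, v) by density. The
  minimizer is normalized through v, and the inequality behind compactness also shows that u does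
  not vanish. The weak equation comes from convexity: tangent inequalities for |a|^p bound the
  growth of the \<mu>-integral from below and that of the energy from above.\<close>

fun Ck :: "nat \<Rightarrow> (real^'n::finite \<Rightarrow> real) \<Rightarrow> bool" where
  "Ck 0 f = True"
| "Ck (Suc k) f = ((\<forall>x. f differentiable (at x)) \<and> (\<forall>i. Ck k (pd i f)))"

text \<open>\<open>foldr\<close> applies the last index of the list first. Peeling off that index
  matches the recursion of \<open>Ck\<close>, whose closure properties then follow by induction on
  the order.\<close>

lemma smooth_fun_iff_Ck: "smooth_fun f \<longleftrightarrow> (\<forall>k. Ck k f)"
proof -
  have 1: "Ck (Suc (length is)) f \<Longrightarrow> foldr pd is f differentiable (at x)" for "is" f x
    by (induction "is" arbitrary: f rule: rev_induct) auto
  have 2: "(\<forall>is. \<forall>x. (foldr pd is f) differentiable (at x)) \<Longrightarrow> Ck k f" for k f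
  proof (induction k arbitrary: f)
    case (Suc k)
    have "f differentiable at x" for x using Suc.prems[rule_format, of "[]" x] by simp
    moreover have "Ck k (pd i f)" for i
      by (rule Suc.IH) (use Suc.prems[rule_format, of "_ @ [i]"] in simp)
    ultimately show ?case by simp
  qed simp
  show ?thesis unfolding smooth_fun_def using 1 2 by blast
qed

lemma Ck_mono: "Ck (Suc k) f \<Longrightarrow> Ck k f"
proof (induction k arbitrary: f)
  case (Suc k) then show ?case using Ck.simps(2)[of "Suc k" f] Ck.simps(2)[of k f] by blast
qed simp

lemma smooth_fun_differentiable: "smooth_fun f \<Longrightarrow> f differentiable (at x)"
  unfolding smooth_fun_iff_Ck by (metis Ck.simps(2))

lemma smooth_fun_pd: "smooth_fun f \<Longrightarrow> smooth_fun (pd i f)"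
  unfolding smooth_fun_iff_Ck by (metis Ck.simps(2))

lemma has_derivative_pd:
  assumes "(f has_derivative F) (at x)"
  shows "pd i f x = F (axis i 1)"
  using frechet_derivative_at[OF assms] by (simp add: pd_def)

lemma has_derivative_grad:
  fixes f :: "real^'n::finite \<Rightarrow> real"
  assumes "f differentiable (at x)"
  shows "(f has_derivative (\<lambda>h. grad f x \<bullet> h)) (at x)"
proof -
  let ?F = "frechet_derivative f (at x)"
  have d: "(f has_derivative ?F) (at x)"
    using assms frechet_derivative_works by blast
  then interpret bounded_linear ?F by (rule has_derivative_bounded_linear)
  have "?F h = grad f x \<bullet> h" for h
  proof -
    have "?F h = ?F (\<Sum>i\<in>UNIV. (h $ i) *\<^sub>R axis i 1)"
      by (subst basis_expansion[symmetric, of h]) (simp add: scalar_mult_eq_scaleR)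
    also have "\<dots> = grad f x \<bullet> h"
      by (simp add: sum scaleR grad_def pd_def inner_vec_def mult.commute)
    finally show ?thesis .
  qed
  then have "?F = (\<lambda>h. grad f x \<bullet> h)" by (rule ext)
  then show ?thesis using d by metis
qed

lemma grad_unique:
  assumes "(f has_derivative (\<lambda>h. g \<bullet> h)) (at x)"
  shows "grad f x = g"
  using has_derivative_pd[OF assms] by (simp add: grad_def vec_eq_iff inner_axis)

lemma smooth_fun_continuous: "smooth_fun f \<Longrightarrow> continuous_on A f"
  by (meson continuous_at_imp_continuous_on differentiable_imp_continuous_within smooth_fun_differentiable)

lemma smooth_fun_continuous_grad: "smooth_fun f \<Longrightarrow> continuous_on A (grad f)"
  unfolding grad_def
  by (intro continuous_on_vec_lambda smooth_fun_continuous smooth_fun_pd)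

lemma pd_const: "pd i (\<lambda>x. c) = (\<lambda>x. 0)"
  by (simp add: pd_def)

lemma pd_coord: "pd i (\<lambda>x. x $ j) = (\<lambda>x. if i = j then 1 else 0)"
  by (rule ext, subst has_derivative_pd[where F="\<lambda>h. h $ j"])
    (auto intro!: bounded_linear_imp_has_derivative bounded_linear_vec_nth simp: axis_def)

lemma pd_add:
  assumes "f differentiable (at x)" "g differentiable (at x)"
  shows "pd i (\<lambda>x. f x + g x) x = pd i f x + pd i g x"
  using has_derivative_pd[OF has_derivative_add[OF assms[unfolded frechet_derivative_works]]]
  by (simp add: pd_def)

lemma pd_mult:
  assumes "f differentiable (at x)" "g differentiable (at x)"
  shows "pd i (\<lambda>x. f x * g x) x = f x * pd i g x + pd i f x * g x"
  using has_derivative_pd[OF has_derivative_mult[OF assms[unfolded frechet_derivative_works]]]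
  by (simp add: pd_def)

lemma Ck_const: "Ck k (\<lambda>x. c)"
  by (induction k arbitrary: c) (auto simp: pd_const)

lemma Ck_coord: "Ck k (\<lambda>x. x $ j)"
  by (cases k) (auto simp: pd_coord Ck_const bounded_linear_imp_differentiable bounded_linear_vec_nth)

lemma Ck_add: "Ck k f \<Longrightarrow> Ck k g \<Longrightarrow> Ck k (\<lambda>x. f x + g x)"
proof (induction k arbitrary: f g)
  case (Suc k)
  have "pd i (\<lambda>x. f x + g x) = (\<lambda>x. pd i f x + pd i g x)" for i
    using Suc.prems by (auto simp: pd_add)
  with Suc show ?case by (auto intro: differentiable_add)
qed simp

lemma Ck_mult: "Ck k f \<Longrightarrow> Ck k g \<Longrightarrow> Ck k (\<lambda>x. f x * g x)"
proof (induction k arbitrary: f g)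
  case (Suc k)
  have "pd i (\<lambda>x. f x * g x) = (\<lambda>x. f x * pd i g x + pd i f x * g x)" for i
    using Suc.prems by (auto simp: pd_mult)
  moreover have "Ck k f" "Ck k g" using Suc.prems Ck_mono by blast+
  ultimately show ?case using Suc by (auto intro!: Ck_add differentiable_mult)
qed simp

lemma smooth_fun_const: "smooth_fun (\<lambda>x. c)"
  and smooth_fun_coord: "smooth_fun (\<lambda>x. x $ j)"
  by (simp_all add: smooth_fun_iff_Ck Ck_const Ck_coord)

lemma smooth_fun_add: "smooth_fun f \<Longrightarrow> smooth_fun g \<Longrightarrow> smooth_fun (\<lambda>x. f x + g x)"
  and smooth_fun_mult: "smooth_fun f \<Longrightarrow> smooth_fun g \<Longrightarrow> smooth_fun (\<lambda>x. f x * g x)"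
  by (simp_all add: smooth_fun_iff_Ck Ck_add Ck_mult)

lemma smooth_fun_diff:
  assumes "smooth_fun f" "smooth_fun g" shows "smooth_fun (\<lambda>x. f x - g x)"
  using smooth_fun_add[OF assms(1) smooth_fun_mult[OF smooth_fun_const[of "-1"] assms(2)]] by simp

lemma smooth_fun_sum:
  assumes "\<And>i. i \<in> I \<Longrightarrow> smooth_fun (f i)" shows "smooth_fun (\<lambda>x. \<Sum>i\<in>I. f i x)"
  using assms by (induction I rule: infinite_finite_induct) (auto simp: smooth_fun_const smooth_fun_add)

lemma smooth_fun_norm_sq: "smooth_fun (\<lambda>x. (norm (x - a))\<^sup>2)"
proof -
  have "(norm (x - a))\<^sup>2 = (\<Sum>j\<in>UNIV. (x $ j - a $ j) * (x $ j - a $ j))" for x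
    by (simp add: power2_norm_eq_inner inner_vec_def)
  then show ?thesis
    by (simp add: smooth_fun_sum smooth_fun_mult smooth_fun_diff smooth_fun_coord smooth_fun_const)
qed

text \<open>The outer function comes with the whole sequence of its derivatives \<open>g j\<close>:
  the chain rule turns \<open>g j\<close> into \<open>g (Suc j)\<close> times a smooth factor, so
  the induction on the order runs for all j at once.\<close>

lemma smooth_fun_compose:
  assumes g: "\<And>j t. ((g j :: real \<Rightarrow> real) has_real_derivative g (Suc j) t) (at t)"
    and f: "smooth_fun f"
  shows "smooth_fun (\<lambda>x. g 0 (f x))"
proof -
  have "Ck k (\<lambda>x. g j (f x))" for k j
  proof (induction k arbitrary: j)
    case (Suc k)
    have d: "((\<lambda>x. g j (f x)) has_derivative (\<lambda>h. g (Suc j) (f x) * (grad f x \<bullet> h))) (at x)" for x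
      using has_derivative_compose[OF has_derivative_grad[OF smooth_fun_differentiable[OF f]]
          g[unfolded has_field_derivative_def]] by (simp add: o_def)
    have "pd i (\<lambda>x. g j (f x)) = (\<lambda>x. g (Suc j) (f x) * pd i f x)" for i
      by (rule ext, subst has_derivative_pd[OF d]) (simp add: grad_def inner_axis)
    moreover have "Ck k (pd i f)" for i using smooth_fun_pd[OF f] smooth_fun_iff_Ck by blast
    moreover have "(\<lambda>x. g j (f x)) differentiable (at x)" for x
      using d unfolding differentiable_def by blast
    ultimately show ?case using Suc.IH by (simp add: Ck_mult)
  qed simp
  then show ?thesis unfolding smooth_fun_iff_Ck by blast
qed

lemma grad_add:
  assumes "f differentiable (at x)" "g differentiable (at x)"
  shows "grad (\<lambda>x. f x + g x) x = grad f x + grad g x"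
  by (simp add: grad_def vec_eq_iff pd_add[OF assms])

lemma grad_mult:
  assumes "f differentiable (at x)" "g differentiable (at x)"
  shows "grad (\<lambda>x. f x * g x) x = f x *\<^sub>R grad g x + g x *\<^sub>R grad f x"
  by (simp add: grad_def vec_eq_iff pd_mult[OF assms])

lemma grad_const: "grad (\<lambda>x. c) x = 0"
  by (simp add: grad_def vec_eq_iff pd_const)

lemma grad_scale:
  assumes "f differentiable (at x)"
  shows "grad (\<lambda>x. c * f x) x = c *\<^sub>R grad f x"
  using grad_mult[OF differentiable_const assms, of c] by (simp add: grad_const)

lemma grad_diff:
  assumes "f differentiable (at x)" "g differentiable (at x)"
  shows "grad (\<lambda>x. f x - g x) x = grad f x - grad g x"
  using grad_add[OF assms(1) differentiable_mult[OF differentiable_const assms(2)], of "-1"]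
    grad_scale[OF assms(2), of "-1"] by simp

lemma grad_sum:
  assumes "\<And>i. i \<in> I \<Longrightarrow> smooth_fun (f i)"
  shows "grad (\<lambda>x. \<Sum>i\<in>I. f i x) x = (\<Sum>i\<in>I. grad (f i) x)"
  using assms
proof (induction I rule: infinite_finite_induct)
  case (insert i I)
  have "grad (\<lambda>x. f i x + (\<Sum>i\<in>I. f i x)) x = grad (f i) x + grad (\<lambda>x. \<Sum>i\<in>I. f i x) x"
    using insert by (intro grad_add smooth_fun_differentiable smooth_fun_sum) auto
  with insert show ?case by simp
qed (simp_all add: grad_const)

section \<open>Supports and the algebra of test functions\<close>

lemma grad_zero_outside:
  assumes "x \<notin> closure {x. f x \<noteq> 0}"
  shows "grad f x = 0"
proof (rule grad_unique, rule has_derivative_transform_within_open[where s="- closure {x. f x \<noteq> 0}"])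
  show "((\<lambda>x. 0) has_derivative (\<lambda>h. 0 \<bullet> h)) (at x)" by simp
  show "0 = f y" if "y \<in> - closure {x. f x \<noteq> 0}" for y
    using that closure_subset[of "{x. f x \<noteq> 0}"] by auto
qed (use assms in auto)

lemma test_funI:
  assumes "smooth_fun f" "compact K" "K \<subseteq> \<Omega>" "\<And>x. x \<notin> K \<Longrightarrow> f x = 0"
  shows "test_fun \<Omega> f"
proof -
  have "closure {x. f x \<noteq> 0} \<subseteq> K"
    using assms by (intro closure_minimal compact_imp_closed) auto
  then show ?thesis unfolding test_fun_def using assms
    using compact_Int_closed[of K "closure {x. f x \<noteq> 0}"] by (auto simp: Int_absorb1)
qed

lemma test_fun_support:
  assumes "test_fun \<Omega> f"
  shows "\<exists>K. compact K \<and> K \<subseteq> \<Omega> \<and> (\<forall>x. x \<notin> K \<longrightarrow> f x = 0 \<and> grad f x = 0)"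
proof (intro exI[of _ "closure {x. f x \<noteq> 0}"] conjI allI impI)
  show "x \<notin> closure {x. f x \<noteq> 0} \<Longrightarrow> f x = 0" for x
    using closure_subset[of "{x. f x \<noteq> 0}"] by auto
qed (use assms in \<open>auto simp: test_fun_def intro: grad_zero_outside\<close>)

lemma test_fun_smooth: "test_fun \<Omega> f \<Longrightarrow> smooth_fun f"
  by (simp add: test_fun_def)

lemma test_fun_differentiable: "test_fun \<Omega> f \<Longrightarrow> f differentiable (at x)"
  by (simp add: test_fun_def smooth_fun_differentiable)

lemma test_fun_mult_smooth:
  assumes "test_fun \<Omega> f" "smooth_fun g" shows "test_fun \<Omega> (\<lambda>x. f x * g x)"
proof -
  obtain K where "compact K" "K \<subseteq> \<Omega>" "\<And>x. x \<notin> K \<Longrightarrow> f x = 0"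
    using test_fun_support[OF assms(1)] by metis
  then show ?thesis
    using assms test_fun_smooth by (intro test_funI[of _ K] smooth_fun_mult) auto
qed

lemma test_fun_scale:
  assumes "test_fun \<Omega> f" shows "test_fun \<Omega> (\<lambda>x. c * f x)"
  using test_fun_mult_smooth[OF assms smooth_fun_const[of c]] by (simp add: mult.commute)

lemma test_fun_add:
  assumes "test_fun \<Omega> f" "test_fun \<Omega> g" shows "test_fun \<Omega> (\<lambda>x. f x + g x)"
proof -
  obtain K where K: "compact K" "K \<subseteq> \<Omega>" "\<And>x. x \<notin> K \<Longrightarrow> f x = 0" using test_fun_support[OF assms(1)] by metis
  obtain L where L: "compact L" "L \<subseteq> \<Omega>" "\<And>x. x \<notin> L \<Longrightarrow> g x = 0" using test_fun_support[OF assms(2)] by metis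
  show ?thesis
    using K L assms test_fun_smooth by (intro test_funI[of _ "K \<union> L"] smooth_fun_add compact_Un) auto
qed

lemma test_fun_diff:
  assumes "test_fun \<Omega> f" "test_fun \<Omega> g" shows "test_fun \<Omega> (\<lambda>x. f x - g x)"
  using test_fun_add[OF assms(1) test_fun_scale[OF assms(2), of "-1"]] by simp

section \<open>Bump functions\<close>

text \<open>The polynomial factor makes the class closed under differentiation: in the variable y =
  1/x the derivative replaces P by y^2 (P - P'), so one computation covers every derivative of
  e^(-1/x).\<close>

definition flat_exp :: "real poly \<Rightarrow> real \<Rightarrow> real" where
  "flat_exp P x = (if x > 0 then poly P (1 / x) * exp (- (1 / x)) else 0)"

lemma poly_mult_exp_tendsto_0: "((\<lambda>x::real. poly P x * exp (- x)) \<longlongrightarrow> 0) at_top"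
proof -
  have "((\<lambda>x::real. \<Sum>i\<le>degree P. coeff P i * (x ^ i / exp x)) \<longlongrightarrow> (\<Sum>i\<le>degree P. coeff P i * 0)) at_top"
    by (intro tendsto_intros tendsto_power_div_exp_0)
  then show ?thesis
    by (simp add: poly_altdef sum_distrib_right exp_minus divide_inverse mult.assoc)
qed

lemma flat_exp_has_derivative:
  "(flat_exp P has_real_derivative flat_exp ([:0, 0, 1:] * (P - pderiv P)) x) (at x)"
proof -
  consider "x > 0" | "x < 0" | "x = 0" by linarith
  then show ?thesis
  proof cases
    case 1
    have "((\<lambda>x. poly P (1 / x) * exp (- (1 / x))) has_real_derivative
        flat_exp ([:0, 0, 1:] * (P - pderiv P)) x) (at x)"
      using 1 by (auto intro!: derivative_eq_intros DERIV_chain'[where g="poly P"] poly_DERIV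
          simp: flat_exp_def field_simps power2_eq_square)
    then show ?thesis
      by (rule DERIV_cong_ev[THEN iffD1, rotated -1])
        (use 1 eventually_nhds_in_open[of "{0<..}" x] in \<open>auto simp: flat_exp_def elim!: eventually_mono\<close>)
  next
    case 2
    have "((\<lambda>x. 0) has_real_derivative flat_exp ([:0, 0, 1:] * (P - pderiv P)) x) (at x)"
      using 2 by (simp add: flat_exp_def)
    then show ?thesis
      by (rule DERIV_cong_ev[THEN iffD1, rotated -1])
        (use 2 eventually_nhds_in_open[of "{..<0}" x] in \<open>auto simp: flat_exp_def elim!: eventually_mono\<close>)
  next
    case 3
    have L: "((\<lambda>h. flat_exp P h / h) \<longlongrightarrow> 0) (at_left 0)"
      by (rule tendsto_eventually) (auto simp: flat_exp_def eventually_at_left_field intro!: exI[of _ "-1"])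
    \<comment> \<open>Dividing by h multiplies the polynomial in 1/h by its variable, which gives
      \<open>pCons 0 P\<close>.\<close>
    have "((\<lambda>t. poly (pCons 0 P) t * exp (- t)) \<longlongrightarrow> 0) at_top"
      by (rule poly_mult_exp_tendsto_0)
    then have "((\<lambda>h. poly (pCons 0 P) (inverse h) * exp (- inverse h)) \<longlongrightarrow> 0) (at_right 0)"
      by (rule filterlim_compose[OF _ filterlim_inverse_at_top_right])
    then have R: "((\<lambda>h. flat_exp P h / h) \<longlongrightarrow> 0) (at_right 0)"
      by (rule Lim_transform_eventually)
        (auto simp: flat_exp_def eventually_at_right_field divide_inverse intro!: exI[of _ 1])
    from L R have "((\<lambda>h. flat_exp P h / h) \<longlongrightarrow> 0) (at 0)"
      by (simp add: filterlim_split_at)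
    then show ?thesis using 3 by (simp add: DERIV_def flat_exp_def)
  qed
qed

lemma smooth_fun_flat_exp:
  assumes "smooth_fun f"
  shows "smooth_fun (\<lambda>x. flat_exp 1 (f x))"
proof -
  define P where "P j = ((\<lambda>P. [:0, 0, 1:] * (P - pderiv P)) ^^ j) (1 :: real poly)" for j
  have P_Suc: "P (Suc j) = [:0, 0, 1:] * (P j - pderiv (P j))" for j
    by (simp only: P_def funpow.simps o_def)
  have "smooth_fun (\<lambda>x. flat_exp (P 0) (f x))"
    by (rule smooth_fun_compose[where g="\<lambda>j. flat_exp (P j)", OF _ assms])
      (simp only: P_Suc flat_exp_has_derivative)
  then show ?thesis by (simp add: P_def)
qed

text \<open>The variable t stands for |x - a|^2 / s^2, so the interval (1, 4) is the annulus s < |x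
  - a| < 2s. The squared norm keeps the cutoff smooth at its center.\<close>

definition bump_density :: "real \<Rightarrow> real" where
  "bump_density t = flat_exp 1 (t - 1) * flat_exp 1 (4 - t)"

text \<open>The center of a bump corresponds to t = 0. Starting the integral at -1 makes 0 an
  interior point, so that the derivative there is two-sided.\<close>

definition bump_primitive :: "real \<Rightarrow> real" where
  "bump_primitive t = integral {-1..t} bump_density"

definition bump :: "real^'n::finite \<Rightarrow> real \<Rightarrow> real^'n \<Rightarrow> real" where
  "bump a s x = 1 - bump_primitive ((1 / s\<^sup>2) * (norm (x - a))\<^sup>2) / bump_primitive 4"

lemma bump_density_bounds: "0 \<le> bump_density t" "bump_density t \<le> 1"
proof -
  have "0 \<le> flat_exp 1 x \<and> flat_exp 1 x \<le> 1" for x by (simp add: flat_exp_def)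
  then show "0 \<le> bump_density t" "bump_density t \<le> 1"
    unfolding bump_density_def by (auto intro!: mult_le_one)
qed

lemma bump_density_eq_0: "t \<le> 1 \<or> t \<ge> 4 \<Longrightarrow> bump_density t = 0"
  by (auto simp: bump_density_def flat_exp_def)

lemma bump_density_continuous: "continuous_on A bump_density"
proof -
  have "continuous_on B (flat_exp 1)" for B
    by (rule continuous_at_imp_continuous_on) (auto intro: DERIV_isCont flat_exp_has_derivative)
  then have *: "continuous_on A (\<lambda>t. flat_exp 1 (f t))" if "continuous_on A f" for f
    using continuous_on_compose2[of UNIV "flat_exp 1" A f] that by auto
  show ?thesis unfolding bump_density_def by (intro continuous_intros *)
qed

lemma bump_density_integrable: "bump_density integrable_on {a..b}"
  by (intro integrable_continuous_real bump_density_continuous)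

lemma bump_primitive_has_derivative:
  assumes "t > -1"
  shows "(bump_primitive has_real_derivative bump_density t) (at t)"
proof -
  have "(bump_primitive has_real_derivative bump_density t) (at t within {-1..t+1})"
    unfolding bump_primitive_def
    using assms by (intro integral_has_real_derivative bump_density_continuous) auto
  then show ?thesis using assms by (simp add: at_within_Icc_at)
qed

lemma bump_primitive_low: "t \<le> 1 \<Longrightarrow> bump_primitive t = 0"
  unfolding bump_primitive_def by (subst integral_cong[where g="\<lambda>_. 0"]) (auto simp: bump_density_eq_0)

lemma bump_primitive_high: "t \<ge> 4 \<Longrightarrow> bump_primitive t = bump_primitive 4"
proof -
  assume t: "t \<ge> 4"
  have "integral {-1..4} bump_density + integral {4..t} bump_density = integral {-1..t} bump_density"
    using t by (intro Henstock_Kurzweil_Integration.integral_combine bump_density_integrable) auto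
  moreover have "integral {4..t} bump_density = 0"
    by (subst integral_cong[where g="\<lambda>_. 0"]) (auto simp: bump_density_eq_0)
  ultimately show ?thesis by (simp add: bump_primitive_def)
qed

lemma bump_primitive_pos: "bump_primitive 4 > 0"
proof -
  have "bump_density 2 \<noteq> 0" by (simp add: bump_density_def flat_exp_def)
  then have "bump_primitive 4 \<noteq> 0"
    unfolding bump_primitive_def
    by (subst integral_eq_0_iff) (auto intro: bump_density_continuous bump_density_bounds intro!: bexI[of _ 2])
  moreover have "bump_primitive 4 \<ge> 0"
    unfolding bump_primitive_def by (intro integral_nonneg bump_density_integrable bump_density_bounds)
  ultimately show ?thesis by simp
qed

lemma bump_primitive_bounds: "0 \<le> bump_primitive t" "bump_primitive t \<le> bump_primitive 4"
proof -
  show "0 \<le> bump_primitive t"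
    unfolding bump_primitive_def by (intro integral_nonneg bump_density_integrable bump_density_bounds)
  show "bump_primitive t \<le> bump_primitive 4"
  proof (cases "t \<le> 4")
    case True
    then show ?thesis unfolding bump_primitive_def
      by (intro integral_subset_le bump_density_integrable) (auto simp: bump_density_bounds)
  qed (use bump_primitive_high[of t] in simp)
qed

lemma bump_bounds: "0 \<le> bump a s x" "bump a s x \<le> 1"
  unfolding bump_def using bump_primitive_pos
  by (simp_all add: divide_le_eq_1_pos bump_primitive_bounds)

lemma bump_eq_1: "s > 0 \<Longrightarrow> norm (x - a) \<le> s \<Longrightarrow> bump a s x = 1"
  by (simp add: bump_def bump_primitive_low power_mono)

lemma bump_eq_0:
  assumes "s > 0" "norm (x - a) \<ge> 2 * s" shows "bump a s x = 0"
proof -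
  have "(2 * s)\<^sup>2 \<le> (norm (x - a))\<^sup>2" using assms by (intro power_mono) auto
  then have "(1 / s\<^sup>2) * (norm (x - a))\<^sup>2 \<ge> 4" using assms by (simp add: field_simps)
  then show ?thesis using bump_primitive_pos unfolding bump_def by (subst bump_primitive_high) auto
qed

lemma bump_translate: "bump a s x = bump 0 s (x - a)"
  and bump_reflect: "bump 0 s (- y) = bump 0 s y"
  by (simp_all add: bump_def)

lemma bump_has_derivative:
  fixes a x :: "real^'n" and s :: real
  defines "r \<equiv> (1 / s\<^sup>2) * (norm (x - a))\<^sup>2"
  shows "(bump a s has_derivative (\<lambda>h. (- (bump_density r / bump_primitive 4) * (2 / s\<^sup>2)) *\<^sub>R (x - a) \<bullet> h)) (at x)"
proof -
  have "r \<ge> 0" by (simp add: r_def)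
  then have "(bump_primitive has_real_derivative bump_density r) (at r)"
    by (intro bump_primitive_has_derivative) simp
  then have d: "((\<lambda>t. 1 - bump_primitive t / bump_primitive 4) has_derivative
      (*) (- (bump_density r / bump_primitive 4))) (at r)"
    unfolding has_field_derivative_def[symmetric]
    by (auto intro!: derivative_eq_intros simp: bump_primitive_pos[THEN less_imp_neq, symmetric])
  have "((\<lambda>x. (1 / s\<^sup>2) * ((x - a) \<bullet> (x - a))) has_derivative (\<lambda>h. (1 / s\<^sup>2) * ((x - a) \<bullet> h + h \<bullet> (x - a)))) (at x)"
    by (intro has_derivative_mult_right has_derivative_eq_rhs[OF has_derivative_inner[of "\<lambda>x. x - a" "\<lambda>h. h" _ _ "\<lambda>x. x - a" "\<lambda>h. h"]])
      (auto intro!: derivative_eq_intros)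
  then have "((\<lambda>x. (1 / s\<^sup>2) * (norm (x - a))\<^sup>2) has_derivative (\<lambda>h. (1 / s\<^sup>2) * ((x - a) \<bullet> h + h \<bullet> (x - a)))) (at x)"
    by (simp add: power2_norm_eq_inner)
  from has_derivative_compose[OF this d[unfolded r_def]] show ?thesis
    unfolding bump_def[abs_def] r_def[symmetric]
    by (rule has_derivative_eq_rhs) (auto simp: inner_commute algebra_simps)
qed

lemma grad_bump:
  "grad (bump a s) x = (- (bump_density ((1 / s\<^sup>2) * (norm (x - a))\<^sup>2) / bump_primitive 4) * (2 / s\<^sup>2)) *\<^sub>R (x - a)"
  by (rule grad_unique[OF bump_has_derivative])

lemma grad_bump_eq_0:
  assumes "s > 0" "norm (x - a) \<le> s \<or> norm (x - a) \<ge> 2 * s"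
  shows "grad (bump a s) x = 0"
proof -
  have "(1 / s\<^sup>2) * (norm (x - a))\<^sup>2 \<le> 1 \<or> (1 / s\<^sup>2) * (norm (x - a))\<^sup>2 \<ge> 4"
    using assms(2)
  proof
    assume "norm (x - a) \<le> s"
    then have "(norm (x - a))\<^sup>2 \<le> s\<^sup>2" by (intro power_mono) auto
    then show ?thesis using assms by simp
  next
    assume "norm (x - a) \<ge> 2 * s"
    then have "(2 * s)\<^sup>2 \<le> (norm (x - a))\<^sup>2" using assms by (intro power_mono) auto
    then show ?thesis using assms by (simp add: field_simps)
  qed
  then show ?thesis by (simp add: grad_bump bump_density_eq_0)
qed

text \<open>On the annulus the factor 2/s^2 meets |x - a| < 2s, and the density is at most 1; the
  order 1/s is what makes the energy of a bump scale like s^(n-p).\<close>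

lemma norm_grad_bump_le:
  assumes "s > 0"
  shows "norm (grad (bump a s) x) \<le> 4 / bump_primitive 4 / s"
proof (cases "norm (x - a) \<ge> 2 * s")
  case False
  have "norm (grad (bump a s) x) = bump_density ((1 / s\<^sup>2) * (norm (x - a))\<^sup>2) * (1 / bump_primitive 4 * (2 / s\<^sup>2) * norm (x - a))"
    using bump_primitive_pos bump_density_bounds by (simp add: grad_bump abs_mult)
  also have "\<dots> \<le> 1 * (1 / bump_primitive 4 * (2 / s\<^sup>2) * (2 * s))"
    using False bump_primitive_pos bump_density_bounds by (intro mult_mono) auto
  also have "\<dots> = 4 / bump_primitive 4 / s"
    using assms by (simp add: power2_eq_square)
  finally show ?thesis .
qed (use assms bump_primitive_pos grad_bump_eq_0[of s x a] in auto)

text \<open>Only the first derivative has to deal with the integral in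
  \<open>bump_primitive\<close>. The partial derivatives are explicit products of flat exponentials
  and polynomials, to which the closure rules apply.\<close>

lemma smooth_fun_bump: "smooth_fun (bump a s)"
proof -
  have r: "smooth_fun (\<lambda>x. (1 / s\<^sup>2) * (norm (x - a))\<^sup>2)"
    by (intro smooth_fun_mult smooth_fun_const smooth_fun_norm_sq)
  have pd: "pd i (bump a s) = (\<lambda>x. (flat_exp 1 ((1 / s\<^sup>2) * (norm (x - a))\<^sup>2 - 1) * flat_exp 1 (4 - (1 / s\<^sup>2) * (norm (x - a))\<^sup>2))
      * (- (1 / bump_primitive 4) * (2 / s\<^sup>2)) * (x $ i - a $ i))" for i
    by (rule ext, subst has_derivative_pd[OF bump_has_derivative]) (simp add: inner_axis bump_density_def)
  have "smooth_fun (pd i (bump a s))" for i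
    unfolding pd by (intro smooth_fun_mult smooth_fun_flat_exp smooth_fun_diff smooth_fun_coord smooth_fun_const smooth_fun_norm_sq)
  then have "Ck k (pd i (bump a s))" for k i by (simp add: smooth_fun_iff_Ck)
  moreover have "bump a s differentiable (at x)" for x
    using bump_has_derivative differentiable_def by blast
  ultimately have "Ck k (bump a s)" for k by (cases k) auto
  then show ?thesis by (simp add: smooth_fun_iff_Ck)
qed

lemma test_fun_bump:
  assumes "s > 0" "cball a (2 * s) \<subseteq> \<Omega>"
  shows "test_fun \<Omega> (bump a s)"
  by (rule test_funI[of _ "cball a (2 * s)"])
    (use assms in \<open>auto simp: smooth_fun_bump dist_norm norm_minus_commute intro!: bump_eq_0\<close>)

section \<open>Convexity of powers of the norm\<close>

lemma norm_add_powr_le: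
  fixes a b :: "'a::real_normed_vector"
  assumes "p \<ge> 0"
  shows "norm (a + b) powr p \<le> 2 powr p * (norm a powr p + norm b powr p)"
proof -
  have "norm (a + b) powr p \<le> (2 * max (norm a) (norm b)) powr p"
    using norm_triangle_ineq[of a b] assms by (intro powr_mono2) auto
  also have "\<dots> = 2 powr p * max (norm a) (norm b) powr p"
    by (simp add: powr_mult)
  also have "\<dots> \<le> 2 powr p * (norm a powr p + norm b powr p)"
    by (intro mult_left_mono) (auto simp: max_def)
  finally show ?thesis .
qed

lemma norm_diff_powr_le:
  fixes a b :: "'a::real_normed_vector"
  assumes "p \<ge> 0"
  shows "norm (a - b) powr p \<le> 2 powr p * (norm a powr p + norm b powr p)"
  using norm_add_powr_le[OF assms, of a "- b"] by simp

text \<open>Young's inequality with a small factor: if t is at most \<epsilon> s, the first term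
  suffices; otherwise s is at most t/\<epsilon> and the second one does.\<close>

lemma powr_mult_le_eps:
  fixes p \<epsilon> :: real
  assumes "p > 1" "\<epsilon> > 0"
  obtains K where "K \<ge> 0"
    "\<And>s t. s \<ge> 0 \<Longrightarrow> t \<ge> 0 \<Longrightarrow> s powr (p - 1) * t \<le> \<epsilon> * s powr p + K * t powr p"
proof
  define K where "K = (1 / \<epsilon>) powr (p - 1)"
  show "K \<ge> 0" by (simp add: K_def)
  fix s t :: real assume st: "s \<ge> 0" "t \<ge> 0"
  have pw: "x powr p = x powr (p - 1) * x" if "x \<ge> 0" for x :: real
    using powr_add[of x "p - 1" 1] that by (cases "x = 0") auto
  show "s powr (p - 1) * t \<le> \<epsilon> * s powr p + K * t powr p"
  proof (cases "t \<le> \<epsilon> * s")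
    case True
    then have "s powr (p - 1) * t \<le> s powr (p - 1) * (\<epsilon> * s)" by (intro mult_left_mono) auto
    also have "\<dots> = \<epsilon> * s powr p" using pw[OF st(1)] by simp
    finally show ?thesis using st by (simp add: K_def add_increasing2)
  next
    case False
    then have "s \<le> (1 / \<epsilon>) * t" using assms by (simp add: field_simps)
    then have "s powr (p - 1) \<le> ((1 / \<epsilon>) * t) powr (p - 1)"
      using assms st by (intro powr_mono2) auto
    also have "\<dots> = K * t powr (p - 1)" unfolding K_def using assms st by (intro powr_mult)
    finally have "s powr (p - 1) * t \<le> K * t powr (p - 1) * t" using st by (intro mult_right_mono)
    also have "\<dots> = K * t powr p" using pw[OF st(2)] by simp
    finally show ?thesis using assms by (simp add: add_increasing)
  qed
qed

text \<open>Hoelder's inequality before integration: the free level s is chosen only after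
  integrating, in \<open>integral_powr_le\<close>.\<close>

lemma powr_interpolate:
  fixes a s :: real
  assumes "0 < p" "p < q" "s > 0" "a \<ge> 0"
  shows "a powr p \<le> s powr p + s powr (p - q) * a powr q"
proof (cases "a \<le> s")
  case True
  then have "a powr p \<le> s powr p" using assms by (intro powr_mono2) auto
  then show ?thesis by (simp add: add_increasing2)
next
  case False
  have "a powr p = a powr (p - q) * a powr q" using False assms by (simp flip: powr_add)
  also have "\<dots> \<le> s powr (p - q) * a powr q"
    using False assms by (intro mult_right_mono powr_mono2') auto
  finally show ?thesis by (simp add: add_increasing)
qed

text \<open>The mean value theorem on the two halves of [u, v], together with the strict growth of
  the derivative; it asks for differentiability in the interior only, which admits u = 0.\<close>

lemma powr_midpoint_less:
  fixes u v :: real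
  assumes "p > 1" "0 \<le> u" "u < v"
  shows "((u + v) / 2) powr p < (u powr p + v powr p) / 2"
proof -
  define m where "m = (u + v) / 2"
  have m: "u < m" "m < v" "m - u = v - m" using assms by (auto simp: m_def field_simps)
  have mvt: "\<exists>z. a < z \<and> z < b \<and> b powr p - a powr p = (b - a) * (p * z powr (p - 1))"
    if "0 \<le> a" "a < b" for a b :: real
  proof -
    have "\<exists>l z. a < z \<and> z < b \<and> ((\<lambda>x. x powr p) has_real_derivative l) (at z) \<and>
        b powr p - a powr p = (b - a) * l"
    proof (rule MVT)
      show "continuous_on {a..b} (\<lambda>x. x powr p)"
        using that assms by (intro continuous_on_powr' continuous_intros) auto
      show "(\<lambda>x. x powr p) differentiable (at x)" if "a < x" "x < b" for x
        using has_real_derivative_powr[of x p] that \<open>0 \<le> a\<close>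
        by (auto simp: real_differentiable_def)
    qed (use that in auto)
    then obtain l z where lz: "a < z" "z < b" "((\<lambda>x. x powr p) has_real_derivative l) (at z)"
      "b powr p - a powr p = (b - a) * l" by blast
    with has_real_derivative_powr[of z p] that have "l = p * z powr (p - 1)"
      by (auto intro: DERIV_unique)
    with lz show ?thesis by blast
  qed
  obtain y where y: "u < y" "y < m" "m powr p - u powr p = (m - u) * (p * y powr (p - 1))"
    using mvt[of u m] assms m by auto
  obtain z where z: "m < z" "z < v" "v powr p - m powr p = (v - m) * (p * z powr (p - 1))"
    using mvt[of m v] assms m by auto
  have "y powr (p - 1) < z powr (p - 1)"
    using y z assms by (intro powr_less_mono2) auto
  then have "(m - u) * (p * y powr (p - 1)) < (v - m) * (p * z powr (p - 1))"
    unfolding m(3) using m assms by simp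
  then show ?thesis using y z by (simp add: m_def)
qed

text \<open>For equal norms the parallelogram law makes the midpoint strictly shorter; for different
  norms the strict convexity of the real power does it.\<close>

lemma norm_midpoint_powr_less:
  fixes a b :: "'a::real_inner"
  assumes "p > 1" "a \<noteq> b"
  shows "norm ((1/2) *\<^sub>R (a + b)) powr p < (norm a powr p + norm b powr p) / 2"
proof (cases "norm a = norm b")
  case True
  have par: "(norm (a + b))\<^sup>2 = 2 * (norm a)\<^sup>2 + 2 * (norm b)\<^sup>2 - (norm (a - b))\<^sup>2"
    by (simp add: power2_norm_eq_inner inner_add inner_diff algebra_simps inner_commute)
  have "(norm (a - b))\<^sup>2 > 0" using assms by simp
  with par True have "(norm (a + b))\<^sup>2 < (2 * norm a)\<^sup>2" by (simp add: power_mult_distrib)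
  then have "norm (a + b) < 2 * norm a" by (rule power2_less_imp_less) simp
  then have "norm ((1/2) *\<^sub>R (a + b)) < norm a" by simp
  then have "norm ((1/2) *\<^sub>R (a + b)) powr p < norm a powr p"
    using assms by (intro powr_less_mono2) auto
  then show ?thesis using True by simp
next
  case False
  have "norm ((1/2) *\<^sub>R (a + b)) powr p \<le> ((norm a + norm b) / 2) powr p"
    using norm_triangle_ineq[of a b] assms by (intro powr_mono2) auto
  also have "\<dots> < (norm a powr p + norm b powr p) / 2"
  proof (cases "norm a < norm b")
    case True
    then show ?thesis using powr_midpoint_less[of p "norm a" "norm b"] assms by simp
  next
    case b: False
    then show ?thesis using powr_midpoint_less[of p "norm b" "norm a"] assms False
      by (simp add: add.commute)
  qed
  finally show ?thesis .
qed

text \<open>A compactness argument in finite dimension takes the place of Clarkson's inequalities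
  and treats p < 2 and p \<ge> 2 alike: on normalized pairs that are not close, the convexity defect
  is positive and attains its minimum.\<close>

lemma norm_powr_uniformly_convex:
  assumes "p > 1" "\<epsilon> > 0"
  obtains K where "K \<ge> 0" "\<And>a b :: 'a::euclidean_space.
    norm (a - b) powr p \<le> \<epsilon> * (norm a powr p + norm b powr p)
      + K * ((norm a powr p + norm b powr p) / 2 - norm ((1/2) *\<^sub>R (a + b)) powr p)"
proof -
  define T where "T = (\<lambda>(a::'a, b::'a). norm a powr p + norm b powr p)"
  define D where "D = (\<lambda>(a::'a, b::'a). (norm a powr p + norm b powr p) / 2 - norm ((1/2) *\<^sub>R (a + b)) powr p)"
  define S where "S = {x. T x = 1 \<and> norm (fst x - snd x) powr p \<ge> \<epsilon>}"
  have contn: "continuous_on UNIV (\<lambda>x. norm (f x) powr p)"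
    if "continuous_on UNIV f" for f :: "'a \<times> 'a \<Rightarrow> 'a"
    using that assms by (intro continuous_on_powr' continuous_intros) auto
  have contT: "continuous_on UNIV T" and contD: "continuous_on UNIV D"
    unfolding T_def D_def case_prod_beta by (intro continuous_intros contn)+ auto
  have "closed S"
  proof -
    have "S = T -` {1} \<inter> (\<lambda>x. norm (fst x - snd x) powr p) -` {\<epsilon>..}" by (auto simp: S_def)
    moreover have "closed \<dots>"
      by (intro closed_Int closed_vimage contT contn continuous_intros)
    ultimately show ?thesis by simp
  qed
  have le1: "x \<le> 1" if "x powr p \<le> 1" "x \<ge> 0" for x :: real
    using that assms powr_mono[of 1 p x] by (cases "x \<le> 1") auto
  moreover have "bounded S"
  proof (rule boundedI)
    fix x assume "x \<in> S"
    then have "norm (fst x) powr p + norm (snd x) powr p = 1" by (auto simp: S_def T_def case_prod_beta)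
    then have "norm (fst x) powr p \<le> 1" "norm (snd x) powr p \<le> 1"
      by (smt (verit) powr_ge_zero)+
    then have "norm (fst x) \<le> 1" "norm (snd x) \<le> 1" by (auto intro: le1)
    then show "norm x \<le> 2" using norm_fst_le norm_snd_le norm_Pair_le[of "fst x" "snd x"] by auto
  qed
  ultimately have "compact S" using \<open>closed S\<close> by (simp add: compact_eq_bounded_closed)
  have Dpos: "D x > 0" if "fst x \<noteq> snd x" for x
    using norm_midpoint_powr_less[OF assms(1) that] by (simp add: D_def case_prod_beta)
  have Dnn: "D x \<ge> 0" for x
    using Dpos[of x] by (cases "fst x = snd x") (auto simp: D_def case_prod_beta scaleR_2[symmetric])
  have "\<exists>\<delta>>0. \<forall>x\<in>S. \<delta> \<le> D x"
  proof (cases "S = {}")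
    case True then show ?thesis by (auto intro: exI[of _ 1])
  next
    case False
    then obtain y where y: "y \<in> S" "\<And>x. x \<in> S \<Longrightarrow> D y \<le> D x"
      using continuous_attains_inf[OF \<open>compact S\<close> False, of D] contD continuous_on_subset by blast
    have "fst y \<noteq> snd y" using y(1) assms by (auto simp: S_def)
    then show ?thesis using y Dpos by blast
  qed
  then obtain \<delta> where \<delta>: "\<delta> > 0" "\<And>x. x \<in> S \<Longrightarrow> \<delta> \<le> D x" by blast
  \<comment> \<open>On \<open>S\<close> the left-hand side is at most 2^p while the defect
    \<open>D\<close> is at least \<delta>.\<close>
  define K where "K = 2 powr p / \<delta>"
  show ?thesis
  proof
    show "K \<ge> 0" using \<delta> by (simp add: K_def)
    fix a b :: 'a
    \<comment> \<open>All terms are homogeneous of degree p, so dividing the pair by s reduces the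
      claim to \<open>T\<close> = 1.\<close>
    define s where "s = T (a, b) powr (1 / p)"
    have Tnn: "T (a, b) \<ge> 0" by (simp add: T_def)
    have sp: "s powr p = T (a, b)" using assms Tnn by (simp add: s_def powr_powr)
    show "norm (a - b) powr p \<le> \<epsilon> * (norm a powr p + norm b powr p)
      + K * ((norm a powr p + norm b powr p) / 2 - norm ((1/2) *\<^sub>R (a + b)) powr p)"
    proof (cases "T (a, b) = 0")
      case True
      then have "norm a powr p = 0" "norm b powr p = 0"
        by (auto simp: T_def add_nonneg_eq_0_iff)
      then show ?thesis by simp
    next
      case False
      then have s: "s > 0" using Tnn by (simp add: s_def)
      define c d where "c = (1 / s) *\<^sub>R a" and "d = (1 / s) *\<^sub>R b"
      have ab: "a = s *\<^sub>R c" "b = s *\<^sub>R d" using s by (auto simp: c_def d_def)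
      have scale: "norm (s *\<^sub>R x) powr p = T (a, b) * norm x powr p" for x :: 'a
        using s sp by (simp add: powr_mult)
      have "T (a, b) = T (a, b) * norm c powr p + T (a, b) * norm d powr p"
        unfolding scale[symmetric] using ab by (simp add: T_def)
      then have "T (a, b) * (norm c powr p + norm d powr p) = T (a, b) * 1"
        by (simp only: distrib_left mult_1_right)
      then have T1: "T (c, d) = 1"
        using False unfolding mult_cancel_left by (simp add: T_def)
      have main: "norm (c - d) powr p \<le> \<epsilon> * T (c, d) + K * D (c, d)"
      proof (cases "norm (c - d) powr p \<ge> \<epsilon>")
        case True
        then have "(c, d) \<in> S" using T1 by (simp add: S_def)
        then have "\<delta> \<le> D (c, d)" by (rule \<delta>)
        have "norm (c - d) powr p \<le> 2 powr p * T (c, d)"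
          using norm_diff_powr_le[of p c d] assms by (simp add: T_def)
        also have "\<dots> \<le> K * D (c, d)"
          using \<open>\<delta> \<le> D (c, d)\<close> \<delta>(1) T1 by (simp add: K_def field_simps)
        finally show ?thesis using T1 assms by simp
      next
        case False
        then show ?thesis using T1 Dnn[of "(c, d)"] \<open>K \<ge> 0\<close> by (simp add: add_increasing2)
      qed
      have "norm (a - b) powr p = T (a, b) * norm (c - d) powr p"
        unfolding scale[symmetric] using ab by (simp add: scaleR_right_diff_distrib)
      moreover have "D (a, b) = T (a, b) * D (c, d)"
      proof -
        have "norm a powr p = T (a, b) * norm c powr p" "norm b powr p = T (a, b) * norm d powr p"
          using scale[of c] scale[of d] ab by auto
        moreover have "norm ((1/2) *\<^sub>R (a + b)) powr p = T (a, b) * norm ((1/2) *\<^sub>R (c + d)) powr p"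
          unfolding scale[symmetric] using ab by (simp add: scaleR_right_distrib)
        ultimately show ?thesis unfolding D_def by (simp only: case_prod_conv) (simp add: algebra_simps)
      qed
      ultimately have "norm (a - b) powr p \<le> \<epsilon> * T (a, b) + K * D (a, b)"
        using mult_left_mono[OF main Tnn] T1 by (simp add: algebra_simps)
      then show ?thesis by (simp add: T_def D_def)
    qed
  qed
qed

text \<open>The integrand of the weak p-Laplacian, which is the derivative of |a|^p / p in direction
  b. Since the reals are an inner product space, the same form serves the gradients and the
  \<mu>-term. It is 0 at a = 0 even for p < 2.\<close>

definition p_form :: "real \<Rightarrow> 'a::real_inner \<Rightarrow> 'a \<Rightarrow> real" where
  "p_form p a b = norm a powr (p - 2) * (a \<bullet> b)"

lemma abs_p_form_le: "\<bar>p_form p a b\<bar> \<le> norm a powr (p - 1) * norm b"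
proof (cases "a = 0")
  case False
  have "\<bar>p_form p a b\<bar> \<le> norm a powr (p - 2) * (norm a * norm b)"
    unfolding p_form_def abs_mult using Cauchy_Schwarz_ineq2[of a b] by (auto intro!: mult_left_mono)
  also have "\<dots> = norm a powr (p - 1) * norm b"
    using False powr_add[of "norm a" "p - 2" 1] by simp
  finally show ?thesis .
qed (simp add: p_form_def)

lemma p_form_self: "p_form p a a = norm a powr p"
proof (cases "a = 0")
  case False
  then show ?thesis using powr_add[of "norm a" "p - 2" 2]
    by (simp add: p_form_def dot_square_norm powr_numeral)
qed (simp add: p_form_def)

text \<open>Convexity of |a|^p as "graph above tangent". It follows from Cauchy-Schwarz and Young's
  inequality for the exponents p and p/(p - 1), without differentiating the norm.\<close>

lemma norm_powr_tangent:
  fixes a b :: "'a::real_inner"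
  assumes "p > 1"
  shows "norm a powr p + p * p_form p a b \<le> norm (a + b) powr p"
proof -
  have "p_form p a (a + b) \<le> norm (a + b) * norm a powr (p - 1)"
    using abs_p_form_le[of p a "a + b"] by (simp add: mult.commute)
  also have "\<dots> \<le> norm (a + b) powr p / p + (norm a powr (p - 1)) powr (p / (p - 1)) / (p / (p - 1))"
    using assms by (intro Youngs_inequality) (auto simp: field_simps)
  also have "(norm a powr (p - 1)) powr (p / (p - 1)) = norm a powr p"
    using assms by (simp add: powr_powr)
  finally have "p * p_form p a (a + b) \<le> norm (a + b) powr p + (p - 1) * norm a powr p"
    using assms by (simp add: field_simps)
  moreover have "p_form p a (a + b) = norm a powr p + p_form p a b"
    using p_form_self[of p a] by (simp add: p_form_def inner_add_right algebra_simps)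
  ultimately show ?thesis by (simp add: algebra_simps)
qed

text \<open>The upper estimate is the tangent inequality at a + b in direction -b, the lower one the
  tangent inequality at a in direction b.\<close>

lemma norm_add_powr_perturb:
  assumes "p > 1" "\<epsilon> > 0"
  obtains K where "K \<ge> 0" "\<And>a b :: 'a::real_inner.
    \<bar>norm (a + b) powr p - norm a powr p\<bar> \<le> \<epsilon> * norm a powr p + K * norm b powr p"
proof -
  \<comment> \<open>Splitting |a + b|^p costs a factor 2^p and the tangent a factor p; this \<delta>
    absorbs both.\<close>
  define \<delta> where "\<delta> = \<epsilon> / (p * 2 powr p)"
  have \<delta>: "\<delta> > 0" "p * (\<delta> * 2 powr p) = \<epsilon>" using assms by (auto simp: \<delta>_def)
  obtain K where K: "K \<ge> 0"
    "\<And>s t. s \<ge> 0 \<Longrightarrow> t \<ge> 0 \<Longrightarrow> s powr (p - 1) * t \<le> \<delta> * s powr p + K * t powr p"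
    using powr_mult_le_eps[OF assms(1) \<delta>(1)] by metis
  have form: "p * \<bar>p_form p a b\<bar> \<le> p * (\<delta> * norm a powr p + K * norm b powr p)" for a b :: 'a
    using assms by (intro mult_left_mono order_trans[OF abs_p_form_le K(2)]) auto
  show ?thesis
  proof
    show "\<epsilon> + p * K \<ge> 0" using assms K(1) by simp
    fix a b :: 'a
    have "norm (a + b) powr p - norm a powr p \<le> p * \<bar>p_form p (a + b) b\<bar>"
    proof -
      have "p_form p (a + b) (- b) = - p_form p (a + b) b" by (simp add: p_form_def)
      moreover have "p * p_form p (a + b) b \<le> p * \<bar>p_form p (a + b) b\<bar>"
        using assms(1) by (intro mult_left_mono) auto
      ultimately show ?thesis using norm_powr_tangent[OF assms(1), of "a + b" "- b"] by simp
    qed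
    also have "\<dots> \<le> p * (\<delta> * (2 powr p * (norm a powr p + norm b powr p)) + K * norm b powr p)"
      using norm_add_powr_le[of p a b] \<delta>(1) assms(1)
      by (intro order_trans[OF form] mult_left_mono add_right_mono) auto
    also have "\<dots> = p * (\<delta> * 2 powr p) * (norm a powr p + norm b powr p) + p * K * norm b powr p"
      by (simp add: algebra_simps)
    finally have 1: "norm (a + b) powr p - norm a powr p \<le> \<epsilon> * norm a powr p + (\<epsilon> + p * K) * norm b powr p"
      unfolding \<delta>(2) by (simp add: algebra_simps)
    have "norm a powr p - norm (a + b) powr p \<le> p * \<bar>p_form p a b\<bar>"
    proof -
      have "p * - p_form p a b \<le> p * \<bar>p_form p a b\<bar>"
        using assms(1) by (intro mult_left_mono) auto
      then show ?thesis using norm_powr_tangent[OF assms(1), of a b] by simp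
    qed
    also have "\<dots> \<le> p * \<delta> * norm a powr p + p * K * norm b powr p"
      using form[of a b] by (simp add: algebra_simps)
    also have "\<dots> \<le> \<epsilon> * norm a powr p + (\<epsilon> + p * K) * norm b powr p"
    proof (intro add_mono mult_right_mono)
      have "p * \<delta> * 1 \<le> p * \<delta> * 2 powr p"
        using assms \<delta>(1) by (intro mult_left_mono ge_one_powr_ge_zero) auto
      then show "p * \<delta> \<le> \<epsilon>" using \<delta>(2) by (simp add: mult.assoc)
    qed (use assms in auto)
    finally show "\<bar>norm (a + b) powr p - norm a powr p\<bar> \<le> \<epsilon> * norm a powr p + (\<epsilon> + p * K) * norm b powr p"
      using 1 by (simp add: abs_le_iff)
  qed
qed

section \<open>\<open>p\<close>-integrable functions\<close>

definition Lp :: "'a measure \<Rightarrow> real \<Rightarrow> ('a \<Rightarrow> 'b::euclidean_space) \<Rightarrow> bool" where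
  "Lp M p f \<longleftrightarrow> f \<in> borel_measurable M \<and> integrable M (\<lambda>x. norm (f x) powr p)"

text \<open>The p-th power of the norm, with no root taken: a triangle inequality with the factor
  2^p replaces Minkowski's. The integral defaults to 0 for functions that are not integrable, hence
  the separate predicate \<open>Lp\<close>.\<close>

definition pint :: "'a measure \<Rightarrow> real \<Rightarrow> ('a \<Rightarrow> 'b::euclidean_space) \<Rightarrow> real" where
  "pint M p f = (\<integral>x. norm (f x) powr p \<partial>M)"

lemma Lp_measurable: "Lp M p f \<Longrightarrow> f \<in> borel_measurable M"
  and Lp_integrable: "Lp M p f \<Longrightarrow> integrable M (\<lambda>x. norm (f x) powr p)"
  by (auto simp: Lp_def)

lemma pint_nonneg [simp]: "0 \<le> pint M p f"
  by (simp add: pint_def)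

lemma nn_integral_pint:
  "Lp M p f \<Longrightarrow> (\<integral>\<^sup>+x. ennreal (norm (f x) powr p) \<partial>M) = ennreal (pint M p f)"
  unfolding pint_def Lp_def by (intro nn_integral_eq_integral) auto

lemma LpI_nn_integral:
  assumes "f \<in> borel_measurable M" "(\<integral>\<^sup>+x. ennreal (norm (f x) powr p) \<partial>M) \<le> ennreal c" "c \<ge> 0"
  shows "Lp M p f" "pint M p f \<le> c"
proof -
  show L: "Lp M p f"
    unfolding Lp_def using assms le_less_trans[OF assms(2) ennreal_less_top]
    by (auto intro!: integrableI_bounded)
  show "pint M p f \<le> c"
    using assms(2,3) nn_integral_pint[OF L] by simp
qed

lemma Lp_add:
  assumes "p > 0" "Lp M p f" "Lp M p g"
  shows "Lp M p (\<lambda>x. f x + g x)"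
    and "pint M p (\<lambda>x. f x + g x) \<le> 2 powr p * (pint M p f + pint M p g)"
proof -
  note [measurable] = assms(2,3)[THEN Lp_measurable]
  have i: "integrable M (\<lambda>x. 2 powr p * (norm (f x) powr p + norm (g x) powr p))"
    using assms by (auto simp: Lp_def)
  have le: "norm (f x + g x) powr p \<le> 2 powr p * (norm (f x) powr p + norm (g x) powr p)" for x
    using assms by (intro norm_add_powr_le) auto
  have i2: "integrable M (\<lambda>x. norm (f x + g x) powr p)"
    by (rule Bochner_Integration.integrable_bound[OF i]) (use le in \<open>auto intro: order_trans\<close>)
  then show "Lp M p (\<lambda>x. f x + g x)" by (simp add: Lp_def)
  have "pint M p (\<lambda>x. f x + g x) \<le> (\<integral>x. 2 powr p * (norm (f x) powr p + norm (g x) powr p) \<partial>M)"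
    unfolding pint_def by (intro integral_mono i i2 le)
  also have "\<dots> = 2 powr p * (pint M p f + pint M p g)"
    using assms by (simp add: pint_def Lp_def)
  finally show "pint M p (\<lambda>x. f x + g x) \<le> 2 powr p * (pint M p f + pint M p g)" .
qed

lemma Lp_scale:
  assumes "Lp M p f"
  shows "Lp M p (\<lambda>x. c *\<^sub>R f x)" and "pint M p (\<lambda>x. c *\<^sub>R f x) = \<bar>c\<bar> powr p * pint M p f"
  using assms by (auto simp: Lp_def pint_def powr_mult)

lemma Lp_mult:
  fixes f :: "'a \<Rightarrow> real"
  assumes "Lp M p f"
  shows "Lp M p (\<lambda>x. c * f x)" and "pint M p (\<lambda>x. c * f x) = \<bar>c\<bar> powr p * pint M p f"
  using Lp_scale[OF assms, of c] by auto

lemma pint_uminus: "pint M p (\<lambda>x. - f x) = pint M p f"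
  by (simp add: pint_def)

lemma Lp_diff:
  assumes "p > 0" "Lp M p f" "Lp M p g"
  shows "Lp M p (\<lambda>x. f x - g x)"
    and "pint M p (\<lambda>x. f x - g x) \<le> 2 powr p * (pint M p f + pint M p g)"
  using Lp_add[OF assms(1,2), of "\<lambda>x. - g x"] assms(3) by (auto simp: pint_uminus Lp_def)

text \<open>K depends on p and \<epsilon> only, not on the measure or the functions; this uniformity
  is what gives limits along sequences.\<close>

lemma pint_perturb:
  assumes "p > 1" "\<epsilon> > 0"
  obtains K where "K \<ge> 0" "\<And>M. \<And>f g :: 'a \<Rightarrow> 'b::euclidean_space. Lp M p f \<Longrightarrow> Lp M p g \<Longrightarrow>
    \<bar>pint M p f - pint M p g\<bar> \<le> \<epsilon> * pint M p g + K * pint M p (\<lambda>x. f x - g x)"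
proof -
  obtain K where K: "K \<ge> 0" "\<And>a b :: 'b.
    \<bar>norm (a + b) powr p - norm a powr p\<bar> \<le> \<epsilon> * norm a powr p + K * norm b powr p"
    using norm_add_powr_perturb[OF assms] by metis
  show ?thesis
  proof (rule that[OF K(1)])
    fix M :: "'a measure" and f g :: "'a \<Rightarrow> 'b"
    assume L: "Lp M p f" "Lp M p g"
    have "p > 0" using assms(1) by simp
    note i = L[THEN Lp_integrable] Lp_integrable[OF Lp_diff(1)[OF this L]]
    have "\<bar>pint M p f - pint M p g\<bar> = \<bar>\<integral>x. norm (f x) powr p - norm (g x) powr p \<partial>M\<bar>"
      using i by (simp add: pint_def)
    also have "\<dots> \<le> (\<integral>x. \<bar>norm (f x) powr p - norm (g x) powr p\<bar> \<partial>M)"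
      by (rule integral_abs_bound)
    also have "\<dots> \<le> (\<integral>x. \<epsilon> * norm (g x) powr p + K * norm (f x - g x) powr p \<partial>M)"
    proof (rule integral_mono)
      show "\<bar>norm (f x) powr p - norm (g x) powr p\<bar> \<le> \<epsilon> * norm (g x) powr p + K * norm (f x - g x) powr p" for x
        using K(2)[of "g x" "f x - g x"] by simp
    qed (use i in auto)
    also have "\<dots> = \<epsilon> * pint M p g + K * pint M p (\<lambda>x. f x - g x)"
      using i by (simp add: pint_def)
    finally show "\<bar>pint M p f - pint M p g\<bar> \<le> \<epsilon> * pint M p g + K * pint M p (\<lambda>x. f x - g x)" .
  qed
qed

text \<open>K may blow up as \<epsilon> tends to 0, but it multiplies a null sequence, while
  \<epsilon> multiplies a fixed bound: fix \<epsilon> first and then let k grow.\<close>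

lemma tendsto_eps_K:
  fixes a d :: "nat \<Rightarrow> real"
  assumes d: "d \<longlonglongrightarrow> 0" and "c \<ge> 0"
    and *: "\<And>\<epsilon>. \<epsilon> > 0 \<Longrightarrow> \<exists>K\<ge>0. \<forall>k. \<bar>a k - b\<bar> \<le> \<epsilon> * c + K * d k"
  shows "a \<longlonglongrightarrow> b"
proof (rule tendstoI)
  fix e :: real assume e: "e > 0"
  define \<epsilon> where "\<epsilon> = e / (2 * (c + 1))"
  have "\<epsilon> > 0" using e assms by (simp add: \<epsilon>_def)
  then obtain K where K: "K \<ge> 0" "\<And>k. \<bar>a k - b\<bar> \<le> \<epsilon> * c + K * d k" using * by blast
  have "\<epsilon> * c < e / 2 + e / 4"
    using e assms by (simp add: \<epsilon>_def field_simps add_pos_nonneg)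
  have "(\<lambda>k. K * d k) \<longlonglongrightarrow> K * 0" by (intro tendsto_intros d)
  then have "\<forall>\<^sub>F k in sequentially. K * d k < e / 4"
    using e by (intro order_tendstoD(2)[of _ 0]) auto
  then show "\<forall>\<^sub>F k in sequentially. dist (a k) b < e"
  proof eventually_elim
    case (elim k) then show ?case using K(2)[of k] \<open>\<epsilon> * c < _\<close> by (simp add: dist_real_def)
  qed
qed

lemma pint_tendsto:
  assumes "p > 1" "\<And>k. Lp M p (f k)" "Lp M p g" "(\<lambda>k. pint M p (\<lambda>x. f k x - g x)) \<longlonglongrightarrow> 0"
  shows "(\<lambda>k. pint M p (f k)) \<longlonglongrightarrow> pint M p g"
proof (rule tendsto_eps_K[OF assms(4), of "pint M p g"])
  fix \<epsilon> :: real assume "\<epsilon> > 0"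
  with pint_perturb[OF assms(1) this] assms(2,3)
  show "\<exists>K\<ge>0. \<forall>k. \<bar>pint M p (f k) - pint M p g\<bar> \<le> \<epsilon> * pint M p g + K * pint M p (\<lambda>x. f k x - g x)"
    by metis
qed simp

lemma pint_eq_0_iff:
  assumes "Lp M p f"
  shows "pint M p f = 0 \<longleftrightarrow> (AE x in M. f x = 0)"
  unfolding pint_def
  by (subst integral_nonneg_eq_0_iff_AE) (use assms in \<open>auto simp: Lp_def\<close>)

lemma Lp_p_form_integrable:
  assumes "p > 1" "Lp M p f" "Lp M p g"
  shows "integrable M (\<lambda>x. p_form p (f x) (g x))"
proof -
  note [measurable] = assms(2,3)[THEN Lp_measurable]
  obtain K where K: "K \<ge> 0"
    "\<And>s t. s \<ge> 0 \<Longrightarrow> t \<ge> 0 \<Longrightarrow> s powr (p - 1) * t \<le> 1 * s powr p + K * t powr p"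
    using powr_mult_le_eps[OF assms(1), of 1] zero_less_one by metis
  have "integrable M (\<lambda>x. 1 * norm (f x) powr p + K * norm (g x) powr p)"
    using assms by (auto simp: Lp_def)
  then show ?thesis
  proof (rule Bochner_Integration.integrable_bound)
    show "(\<lambda>x. p_form p (f x) (g x)) \<in> borel_measurable M" unfolding p_form_def by measurable
    have "\<bar>p_form p (f x) (g x)\<bar> \<le> 1 * norm (f x) powr p + K * norm (g x) powr p" for x
      by (rule order_trans[OF abs_p_form_le K(2)]) auto
    then show "AE x in M. norm (p_form p (f x) (g x)) \<le> norm (1 * norm (f x) powr p + K * norm (g x) powr p)"
      using K(1) by auto
  qed
qed

text \<open>The form is linear in its second argument, so the difference of the integrals is the
  form tested with \<open>g k - h\<close>.\<close>

lemma p_form_tendsto: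
  assumes "p > 1" "Lp M p f" "\<And>k. Lp M p (g k)" "Lp M p h"
    and "(\<lambda>k. pint M p (\<lambda>x. g k x - h x)) \<longlonglongrightarrow> 0"
  shows "(\<lambda>k. \<integral>x. p_form p (f x) (g k x) \<partial>M) \<longlonglongrightarrow> (\<integral>x. p_form p (f x) (h x) \<partial>M)"
proof (rule tendsto_eps_K[OF assms(5), of "pint M p f"])
  let ?I = "\<lambda>h. \<integral>x. p_form p (f x) (h x) \<partial>M"
  fix \<epsilon> :: real assume "\<epsilon> > 0"
  then obtain K where K: "K \<ge> 0"
    "\<And>s t. s \<ge> 0 \<Longrightarrow> t \<ge> 0 \<Longrightarrow> s powr (p - 1) * t \<le> \<epsilon> * s powr p + K * t powr p"
    using powr_mult_le_eps[OF assms(1)] by metis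
  have "\<bar>?I (g k) - ?I h\<bar>
    \<le> \<epsilon> * pint M p f + K * pint M p (\<lambda>x. g k x - h x)" for k
  proof -
    have L: "Lp M p (\<lambda>x. g k x - h x)" using assms by (intro Lp_diff) auto
    have "?I (g k) - ?I h
      = (\<integral>x. p_form p (f x) (g k x) - p_form p (f x) (h x) \<partial>M)"
      using assms by (intro Bochner_Integration.integral_diff[symmetric] Lp_p_form_integrable) auto
    also have "\<dots> = (\<integral>x. p_form p (f x) (g k x - h x) \<partial>M)"
      by (simp add: p_form_def inner_diff_right right_diff_distrib)
    finally have "\<bar>?I (g k) - ?I h\<bar>
        \<le> (\<integral>x. \<bar>p_form p (f x) (g k x - h x)\<bar> \<partial>M)"
      by simp
    also have "\<dots> \<le> (\<integral>x. \<epsilon> * norm (f x) powr p + K * norm (g k x - h x) powr p \<partial>M)"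
    proof (rule integral_mono)
      show "\<bar>p_form p (f x) (g k x - h x)\<bar> \<le> \<epsilon> * norm (f x) powr p + K * norm (g k x - h x) powr p" for x
        by (rule order_trans[OF abs_p_form_le K(2)]) auto
    qed (use assms L in \<open>auto intro!: Lp_p_form_integrable Lp_integrable\<close>)
    also have "\<dots> = \<epsilon> * pint M p f + K * pint M p (\<lambda>x. g k x - h x)"
      using assms(2) L by (simp add: pint_def Lp_def)
    finally show ?thesis .
  qed
  with K(1) show "\<exists>K\<ge>0. \<forall>k. \<bar>?I (g k) - ?I h\<bar>
    \<le> \<epsilon> * pint M p f + K * pint M p (\<lambda>x. g k x - h x)" by blast
qed simp

text \<open>The limit t \<rightarrow> 0 of the Euler-Lagrange argument, by dominated convergence.
  The majorant is again a \<open>p_form\<close>, with |f| + |g| in the nonlinear slot.\<close>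

lemma Lp_p_form_perturb_tendsto:
  assumes "p > 1" "Lp M p f" "Lp M p g" "t \<longlonglongrightarrow> 0" "\<And>k. \<bar>t k\<bar> \<le> 1"
  shows "(\<lambda>k. \<integral>x. p_form p (f x + t k *\<^sub>R g x) (g x) \<partial>M) \<longlonglongrightarrow> (\<integral>x. p_form p (f x) (g x) \<partial>M)"
proof (rule integral_dominated_convergence)
  note [measurable] = assms(2,3)[THEN Lp_measurable]
  define w where "w x = norm (f x) + norm (g x)" for x
  have Lw: "Lp M p w" unfolding w_def using assms by (intro Lp_add) (auto simp: Lp_def)
  show "integrable M (\<lambda>x. p_form p (w x) (norm (g x)))"
    using assms Lw by (intro Lp_p_form_integrable) (auto simp: Lp_def)
  show "AE x in M. norm (p_form p (f x + t k *\<^sub>R g x) (g x)) \<le> p_form p (w x) (norm (g x))" for k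
  proof (rule AE_I2)
    fix x
    have "norm (f x + t k *\<^sub>R g x) \<le> norm (f x) + \<bar>t k\<bar> * norm (g x)"
      by (metis norm_scaleR norm_triangle_ineq)
    also have "\<dots> \<le> w x" unfolding w_def using assms(5)[of k] by (simp add: mult_left_le_one_le)
    finally have 1: "norm (f x + t k *\<^sub>R g x) \<le> w x" .
    then have "norm (f x + t k *\<^sub>R g x) powr (p - 1) * norm (g x) \<le> w x powr (p - 1) * norm (g x)"
      using assms by (intro mult_right_mono powr_mono2) auto
    also have "w x powr (p - 1) = w x powr (p - 2) * w x"
      using powr_add[of "w x" "p - 2" 1] by (cases "w x = 0") (auto simp: w_def)
    also have "w x powr (p - 2) * w x * norm (g x) = p_form p (w x) (norm (g x))"
      by (simp add: p_form_def w_def)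
    finally show "norm (p_form p (f x + t k *\<^sub>R g x) (g x)) \<le> p_form p (w x) (norm (g x))"
      using abs_p_form_le[of p "f x + t k *\<^sub>R g x" "g x"] by simp
  qed
  show "AE x in M. (\<lambda>k. p_form p (f x + t k *\<^sub>R g x) (g x)) \<longlonglongrightarrow> p_form p (f x) (g x)"
  proof (rule AE_I2)
    fix x
    have T: "(\<lambda>k. f x + t k *\<^sub>R g x) \<longlonglongrightarrow> f x + 0 *\<^sub>R g x" by (intro tendsto_intros assms)
    show "(\<lambda>k. p_form p (f x + t k *\<^sub>R g x) (g x)) \<longlonglongrightarrow> p_form p (f x) (g x)"
    \<comment> \<open>Where f vanishes, the factor with exponent p - 2 may be singular; the bound by
      |f + t g|^(p - 1) |g| gives the limit there.\<close>
    proof (cases "f x = 0")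
      case True
      have "(\<lambda>k. norm (f x + t k *\<^sub>R g x)) \<longlonglongrightarrow> 0"
        using tendsto_norm[OF T] True by simp
      then have "(\<lambda>k. norm (f x + t k *\<^sub>R g x) powr (p - 1)) \<longlonglongrightarrow> 0 powr (p - 1)"
        using assms(1) by (intro tendsto_powr' tendsto_const) auto
      then have "(\<lambda>k. norm (f x + t k *\<^sub>R g x) powr (p - 1) * norm (g x)) \<longlonglongrightarrow> 0 * norm (g x)"
        by (intro tendsto_mult tendsto_const) simp
      then have lim: "(\<lambda>k. norm (f x + t k *\<^sub>R g x) powr (p - 1) * norm (g x)) \<longlonglongrightarrow> 0"
        by simp
      have "(\<lambda>k. p_form p (f x + t k *\<^sub>R g x) (g x)) \<longlonglongrightarrow> 0"
        by (rule Lim_null_comparison[OF always_eventually lim]) (simp add: abs_p_form_le)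
      then show ?thesis using True by (simp add: p_form_def)
    next
      case False
      then show ?thesis unfolding p_form_def
        using T by (intro tendsto_intros) auto
    qed
  qed
  show "(\<lambda>x. p_form p (f x) (g x)) \<in> borel_measurable M"
    "(\<lambda>x. p_form p (f x + t k *\<^sub>R g x) (g x)) \<in> borel_measurable M" for k
    unfolding p_form_def by measurable
qed

section \<open>Hoelder's inequality on sets of finite measure, and completeness\<close>

text \<open>Hoelder's inequality up to a factor 2: integrate \<open>powr_interpolate\<close> and
  optimize the level s.\<close>

lemma integral_powr_le:
  fixes f :: "'a \<Rightarrow> real"
  assumes pq: "0 < p" "p < q"
    and A: "A \<in> sets M" "emeasure M A < \<infinity>"
    and f: "f \<in> borel_measurable M" "\<And>x. f x \<ge> 0" "\<And>x. x \<in> space M \<Longrightarrow> x \<notin> A \<Longrightarrow> f x = 0"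
    and int: "integrable M (\<lambda>x. f x powr q)"
  shows "integrable M (\<lambda>x. f x powr p)"
    and "(\<integral>x. f x powr p \<partial>M) \<le> 2 * measure M A powr (1 - p / q) * (\<integral>x. f x powr q \<partial>M) powr (p / q)"
proof -
  note [measurable] = f(1) A(1)
  have ind: "integrable M (indicat_real A)" using A by simp
  have pw: "f x powr p \<le> s powr p * indicat_real A x + s powr (p - q) * f x powr q"
    if "s > 0" "x \<in> space M" for s x
    using powr_interpolate[OF pq that(1) f(2), of x] f(3)[OF that(2)] by (cases "x \<in> A") auto
  have int_bd: "integrable M (\<lambda>x. s powr p * indicat_real A x + s powr (p - q) * f x powr q)" for s
    using ind int by auto
  show ip: "integrable M (\<lambda>x. f x powr p)"
    by (rule Bochner_Integration.integrable_bound[OF int_bd[of 1]])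
      (use pw[of 1] in \<open>auto intro!: AE_I2\<close>)
  define m where "m = measure M A"
  define K where "K = (\<integral>x. f x powr q \<partial>M)"
  have bd: "(\<integral>x. f x powr p \<partial>M) \<le> s powr p * m + s powr (p - q) * K" if "s > 0" for s
  proof -
    have "(\<integral>x. f x powr p \<partial>M) \<le> (\<integral>x. s powr p * indicat_real A x + s powr (p - q) * f x powr q \<partial>M)"
      using ip int_bd pw that by (intro integral_mono) auto
    also have "\<dots> = s powr p * m + s powr (p - q) * K"
      using ind int A(1) sets.sets_into_space[OF A(1)] by (simp add: m_def K_def Int_absorb2)
    finally show ?thesis .
  qed
  have mn: "m \<ge> 0" "K \<ge> 0" by (auto simp: m_def K_def)
  show "(\<integral>x. f x powr p \<partial>M) \<le> 2 * measure M A powr (1 - p / q) * (\<integral>x. f x powr q \<partial>M) powr (p / q)"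
  proof (cases "m = 0 \<or> K = 0")
    case True
    have "AE x in M. f x = 0"
    proof (cases "m = 0")
      case True
      then have "emeasure M A = 0" using A(2) by (simp add: m_def emeasure_eq_ennreal_measure)
      then have "AE x in M. x \<notin> A" using A(1) by (intro AE_not_in null_setsI)
      then show ?thesis using AE_space by eventually_elim (rule f(3))
    next
      case False
      with True have "AE x in M. f x powr q = 0"
        using int unfolding K_def by (subst (asm) integral_nonneg_eq_0_iff_AE) auto
      then show ?thesis by simp
    qed
    then have "AE x in M. f x powr p = 0" by simp
    then have "(\<integral>x. f x powr p \<partial>M) = 0" by (rule integral_eq_zero_AE)
    then show ?thesis by simp
  next
    case False
    then have pos: "m > 0" "K > 0" using mn by auto
    \<comment> \<open>At s^q = K/m the two terms of the bound are equal, whence the factor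
      2.\<close>
    define s where "s = (K / m) powr (1 / q)"
    have "s > 0" using pos by (simp add: s_def)
    have 1: "s powr p * m = K powr (p / q) * m powr (1 - p / q)"
      using pos pq by (simp add: s_def powr_powr powr_divide powr_diff)
    have 2: "s powr (p - q) * K = K powr (p / q) * m powr (1 - p / q)"
    proof -
      have "s powr (p - q) = (K / m) powr (p / q - 1)"
        using pq by (simp add: s_def powr_powr diff_divide_distrib)
      then show ?thesis using pos by (simp add: powr_divide powr_diff)
    qed
    show ?thesis using bd[OF \<open>s > 0\<close>] 1 2 by (simp add: m_def K_def algebra_simps)
  qed
qed

lemma (in finite_measure) Lp_mono_exponent:
  assumes "0 < p" "p < q" "Lp M q f"
  shows "Lp M p f" "pint M p f \<le> 2 * measure M (space M) powr (1 - p / q) * pint M q f powr (p / q)"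
  using integral_powr_le[of p q "space M" M "\<lambda>x. norm (f x)"] assms
  by (auto simp: Lp_def pint_def emeasure_eq_measure)

lemma (in finite_measure) pint_tendsto_0_mono_exponent:
  assumes pq: "0 < p" "p < q" and L: "\<And>k. Lp M q (f k)" and "(\<lambda>k. pint M q (f k)) \<longlonglongrightarrow> 0"
  shows "(\<lambda>k. pint M p (f k)) \<longlonglongrightarrow> 0"
proof -
  have "(\<lambda>k. 2 * measure M (space M) powr (1 - p / q) * pint M q (f k) powr (p / q)) \<longlonglongrightarrow>
      2 * measure M (space M) powr (1 - p / q) * 0 powr (p / q)"
    using assms by (intro tendsto_mult tendsto_const tendsto_powr') auto
  then have lim: "(\<lambda>k. 2 * measure M (space M) powr (1 - p / q) * pint M q (f k) powr (p / q)) \<longlonglongrightarrow> 0"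
    by simp
  show ?thesis
    using Lp_mono_exponent(2)[OF pq L] by (intro Lim_null_comparison[OF always_eventually lim]) auto
qed

text \<open>Riesz-Fischer for p-th powers: a rapidly converging subsequence has an almost everywhere
  limit, and Fatou's lemma carries the Cauchy bound over to it.\<close>

lemma Lp_complete:
  fixes f :: "nat \<Rightarrow> 'a \<Rightarrow> 'b::euclidean_space"
  assumes p: "p > 0" and L: "\<And>k. Lp M p (f k)"
    and cauchy: "\<And>\<epsilon>. \<epsilon> > 0 \<Longrightarrow> \<exists>N. \<forall>k\<ge>N. \<forall>l\<ge>N. pint M p (\<lambda>x. f k x - f l x) \<le> \<epsilon>"
  obtains g where "Lp M p g" "(\<lambda>k. pint M p (\<lambda>x. f k x - g x)) \<longlonglongrightarrow> 0"
proof -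
  note [measurable] = L[THEN Lp_measurable]
  have Ld: "Lp M p (\<lambda>x. f k x - f l x)" for k l using p L by (intro Lp_diff) auto
  \<comment> \<open>With the rate (1/4)^(pj), the weight 2^(pj) in \<open>?F\<close> still leaves
    the summable bound (1/2)^(pj).\<close>
  have "\<forall>j::nat. \<exists>N. \<forall>k\<ge>N. \<forall>l\<ge>N. pint M p (\<lambda>x. f k x - f l x) \<le> (1/4) powr (p * j)"
    by (intro allI cauchy) auto
  then obtain N where N: "\<And>j k l. k \<ge> N j \<Longrightarrow> l \<ge> N j \<Longrightarrow> pint M p (\<lambda>x. f k x - f l x) \<le> (1/4) powr (p * real j)"
    by metis
  \<comment> \<open>The sum puts both \<open>r j\<close> and \<open>r (Suc j)\<close> beyond
    \<open>N j\<close>; the summand j forces r to tend to infinity.\<close>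
  define r where "r j = (\<Sum>i\<le>j. N i) + j" for j
  have r: "N j \<le> r j" "N j \<le> r (Suc j)" "j \<le> r j" for j
    using member_le_sum[of j "{..j}" N] by (auto simp: r_def)
  define d where "d j x = f (r (Suc j)) x - f (r j) x" for j x
  have [measurable]: "d j \<in> borel_measurable M" for j unfolding d_def by measurable
  have pd: "pint M p (d j) \<le> (1/4) powr (p * j)" for j unfolding d_def by (intro N r)
  let ?F = "\<lambda>j x. ennreal (2 powr (p * real j) * norm (d j x) powr p)"
  have ratio: "norm ((1/2::real) powr p) < 1" using p powr_less_mono2[of p "1/2" 1] by simp
  have "AE x in M. (\<Sum>j. ?F j x) \<noteq> \<infinity>"
  proof (rule nn_integral_PInf_AE)
    have "(\<integral>\<^sup>+x. (\<Sum>j. ?F j x) \<partial>M)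
       = (\<Sum>j. \<integral>\<^sup>+x. ?F j x \<partial>M)"
      by (intro nn_integral_suminf) measurable
    also have "\<dots> \<le> (\<Sum>j. ennreal (((1/2) powr p) ^ j))"
    proof (intro suminf_le summableI)
      fix j
      have "(\<integral>\<^sup>+x. ?F j x \<partial>M)
         = ennreal (2 powr (p * j)) * (\<integral>\<^sup>+x. ennreal (norm (d j x) powr p) \<partial>M)"
        by (simp add: ennreal_mult nn_integral_cmult)
      also have "\<dots> = ennreal (2 powr (p * j) * pint M p (d j))"
        using nn_integral_pint[OF Ld[of "r (Suc j)" "r j"]] unfolding d_def[abs_def] by (simp add: ennreal_mult)
      also have "\<dots> \<le> ennreal (2 powr (p * j) * (1/4) powr (p * j))"
        using pd[of j] by (intro ennreal_leI mult_left_mono) auto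
      also have "2 powr (p * j) * (1/4) powr (p * j) = ((1/2) powr p) ^ j"
      proof -
        have "2 powr (p * j) * (1/4) powr (p * j) = (2 * (1/4)) powr (p * real j)"
          by (rule powr_mult[symmetric])
        also have "\<dots> = ((1/2) powr p) ^ j"
          by (simp add: powr_powr[symmetric] powr_realpow)
        finally show ?thesis .
      qed
      finally show "(\<integral>\<^sup>+x. ?F j x \<partial>M) \<le> ennreal (((1/2) powr p) ^ j)" .
    qed
    also have "\<dots> = ennreal (\<Sum>j. ((1/2) powr p) ^ j)"
      using ratio by (intro suminf_ennreal2 summable_geometric) auto
    also have "\<dots> < \<infinity>" by simp
    finally show "(\<integral>\<^sup>+x. (\<Sum>j. ?F j x) \<partial>M) \<noteq> \<infinity>" by simp
  qed measurable
  \<comment> \<open>Where the weighted series is finite, \<open>d j x\<close> decays like (1/2)^j,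
    so the telescoping series converges absolutely.\<close>
  then have conv: "AE x in M. convergent (\<lambda>j. f (r j) x)"
  proof eventually_elim
    case (elim x)
    define S where "S = enn2real (\<Sum>j. ?F j x)"
    have bd: "norm (d j x) \<le> S powr (1 / p) * (1/2) ^ j" for j
    proof -
      define F where "F j = ?F j x" for j :: nat
      have "sum F {j} \<le> suminf F" by (rule sum_le_suminf) auto
      then have "F j \<le> suminf F" by simp
      also have "suminf F = ennreal S"
        unfolding S_def F_def[abs_def] using elim by (intro ennreal_enn2real[symmetric]) (simp only: less_top infinity_ennreal_def)
      finally have "2 powr (p * j) * norm (d j x) powr p \<le> S"
        unfolding F_def by (rule ennreal_le_iff[THEN iffD1, rotated]) (simp add: S_def)
      then have "(2 powr (p * j) * norm (d j x) powr p) powr (1 / p) \<le> S powr (1 / p)"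
        using p by (intro powr_mono2) auto
      then have "2 powr j * norm (d j x) \<le> S powr (1 / p)"
        using p by (simp add: powr_mult powr_powr)
      then show ?thesis by (simp add: powr_realpow field_simps)
    qed
    have "summable (\<lambda>j. norm (d j x))"
      by (rule summable_comparison_test'[OF summable_mult[OF summable_geometric[of "1/2::real"]], of 0])
        (use bd in auto)
    then have "summable (\<lambda>j. d j x)" by (rule summable_norm_cancel)
    then have "(\<lambda>n. \<Sum>j<n. d j x) \<longlonglongrightarrow> (\<Sum>j. d j x)" by (rule summable_LIMSEQ)
    then have "(\<lambda>n. (\<Sum>j<n. d j x) + f (r 0) x) \<longlonglongrightarrow> (\<Sum>j. d j x) + f (r 0) x"
      by (intro tendsto_intros)
    moreover have "(\<Sum>j<n. d j x) + f (r 0) x = f (r n) x" for n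
      using sum_lessThan_telescope[of "\<lambda>j. f (r j) x" n] by (simp add: d_def)
    ultimately show ?case by (auto simp: convergent_def)
  qed
  define g where "g x = lim (\<lambda>j. f (r j) x)" for x
  have [measurable]: "g \<in> borel_measurable M" unfolding g_def by measurable
  have conv': "AE x in M. (\<lambda>j. f (r j) x) \<longlonglongrightarrow> g x"
    using conv by eventually_elim (simp add: g_def convergent_LIMSEQ_iff)
  \<comment> \<open>Fatou's lemma with the explicit bound \<epsilon> gives membership in
    \<open>Lp\<close> and the estimate together.\<close>
  have est: "Lp M p (\<lambda>x. f k x - g x) \<and> pint M p (\<lambda>x. f k x - g x) \<le> \<epsilon>"
    if "\<epsilon> > 0" "\<forall>k\<ge>n. \<forall>l\<ge>n. pint M p (\<lambda>x. f k x - f l x) \<le> \<epsilon>" "k \<ge> n" for \<epsilon> k n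
  proof -
    have "(\<integral>\<^sup>+x. ennreal (norm (f k x - g x) powr p) \<partial>M)
       = (\<integral>\<^sup>+x. liminf (\<lambda>j. ennreal (norm (f k x - f (r j) x) powr p)) \<partial>M)"
    proof (rule nn_integral_cong_AE, use conv' in eventually_elim)
      case (elim x)
      have "(\<lambda>j. ennreal (norm (f k x - f (r j) x) powr p)) \<longlonglongrightarrow> ennreal (norm (f k x - g x) powr p)"
        using p by (intro tendsto_ennrealI tendsto_powr' tendsto_intros elim) auto
      then show ?case by (rule lim_imp_Liminf[OF trivial_limit_sequentially, symmetric])
    qed
    also have "\<dots> \<le> liminf (\<lambda>j. \<integral>\<^sup>+x. ennreal (norm (f k x - f (r j) x) powr p) \<partial>M)"
      by (intro nn_integral_liminf) measurable
    also have "\<dots> \<le> liminf (\<lambda>j. ennreal \<epsilon>)"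
    proof (rule Liminf_mono)
      show "\<forall>\<^sub>F j in sequentially. (\<integral>\<^sup>+x. ennreal (norm (f k x - f (r j) x) powr p) \<partial>M) \<le> ennreal \<epsilon>"
        using eventually_ge_at_top[of n]
      proof eventually_elim
        case (elim j)
        then have "r j \<ge> n" using r(3)[of j] by simp
        then show ?case using that by (simp add: nn_integral_pint[OF Ld] ennreal_leI)
      qed
    qed
    also have "\<dots> = ennreal \<epsilon>" by (simp add: Liminf_const)
    finally show ?thesis using LpI_nn_integral[of "\<lambda>x. f k x - g x" M p \<epsilon>] that(1) by simp
  qed
  show ?thesis
  proof (rule that)
    obtain n where "\<forall>k\<ge>n. \<forall>l\<ge>n. pint M p (\<lambda>x. f k x - f l x) \<le> 1" using cauchy[of 1] by auto
    then have "Lp M p (\<lambda>x. f n x - g x)" using est[of 1 n n] by simp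
    from Lp_diff(1)[OF p L[of n] this] show "Lp M p g" by simp
    show "(\<lambda>k. pint M p (\<lambda>x. f k x - g x)) \<longlonglongrightarrow> 0"
    proof (rule LIMSEQ_I)
      fix e :: real assume "e > 0"
      then obtain n where n: "\<forall>k\<ge>n. \<forall>l\<ge>n. pint M p (\<lambda>x. f k x - f l x) \<le> e / 2" using cauchy[of "e/2"] by auto
      show "\<exists>no. \<forall>k\<ge>no. norm (pint M p (\<lambda>x. f k x - g x) - 0) < e"
      proof (intro exI allI impI)
        fix k assume "k \<ge> n"
        then have "pint M p (\<lambda>x. f k x - g x) \<le> e / 2" using est[of "e/2" n k] n \<open>e > 0\<close> by simp
        then show "norm (pint M p (\<lambda>x. f k x - g x) - 0) < e" using \<open>e > 0\<close> by simp
      qed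
    qed
  qed
qed

lemma pint_uniformly_convex:
  assumes "p > 1" "\<epsilon> > 0"
  obtains K where "K \<ge> 0" "\<And>M. \<And>f g :: 'a \<Rightarrow> 'b::euclidean_space. Lp M p f \<Longrightarrow> Lp M p g \<Longrightarrow>
    pint M p (\<lambda>x. f x - g x) \<le> \<epsilon> * (pint M p f + pint M p g)
      + K * ((pint M p f + pint M p g) / 2 - pint M p (\<lambda>x. (1/2) *\<^sub>R (f x + g x)))"
proof -
  obtain K where K: "K \<ge> 0" "\<And>a b :: 'b.
    norm (a - b) powr p \<le> \<epsilon> * (norm a powr p + norm b powr p)
      + K * ((norm a powr p + norm b powr p) / 2 - norm ((1/2) *\<^sub>R (a + b)) powr p)"
    using norm_powr_uniformly_convex[OF assms] by metis
  show ?thesis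
  proof (rule that[OF K(1)])
    fix M :: "'a measure" and f g :: "'a \<Rightarrow> 'b"
    assume L: "Lp M p f" "Lp M p g"
    have p: "p > 0" using assms by simp
    note i = L[THEN Lp_integrable] Lp_integrable[OF Lp_diff(1)[OF p L]]
      Lp_integrable[OF Lp_scale(1)[OF Lp_add(1)[OF p L], of "1/2"]]
    have "pint M p (\<lambda>x. f x - g x) \<le> (\<integral>x. \<epsilon> * (norm (f x) powr p + norm (g x) powr p)
        + K * ((norm (f x) powr p + norm (g x) powr p) / 2 - norm ((1/2) *\<^sub>R (f x + g x)) powr p) \<partial>M)"
      unfolding pint_def using i by (intro integral_mono K(2) Bochner_Integration.integrable_add
        Bochner_Integration.integrable_diff integrable_mult_right integrable_divide) 
    also have "\<dots> = \<epsilon> * (pint M p f + pint M p g)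
      + K * ((pint M p f + pint M p g) / 2 - pint M p (\<lambda>x. (1/2) *\<^sub>R (f x + g x)))"
      unfolding pint_def using i
      by (simp only: Bochner_Integration.integral_add Bochner_Integration.integral_diff
          Bochner_Integration.integrable_add Bochner_Integration.integrable_diff integrable_mult_right
          integrable_divide integral_mult_right_zero integral_divide_zero)
    finally show "pint M p (\<lambda>x. f x - g x) \<le> \<epsilon> * (pint M p f + pint M p g)
      + K * ((pint M p f + pint M p g) / 2 - pint M p (\<lambda>x. (1/2) *\<^sub>R (f x + g x)))" .
  qed
qed

section \<open>Poincare's inequality and Rellich's theorem\<close>

lemma Lp_continuous_compact_support:
  fixes f :: "'a::euclidean_space \<Rightarrow> 'b::euclidean_space"
  assumes "continuous_on UNIV f" "compact K" "\<And>x. x \<notin> K \<Longrightarrow> f x = 0" "p > 0"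
  shows "Lp lborel p f"
proof -
  have c: "continuous_on UNIV (\<lambda>x. norm (f x) powr p)"
    using assms by (intro continuous_on_powr' continuous_intros) auto
  have "integrable lborel (\<lambda>x. indicator K x *\<^sub>R (norm (f x) powr p))"
    using c by (intro borel_integrable_compact assms) (rule continuous_on_subset, auto)
  also have "(\<lambda>x. indicator K x *\<^sub>R (norm (f x) powr p)) = (\<lambda>x. norm (f x) powr p)"
    using assms(3) by (auto simp: indicator_def fun_eq_iff)
  finally show ?thesis using assms(1) by (simp add: Lp_def borel_measurable_continuous_onI)
qed

lemma Lp_continuous_compact_support_finite:
  fixes f :: "'a::euclidean_space \<Rightarrow> 'b::euclidean_space"
  assumes "continuous_on UNIV f" "compact K" "\<And>x. x \<notin> K \<Longrightarrow> f x = 0" "p > 0"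
    and "finite_measure \<mu>" "sets \<mu> = sets borel"
  shows "Lp \<mu> p f"
proof -
  interpret finite_measure \<mu> by fact
  have meas: "f \<in> borel_measurable \<mu>"
    using borel_measurable_continuous_onI[OF assms(1)] measurable_cong_sets[OF assms(6) refl] by blast
  obtain B where B: "\<And>x. x \<in> K \<Longrightarrow> norm (f x) \<le> B"
    using compact_imp_bounded[OF compact_continuous_image[OF continuous_on_subset[OF assms(1)] assms(2)]]
    by (auto simp: bounded_iff)
  have "norm (norm (f x) powr p) \<le> \<bar>B\<bar> powr p" for x
    using B[of x] assms(3)[of x] assms(4) by (cases "x \<in> K") (auto intro!: powr_mono2)
  then have "integrable \<mu> (\<lambda>x. norm (f x) powr p)"
    using meas by (intro integrable_const_bound[of _ "\<bar>B\<bar> powr p"]) auto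
  with meas show ?thesis by (simp add: Lp_def)
qed

lemma test_fun_Lp:
  assumes "test_fun \<Omega> f" "p > 0"
  shows "Lp lborel p f" "Lp lborel p (grad f)"
    "finite_measure \<mu> \<Longrightarrow> sets \<mu> = sets borel \<Longrightarrow> Lp \<mu> p f"
proof -
  obtain K where K: "compact K" "\<forall>x. x \<notin> K \<longrightarrow> f x = 0 \<and> grad f x = 0"
    using test_fun_support[OF assms(1)] by blast
  note s = test_fun_smooth[OF assms(1)]
  show "Lp lborel p f" "Lp lborel p (grad f)"
    using K by (auto intro!: Lp_continuous_compact_support[OF _ K(1)] smooth_fun_continuous s
        smooth_fun_continuous_grad assms(2))
  show "finite_measure \<mu> \<Longrightarrow> sets \<mu> = sets borel \<Longrightarrow> Lp \<mu> p f"
    using K by (auto intro!: Lp_continuous_compact_support_finite[OF _ K(1)] smooth_fun_continuous s assms(2))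
qed

lemma smooth_fun_measurable:
  assumes "smooth_fun f"
  shows "f \<in> borel_measurable borel" "grad f \<in> borel_measurable borel"
  using assms by (auto intro!: borel_measurable_continuous_onI smooth_fun_continuous smooth_fun_continuous_grad)

lemma nn_integral_lborel_shift:
  fixes c :: "'a::euclidean_space"
  assumes "f \<in> borel_measurable borel"
  shows "(\<integral>\<^sup>+x. f (c + x) \<partial>lborel) = (\<integral>\<^sup>+x. f x \<partial>lborel)"
proof -
  have "(\<integral>\<^sup>+x. f x \<partial>lborel) = (\<integral>\<^sup>+x. f x \<partial>distr lborel borel ((+) c))"
    by (simp add: lborel_distr_plus)
  also have "\<dots> = (\<integral>\<^sup>+x. f (c + x) \<partial>lborel)"
    using assms by (subst nn_integral_distr) auto
  finally show ?thesis by simp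
qed

text \<open>If f is not integrable, the left-hand side is the default value 0.\<close>

lemma ennreal_integral_le_nn_integral:
  fixes f :: "'a \<Rightarrow> real"
  assumes "f \<in> borel_measurable M" "\<And>x. 0 \<le> f x"
  shows "ennreal (\<integral>x. f x \<partial>M) \<le> (\<integral>\<^sup>+x. ennreal (f x) \<partial>M)"
  using assms by (subst integral_eq_nn_integral) (auto simp: ennreal_enn2real_if)

text \<open>The fundamental theorem of calculus along the segment from x to x + z, then Hoelder's
  inequality on [0, 1]; the 2 is the constant of \<open>integral_powr_le\<close>.\<close>

lemma increment_powr_le:
  fixes f :: "real^'n::finite \<Rightarrow> real"
  assumes f: "smooth_fun f" and p: "p > 1"
  shows "\<bar>f (x + z) - f x\<bar> powr p
    \<le> (2 * norm z) powr p * (\<integral>t. (indicat_real {0..1} t * norm (grad f (x + t *\<^sub>R z))) powr p \<partial>lborel)"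
proof -
  let ?w = "\<lambda>t. grad f (x + t *\<^sub>R z)"
  define g where "g t = indicat_real {0..1} t * norm (?w t)" for t
  have contg: "continuous_on UNIV (\<lambda>t. ?w t)"
    by (rule continuous_on_compose2[OF smooth_fun_continuous_grad[OF f, of UNIV]])
      (auto intro!: continuous_intros)
  then have contg': "continuous_on A (\<lambda>t. ?w t)" for A
    by (rule continuous_on_subset) auto
  have 1: "(\<integral>t. indicator {0..1} t *\<^sub>R (?w t \<bullet> z) \<partial>lborel) = f (x + 1 *\<^sub>R z) - f (x + 0 *\<^sub>R z)"
  proof (rule integral_FTC_Icc)
    fix t :: real
    have "((\<lambda>t. f (x + t *\<^sub>R z)) has_derivative (\<lambda>h. ?w t \<bullet> (h *\<^sub>R z))) (at t)"
      by (rule has_derivative_compose[OF _ has_derivative_grad[OF smooth_fun_differentiable[OF f]]])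
        (auto intro!: derivative_eq_intros)
    then show "((\<lambda>t. f (x + t *\<^sub>R z)) has_vector_derivative (?w t \<bullet> z)) (at t within {0..1})"
      by (simp add: has_vector_derivative_def has_derivative_at_withinI)
  qed (auto intro!: continuous_intros contg')
  have int: "integrable lborel (\<lambda>t. indicator {0..1} t *\<^sub>R h t)" if "continuous_on UNIV h" for h :: "real \<Rightarrow> real"
    using that by (intro borel_integrable_compact) (auto intro: continuous_on_subset)
  have intg: "integrable lborel g"
    using int[of "\<lambda>t. norm (?w t)"] contg by (simp add: g_def[abs_def] continuous_on_norm)
  have intgp: "integrable lborel (\<lambda>t. g t powr p)"
  proof -
    have "continuous_on UNIV (\<lambda>t. norm (?w t) powr p)"
      using p by (intro continuous_on_powr' continuous_intros contg) auto
    moreover have "(\<lambda>t. indicator {0..1} t *\<^sub>R norm (?w t) powr p) = (\<lambda>t. g t powr p)"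
      by (auto simp: g_def indicator_def fun_eq_iff)
    ultimately show ?thesis using int[of "\<lambda>t. norm (?w t) powr p"] by simp
  qed
  have "\<bar>f (x + z) - f x\<bar> \<le> (\<integral>t. \<bar>indicator {0..1} t *\<^sub>R (?w t \<bullet> z)\<bar> \<partial>lborel)"
    using 1 integral_abs_bound[of lborel "\<lambda>t. indicator {0..1} t *\<^sub>R (?w t \<bullet> z)"] by simp
  also have "\<dots> \<le> (\<integral>t. norm z * g t \<partial>lborel)"
  proof (rule integral_mono)
    show "integrable lborel (\<lambda>t. \<bar>indicator {0..1} t *\<^sub>R (?w t \<bullet> z)\<bar>)"
      by (intro integrable_abs int continuous_intros contg)
    show "\<bar>indicator {0..1} t *\<^sub>R (?w t \<bullet> z)\<bar> \<le> norm z * g t" for t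
      using Cauchy_Schwarz_ineq2[of "?w t" z] by (auto simp: g_def indicator_def mult.commute)
  qed (use intg in auto)
  finally have 2: "\<bar>f (x + z) - f x\<bar> \<le> norm z * (\<integral>t. g t \<partial>lborel)" by simp
  have "(\<integral>t. g t \<partial>lborel) = (\<integral>t. g t powr 1 \<partial>lborel)" by (simp add: g_def)
  also have "\<dots> \<le> 2 * measure lborel {0..1::real} powr (1 - 1 / p) * (\<integral>t. g t powr p \<partial>lborel) powr (1 / p)"
    using p intgp borel_measurable_integrable[OF intg]
    by (intro integral_powr_le(2)) (auto simp: g_def[abs_def])
  finally have "norm z * (\<integral>t. g t \<partial>lborel) \<le> norm z * (2 * (\<integral>t. g t powr p \<partial>lborel) powr (1 / p))"
    by (intro mult_left_mono) auto
  with 2 have "\<bar>f (x + z) - f x\<bar> \<le> (2 * norm z) * (\<integral>t. g t powr p \<partial>lborel) powr (1 / p)"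
    by (simp add: algebra_simps)
  then have "\<bar>f (x + z) - f x\<bar> powr p \<le> ((2 * norm z) * (\<integral>t. g t powr p \<partial>lborel) powr (1 / p)) powr p"
    using p by (intro powr_mono2) auto
  also have "\<dots> = (2 * norm z) powr p * (\<integral>t. g t powr p \<partial>lborel)"
    using p by (simp add: powr_mult powr_powr)
  finally show ?thesis by (simp add: g_def)
qed

text \<open>Fubini and translation invariance: every point of the segment contributes the same
  energy. This translation estimate feeds both Poincare's inequality and Rellich's theorem.\<close>

lemma nn_integral_increment_le:
  fixes f :: "real^'n::finite \<Rightarrow> real"
  assumes f: "test_fun \<Omega> f" and p: "p > 1"
  shows "(\<integral>\<^sup>+x. ennreal (\<bar>f (x + z) - f x\<bar> powr p) \<partial>lborel) \<le> ennreal ((2 * norm z) powr p * pint lborel p (grad f))"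
proof -
  let ?h = "\<lambda>x t. ennreal ((indicat_real {0..1} t * norm (grad f (x + t *\<^sub>R z))) powr p)"
  note s = test_fun_smooth[OF f]
  note [measurable] = smooth_fun_measurable[OF s]
  have "(\<integral>\<^sup>+x. ennreal (\<bar>f (x + z) - f x\<bar> powr p) \<partial>lborel)
    \<le> (\<integral>\<^sup>+x. ennreal ((2 * norm z) powr p) *
        (\<integral>\<^sup>+t. ?h x t \<partial>lborel) \<partial>lborel)"
  proof (rule nn_integral_mono)
    fix x
    have "ennreal (\<bar>f (x + z) - f x\<bar> powr p) \<le> ennreal ((2 * norm z) powr p) *
      ennreal (\<integral>t. (indicat_real {0..1} t * norm (grad f (x + t *\<^sub>R z))) powr p \<partial>lborel)"
      using increment_powr_le[OF s p, of x z] by (simp add: ennreal_leI flip: ennreal_mult)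
    also have "\<dots> \<le> ennreal ((2 * norm z) powr p) *
      (\<integral>\<^sup>+t. ?h x t \<partial>lborel)"
      by (intro mult_left_mono ennreal_integral_le_nn_integral) auto
    finally show "ennreal (\<bar>f (x + z) - f x\<bar> powr p) \<le> \<dots>" .
  qed
  also have "\<dots> = ennreal ((2 * norm z) powr p) * (\<integral>\<^sup>+x. \<integral>\<^sup>+t.
      ?h x t \<partial>lborel \<partial>lborel)"
    by (intro nn_integral_cmult) measurable
  also have "(\<integral>\<^sup>+x. \<integral>\<^sup>+t. ?h x t \<partial>lborel \<partial>lborel)
     = (\<integral>\<^sup>+t. \<integral>\<^sup>+x. ?h x t \<partial>lborel \<partial>lborel)"
    by (intro lborel_pair.Fubini'[symmetric]) measurable
  also have "\<dots> = (\<integral>\<^sup>+t. indicator {0..1::real} t * ennreal (pint lborel p (grad f)) \<partial>lborel)"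
  proof (rule nn_integral_cong)
    fix t :: real
    show "(\<integral>\<^sup>+x. ?h x t \<partial>lborel)
      = indicator {0..1} t * ennreal (pint lborel p (grad f))"
    proof (cases "t \<in> {0..1}")
      case True
      have "(\<integral>\<^sup>+x. ennreal (norm (grad f (t *\<^sub>R z + x)) powr p) \<partial>lborel) = (\<integral>\<^sup>+x. ennreal (norm (grad f x) powr p) \<partial>lborel)"
        by (rule nn_integral_lborel_shift) measurable
      also have "\<dots> = ennreal (pint lborel p (grad f))"
        using p by (intro nn_integral_pint test_fun_Lp[OF f]) auto
      finally show ?thesis using True by (simp add: add.commute)
    qed simp
  qed
  also have "\<dots> = ennreal (pint lborel p (grad f))"
    by (subst nn_integral_multc) auto
  finally show ?thesis by (simp add: ennreal_mult)
qed

text \<open>A translation that moves \<Omega> off itself turns |f| on \<Omega> into an increment of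
  f.\<close>

lemma poincare_inequality:
  fixes \<Omega> :: "(real^'n::finite) set"
  assumes "bounded \<Omega>" "p > 1"
  obtains K where "K \<ge> 0" "\<And>f. test_fun \<Omega> f \<Longrightarrow> pint lborel p f \<le> K * pint lborel p (grad f)"
proof -
  obtain R where R: "\<And>x. x \<in> \<Omega> \<Longrightarrow> norm x < R" "R > 0"
    using assms(1) bounded_pos_less by metis
  \<comment> \<open>Any direction will do: since \<Omega> lies in the open ball of radius R about 0,
    a shift of length 2R leaves no overlap.\<close>
  define z :: "real^'n" where "z = (2 * R) *\<^sub>R axis undefined 1"
  have nz: "norm z = 2 * R" using R by (simp add: z_def norm_axis_1)
  show ?thesis
  proof
    show "(2 * norm z) powr p \<ge> 0" by simp
    fix f assume f: "test_fun \<Omega> f"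
    have zero: "f x = 0" if "x \<notin> \<Omega>" for x using test_fun_support[OF f] that by blast
    have "(\<integral>\<^sup>+x. ennreal (norm (f x) powr p) \<partial>lborel) \<le> (\<integral>\<^sup>+x. ennreal (\<bar>f (x + z) - f x\<bar> powr p) \<partial>lborel)"
    proof (rule nn_integral_mono)
      fix x
      show "ennreal (norm (f x) powr p) \<le> ennreal (\<bar>f (x + z) - f x\<bar> powr p)"
      proof (cases "x \<in> \<Omega>")
        case True
        have "norm z \<le> norm (x + z) + norm x" using norm_triangle_ineq4[of "x + z" x] by simp
        then have "x + z \<notin> \<Omega>" using R(1)[OF True] R(1)[of "x + z"] nz by auto
        then show ?thesis using zero by simp
      qed (use zero in simp)
    qed
    also have "\<dots> \<le> ennreal ((2 * norm z) powr p * pint lborel p (grad f))"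
      by (rule nn_integral_increment_le[OF f assms(2)])
    finally show "pint lborel p f \<le> (2 * norm z) powr p * pint lborel p (grad f)"
      using LpI_nn_integral(2)[of f lborel p] Lp_measurable[OF test_fun_Lp(1)[OF f, of p]] assms by simp
  qed
qed

section \<open>Averages over the cells of a cubic grid\<close>

definition cell_index :: "nat \<Rightarrow> real^'n \<Rightarrow> int^'n" where
  "cell_index m x = (\<chi> i. \<lfloor>real m * x $ i\<rfloor>)"

text \<open>Mesh and cell form one argument, so that the cell integrals over all grids make up one
  countable family for a single diagonal subsequence.\<close>

definition cell_integral :: "(real^'n::finite \<Rightarrow> real) \<Rightarrow> nat \<times> (int^'n) \<Rightarrow> real" where
  "cell_integral f = (\<lambda>(m, k). \<integral>y. indicat_real {y. cell_index m y = k} y * f y \<partial>lborel)"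

lemma cell_measurable [measurable]: "{y :: real^'n::finite. cell_index m y = k} \<in> sets borel"
proof -
  have "{y :: real^'n. cell_index m y = k} = {y \<in> space borel. \<forall>i. \<lfloor>real m * y $ i\<rfloor> = k $ i}"
    by (auto simp: cell_index_def vec_eq_iff)
  also have "\<dots> \<in> sets borel" by measurable
  finally show ?thesis .
qed

text \<open>Comparison with closed boxes of side 1/(2m) and 1/m sharing a corner; the crude lower
  bound costs only a factor 2^n later.\<close>

lemma cell_measure:
  fixes k :: "int^'n::finite"
  assumes "m > 0"
  defines "Q \<equiv> {y. cell_index m y = k}"
  shows "emeasure lborel Q < \<infinity>" "(1 / (2 * real m)) ^ CARD('n) \<le> measure lborel Q" "measure lborel Q \<le> 1"
proof -
  have [measurable]: "Q \<in> sets borel" unfolding Q_def by measurable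
  let ?a = "(\<chi> i. real_of_int (k $ i) / m) :: real^'n"
  let ?b = "(\<chi> i. real_of_int (k $ i) / m + 1 / (2 * real m)) :: real^'n"
  let ?c = "(\<chi> i. real_of_int (k $ i) / m + 1 / real m) :: real^'n"
  have sub1: "cbox ?a ?b \<subseteq> Q"
  proof
    fix y assume y: "y \<in> cbox ?a ?b"
    have "\<lfloor>real m * y $ i\<rfloor> = k $ i" for i
    proof -
      have "real_of_int (k $ i) / m \<le> y $ i" "y $ i \<le> real_of_int (k $ i) / m + 1 / (2 * real m)"
        using y by (auto simp: mem_box_cart)
      then have "real_of_int (k $ i) \<le> real m * y $ i" "real m * y $ i < real_of_int (k $ i) + 1"
        using assms by (auto simp: field_simps)
      then show ?thesis by (simp add: floor_eq_iff)
    qed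
    then show "y \<in> Q" by (simp add: Q_def cell_index_def vec_eq_iff)
  qed
  have sub2: "Q \<subseteq> cbox ?a ?c"
  proof
    fix y assume "y \<in> Q"
    then have "\<lfloor>real m * y $ i\<rfloor> = k $ i" for i by (auto simp: Q_def cell_index_def vec_eq_iff)
    then have "real_of_int (k $ i) \<le> real m * y $ i \<and> real m * y $ i < real_of_int (k $ i) + 1" for i
      by (simp add: floor_eq_iff)
    then show "y \<in> cbox ?a ?c" using assms by (auto simp: mem_box_cart field_simps less_imp_le)
  qed
  have mc: "measure lborel (cbox ?a ?c) = (1 / real m) ^ CARD('n)"
    using assms by (subst content_cbox_cart) (auto simp: interval_ne_empty_cart)
  have mb: "measure lborel (cbox ?a ?b) = (1 / (2 * real m)) ^ CARD('n)"
    using assms by (subst content_cbox_cart) (auto simp: interval_ne_empty_cart)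
  show fin: "emeasure lborel Q < \<infinity>"
    using emeasure_mono[OF sub2, of lborel] emeasure_lborel_cbox_finite[of ?a ?c] by (simp add: order.strict_trans1)
  show "(1 / (2 * real m)) ^ CARD('n) \<le> measure lborel Q"
    unfolding mb[symmetric] by (rule measure_mono_fmeasurable[OF sub1]) (use fin in \<open>auto simp: fmeasurable_def\<close>)
  have "measure lborel Q \<le> measure lborel (cbox ?a ?c)"
    by (rule measure_mono_fmeasurable[OF sub2]) auto
  also have "\<dots> \<le> 1" unfolding mc using assms by (intro power_le_one) auto
  finally show "measure lborel Q \<le> 1" .
qed

lemma finite_cell_index_image:
  fixes \<Omega> :: "(real^'n::finite) set"
  assumes "bounded \<Omega>"
  shows "finite (cell_index m ` \<Omega>)"
proof -
  obtain R where R: "\<And>x. x \<in> \<Omega> \<Longrightarrow> norm x \<le> R" using assms by (auto simp: bounded_iff)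
  define S where "S = {\<lfloor>- (real m * R)\<rfloor>..\<lfloor>real m * R\<rfloor>}"
  have "cell_index m ` \<Omega> \<subseteq> vec_lambda ` (PiE UNIV (\<lambda>_. S))"
  proof
    fix k assume "k \<in> cell_index m ` \<Omega>"
    then obtain x where x: "x \<in> \<Omega>" "k = cell_index m x" by blast
    have "k $ i \<in> S" for i
    proof -
      have "\<bar>x $ i\<bar> \<le> R" using R[OF x(1)] component_le_norm_cart[of x i] by simp
      then have "\<bar>real m * x $ i\<bar> \<le> real m * R" by (simp add: abs_mult mult_left_mono)
      then show ?thesis using x(2) by (auto simp: S_def cell_index_def intro!: floor_mono)
    qed
    then show "k \<in> vec_lambda ` (PiE UNIV (\<lambda>_. S))"
      by (intro image_eqI[of _ _ "vec_nth k"]) (auto simp: PiE_def)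
  qed
  then show ?thesis by (rule finite_subset) (auto simp: S_def intro!: finite_imageI finite_PiE)
qed

lemma test_fun_bounded:
  assumes "test_fun \<Omega> f"
  obtains B where "\<And>x. \<bar>f x\<bar> \<le> B"
proof -
  obtain K where K: "compact K" "\<forall>x. x \<notin> K \<longrightarrow> f x = 0 \<and> grad f x = 0"
    using test_fun_support[OF assms] by blast
  obtain B where B: "\<And>x. x \<in> K \<Longrightarrow> norm (f x) \<le> B"
    using compact_imp_bounded[OF compact_continuous_image[OF smooth_fun_continuous[OF test_fun_smooth[OF assms]] K(1)]]
    by (auto simp: bounded_iff)
  have "\<bar>f x\<bar> \<le> \<bar>B\<bar>" for x using B[of x] K(2) by (cases "x \<in> K") auto
  then show ?thesis by (rule that)
qed

definition cell_average :: "(real^'n::finite \<Rightarrow> real) \<Rightarrow> nat \<Rightarrow> real^'n \<Rightarrow> real" where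
  "cell_average f m x = cell_integral f (m, cell_index m x) / measure lborel {y. cell_index m y = cell_index m x}"

text \<open>The error is an average of f(x) - f(y) over the cell of x. Every such y is x + z with z
  in a cube that does not depend on x, so increments by a fixed z can be integrated over x
  afterwards.\<close>

lemma cell_average_error_pointwise:
  fixes f :: "real^'n::finite \<Rightarrow> real"
  assumes f: "test_fun \<Omega> f" and p: "p > 1" and m: "m > 0"
  shows "ennreal (\<bar>f x - cell_average f m x\<bar> powr p) \<le> ennreal (2 powr p * (2 * real m) ^ CARD('n)) *
    (\<integral>\<^sup>+z. indicator (cbox (\<chi> i. - (1 / real m)) (\<chi> i. 1 / real m)) z * ennreal (\<bar>f (x + z) - f x\<bar> powr p) \<partial>lborel)"
proof -
  let ?A = "f x - cell_average f m x"
  let ?B = "cbox (\<chi> i. - (1 / real m)) (\<chi> i. 1 / real m) :: (real^'n) set"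
  note s = test_fun_smooth[OF f]
  note [measurable] = smooth_fun_measurable(1)[OF s]
  define Q where "Q = {y. cell_index m y = cell_index m x}"
  have [measurable]: "Q \<in> sets borel" unfolding Q_def by measurable
  define v where "v = measure lborel Q"
  have fin: "emeasure lborel Q < \<infinity>" and vlow: "(1 / (2 * real m)) ^ CARD('n) \<le> v"
    unfolding Q_def v_def using cell_measure[OF m] by auto
  have v: "v > 0" by (rule less_le_trans[OF _ vlow]) (use m in simp)
  obtain B where B: "\<And>x. \<bar>f x\<bar> \<le> B" using test_fun_bounded[OF f] by metis
  have int: "integrable lborel (\<lambda>y. indicator Q y *\<^sub>R h y)"
    if "h \<in> borel_measurable borel" "\<And>y. \<bar>h y\<bar> \<le> B'" for h :: "real^'n \<Rightarrow> real" and B'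
    using that fin by (intro integrableI_bounded_set_indicator[where B=B']) auto
  define g where "g y = indicat_real Q y * \<bar>f x - f y\<bar>" for y
  have [measurable]: "g \<in> borel_measurable borel" unfolding g_def by measurable
  have intg: "integrable lborel g"
    using int[of "\<lambda>y. \<bar>f x - f y\<bar>" "2 * B"] B by (simp add: g_def[abs_def] abs_diff_le_iff) (smt (verit, best))
  let ?J = "\<integral>y. g y powr p \<partial>lborel"
  have intgp: "integrable lborel (\<lambda>y. g y powr p)"
  proof -
    have "\<bar>\<bar>f x - f y\<bar> powr p\<bar> \<le> (2 * B) powr p" for y
      using B[of x] B[of y] p by (auto intro!: powr_mono2)
    then have "integrable lborel (\<lambda>y. indicator Q y *\<^sub>R (\<bar>f x - f y\<bar> powr p))"
      by (intro int) measurable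
    moreover have "(\<lambda>y. indicator Q y *\<^sub>R (\<bar>f x - f y\<bar> powr p)) = (\<lambda>y. g y powr p)"
      by (auto simp: g_def indicator_def fun_eq_iff)
    ultimately show ?thesis by simp
  qed
  have "v * ?A = (\<integral>y. indicat_real Q y * (f x - f y) \<partial>lborel)"
  proof -
    have i1: "integrable lborel (\<lambda>y. indicat_real Q y * f x)" and i2: "integrable lborel (\<lambda>y. indicat_real Q y * f y)"
      using int[of "\<lambda>y. f x" "\<bar>f x\<bar>"] int[of f B] B by auto
    have "(\<integral>y. indicat_real Q y * (f x - f y) \<partial>lborel) = (\<integral>y. indicat_real Q y * f x \<partial>lborel) - (\<integral>y. indicat_real Q y * f y \<partial>lborel)"
      using i1 i2 by (simp add: right_diff_distrib)
    also have "(\<integral>y. indicat_real Q y * f x \<partial>lborel) = v * f x"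
      using fin by (simp add: v_def)
    also have "(\<integral>y. indicat_real Q y * f y \<partial>lborel) = v * cell_average f m x"
      using v by (simp add: cell_average_def cell_integral_def Q_def v_def)
    finally show ?thesis by (simp add: right_diff_distrib)
  qed
  then have "v * \<bar>?A\<bar> = \<bar>\<integral>y. indicat_real Q y * (f x - f y) \<partial>lborel\<bar>"
    using v by (metis abs_mult abs_of_pos)
  also have "\<dots> \<le> (\<integral>y. \<bar>indicat_real Q y * (f x - f y)\<bar> \<partial>lborel)" by (rule integral_abs_bound)
  also have "\<dots> = (\<integral>y. g y powr 1 \<partial>lborel)" by (simp add: g_def abs_mult)
  also have "\<dots> \<le> 2 * measure lborel Q powr (1 - 1 / p) * ?J powr (1 / p)"
    using p intgp fin by (intro integral_powr_le(2)) (auto simp: g_def)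
  finally have "\<bar>?A\<bar> \<le> 2 * v powr (1 - 1 / p) / v * ?J powr (1 / p)"
    using v by (simp add: v_def[symmetric] field_simps)
  also have "v powr (1 - 1 / p) / v = v powr (- 1 / p)"
    using v by (simp add: powr_diff powr_minus_divide)
  then have "2 * v powr (1 - 1 / p) / v = 2 * v powr (- 1 / p)" by simp
  finally have "\<bar>?A\<bar> powr p \<le> (2 * v powr (- 1 / p) * ?J powr (1 / p)) powr p"
    using p by (intro powr_mono2) auto
  also have "\<dots> = 2 powr p * (1 / v) * ?J"
  proof -
    have "(v powr (- 1 / p)) powr p = 1 / v"
      using p v powr_minus_divide[of v 1] by (simp only: powr_powr) simp
    moreover have "(?J powr (1 / p)) powr p = ?J"
      using p by (simp add: powr_powr)
    ultimately show ?thesis by (simp only: powr_mult)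
  qed
  also have "\<dots> \<le> 2 powr p * (2 * real m) ^ CARD('n) * ?J"
  proof (intro mult_right_mono mult_left_mono)
    have "1 / v \<le> 1 / (1 / (2 * real m)) ^ CARD('n)"
      using vlow v m by (intro divide_left_mono) auto
    then show "1 / v \<le> (2 * real m) ^ CARD('n)" by (simp add: power_one_over)
  qed auto
  finally have "ennreal (\<bar>?A\<bar> powr p)
      \<le> ennreal (2 powr p * (2 * real m) ^ CARD('n)) * ennreal ?J"
    by (simp add: ennreal_leI flip: ennreal_mult)
  also have "ennreal ?J \<le> (\<integral>\<^sup>+y. ennreal (g y powr p) \<partial>lborel)"
    by (rule ennreal_integral_le_nn_integral) auto
  also have "\<dots> = (\<integral>\<^sup>+z. ennreal (g (x + z) powr p) \<partial>lborel)"
    by (rule nn_integral_lborel_shift[symmetric]) measurable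
  also have "\<dots> \<le> (\<integral>\<^sup>+z. indicator ?B z * ennreal (\<bar>f (x + z) - f x\<bar> powr p) \<partial>lborel)"
  proof (rule nn_integral_mono)
    fix z
    show "ennreal (g (x + z) powr p) \<le> indicator ?B z * ennreal (\<bar>f (x + z) - f x\<bar> powr p)"
    proof (cases "x + z \<in> Q")
      case True
      have "- (1 / real m) \<le> z $ i \<and> z $ i \<le> 1 / real m" for i
      proof -
        have "\<lfloor>real m * x $ i + real m * z $ i\<rfloor> = \<lfloor>real m * x $ i\<rfloor>"
          using True by (auto simp: Q_def cell_index_def vec_eq_iff distrib_left)
        then have "\<bar>real m * z $ i\<bar> \<le> 1" by linarith
        then have "real m * \<bar>z $ i\<bar> \<le> 1" by (simp add: abs_mult)
        then have "\<bar>z $ i\<bar> \<le> 1 / real m" using m by (simp add: field_simps)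
        then show ?thesis by linarith
      qed
      then have "z \<in> ?B" by (simp add: mem_box_cart)
      then show ?thesis using True by (simp add: g_def abs_minus_commute)
    qed (use p in \<open>simp add: g_def\<close>)
  qed
  finally show ?thesis by (simp add: mult_left_mono)
qed

text \<open>The reciprocal cell volume of order m^n cancels against the volume (2/m)^n of the cube
  of shifts, and |z| \<le> n/m leaves a factor of order m^(-p). The integrated quantity is the
  pointwise majorant, which spares the measurability of \<open>cell_average\<close>.\<close>

lemma cell_average_error:
  fixes f :: "real^'n::finite \<Rightarrow> real"
  assumes f: "test_fun \<Omega> f" and p: "p > 1" and m: "m > 0"
  shows "(\<integral>\<^sup>+x. ennreal (2 powr p * (2 * real m) ^ CARD('n)) *
    (\<integral>\<^sup>+z. indicator (cbox (\<chi> i. - (1 / real m)) (\<chi> i. 1 / real m)) z * ennreal (\<bar>f (x + z) - f x\<bar> powr p) \<partial>lborel) \<partial>lborel)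
    \<le> ennreal (2 powr p * 4 ^ CARD('n) * (2 * real CARD('n) / real m) powr p * pint lborel p (grad f))"
proof -
  note s = test_fun_smooth[OF f]
  note [measurable] = smooth_fun_measurable(1)[OF s]
  define B :: "(real^'n) set" where "B = cbox (\<chi> i. - (1 / real m)) (\<chi> i. 1 / real m)"
  have [measurable]: "B \<in> sets borel" by (simp add: B_def)
  let ?J = "\<lambda>x. \<integral>\<^sup>+z. indicator B z * ennreal (\<bar>f (x + z) - f x\<bar> powr p) \<partial>lborel"
  let ?c = "(2 * real CARD('n) / real m) powr p * pint lborel p (grad f)"
  have mB: "emeasure lborel B = ennreal ((2 / real m) ^ CARD('n))"
  proof -
    have "measure lborel B = (2 / real m) ^ CARD('n)"
      unfolding B_def using m by (subst content_cbox_cart) (auto simp: interval_ne_empty_cart)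
    then show ?thesis
      using emeasure_lborel_cbox_finite unfolding B_def by (subst emeasure_eq_ennreal_measure) (auto simp: less_top)
  qed
  have "(\<integral>\<^sup>+x. ?J x \<partial>lborel)
     = (\<integral>\<^sup>+z. (\<integral>\<^sup>+x. indicator B z * ennreal (\<bar>f (x + z) - f x\<bar> powr p) \<partial>lborel) \<partial>lborel)"
    by (intro lborel_pair.Fubini'[symmetric]) measurable
  also have "\<dots> \<le> (\<integral>\<^sup>+z. indicator B z * ennreal ?c \<partial>lborel)"
  proof (rule nn_integral_mono)
    fix z :: "real^'n"
    show "(\<integral>\<^sup>+x. indicator B z * ennreal (\<bar>f (x + z) - f x\<bar> powr p) \<partial>lborel)
      \<le> indicator B z * ennreal ?c"
    proof (cases "z \<in> B")
      case True
      have "\<bar>z $ i\<bar> \<le> 1 / real m" for i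
      proof -
        have "- (1 / real m) \<le> z $ i \<and> z $ i \<le> 1 / real m"
          using True by (simp add: B_def mem_box_cart)
        then show ?thesis by linarith
      qed
      then have "norm z \<le> (\<Sum>i\<in>(UNIV :: 'n set). 1 / real m)"
        by (intro order_trans[OF norm_le_l1_cart] sum_mono) auto
      then have "2 * norm z \<le> 2 * real CARD('n) / real m" by simp
      then have "(2 * norm z) powr p * pint lborel p (grad f) \<le> ?c"
        using p by (intro mult_right_mono powr_mono2) auto
      then show ?thesis using True nn_integral_increment_le[OF f p, of z]
        by (simp add: ennreal_leI order_trans)
    qed simp
  qed
  also have "\<dots> = ennreal ((2 / real m) ^ CARD('n)) * ennreal ?c"
    using mB by (subst nn_integral_multc) auto
  finally have 1: "(\<integral>\<^sup>+x. ?J x \<partial>lborel)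
     \<le> ennreal ((2 / real m) ^ CARD('n) * ?c)"
    by (simp add: ennreal_mult)
  have "(\<integral>\<^sup>+x. ennreal (2 powr p * (2 * real m) ^ CARD('n)) *
      ?J x \<partial>lborel)
    = ennreal (2 powr p * (2 * real m) ^ CARD('n)) * 
      (\<integral>\<^sup>+x. ?J x \<partial>lborel)"
    by (intro nn_integral_cmult) measurable
  also have "\<dots> \<le> ennreal (2 powr p * (2 * real m) ^ CARD('n)) *
      ennreal ((2 / real m) ^ CARD('n) * ?c)"
    by (intro mult_left_mono 1) auto
  also have "\<dots> = ennreal (2 powr p * ((2 * real m) ^ CARD('n) * (2 / real m) ^ CARD('n)) * (2 * real CARD('n) / real m) powr p * pint lborel p (grad f))"
    by (subst ennreal_mult[symmetric]) (auto simp: mult_ac)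
  also have "(2 * real m) ^ CARD('n) * (2 / real m) ^ CARD('n) = 4 ^ CARD('n)"
    unfolding power_mult_distrib[symmetric] using m by simp
  finally show ?thesis unfolding B_def .
qed

text \<open>Total boundedness in quantitative form: up to an error of order m^(-p) times the energy,
  f is controlled by its finitely many cell integrals over \<Omega>.\<close>

lemma pint_le_cell_integrals:
  fixes f :: "real^'n::finite \<Rightarrow> real"
  assumes f: "test_fun \<Omega> f" and p: "p > 1" and m: "m > 0" and \<Omega>: "bounded \<Omega>" "open \<Omega>"
    and \<eta>: "\<And>k. k \<in> cell_index m ` \<Omega> \<Longrightarrow> \<bar>cell_integral f (m, k)\<bar> \<le> \<eta>"
  shows "pint lborel p f \<le> 2 powr p * (2 powr p * 4 ^ CARD('n) * (2 * real CARD('n) / real m) powr p * pint lborel p (grad f))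
     + 2 powr p * (\<bar>\<eta>\<bar> * (2 * real m) ^ CARD('n)) powr p * measure lborel \<Omega>"
proof -
  let ?t = "(\<bar>\<eta>\<bar> * (2 * real m) ^ CARD('n)) powr p"
  let ?c = "2 powr p * 4 ^ CARD('n) * (2 * real CARD('n) / real m) powr p * pint lborel p (grad f)"
  let ?d = "\<lambda>x. \<bar>f x - cell_average f m x\<bar> powr p"
  note s = test_fun_smooth[OF f]
  note [measurable] = smooth_fun_measurable(1)[OF s] borel_open[OF \<Omega>(2)]
  let ?h = "\<lambda>x. ennreal (2 powr p * (2 * real m) ^ CARD('n)) *
    (\<integral>\<^sup>+z. indicator (cbox (\<chi> i. - (1 / real m)) (\<chi> i. 1 / real m)) z * ennreal (\<bar>f (x + z) - f x\<bar> powr p) \<partial>lborel)"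
  let ?b = "ennreal (?t)"
  have fin: "emeasure lborel \<Omega> = ennreal (measure lborel \<Omega>)"
    using emeasure_bounded_finite[OF \<Omega>(1)] by (intro emeasure_eq_ennreal_measure) (auto simp: less_top)
  have pw: "ennreal (norm (f x) powr p) \<le> ennreal (2 powr p) * (?h x + indicator \<Omega> x * ?b)" for x
  proof (cases "x \<in> \<Omega>")
    case False
    then have "f x = 0" using test_fun_support[OF f] by blast
    then show ?thesis using p by simp
  next
    case True
    define k where "k = cell_index m x"
    define v where "v = measure lborel {y. cell_index m y = cell_index m x}"
    have vlow: "(1 / (2 * real m)) ^ CARD('n) \<le> v" unfolding v_def using cell_measure[OF m] by auto
    have v: "v > 0" by (rule less_le_trans[OF _ vlow]) (use m in simp)
    have "1 / v \<le> 1 / (1 / (2 * real m)) ^ CARD('n)"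
      using vlow v m by (intro divide_left_mono) auto
    then have 1: "1 / v \<le> (2 * real m) ^ CARD('n)" by (simp add: power_one_over)
    have "\<bar>cell_average f m x\<bar> = \<bar>cell_integral f (m, k)\<bar> * (1 / v)"
      using v by (simp add: cell_average_def v_def k_def)
    also have "\<dots> \<le> \<bar>\<eta>\<bar> * (2 * real m) ^ CARD('n)"
      using \<eta>[of k] True v 1 by (intro mult_mono) (auto simp: k_def)
    finally have A: "\<bar>cell_average f m x\<bar> powr p \<le> ?t"
      using p by (intro powr_mono2) auto
    have "norm (f x) powr p \<le> 2 powr p * (?d x + \<bar>cell_average f m x\<bar> powr p)"
      using norm_add_powr_le[of p "f x - cell_average f m x" "cell_average f m x"] p by simp
    also have "\<dots> \<le> 2 powr p * (?d x + ?t)"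
      using A by simp
    finally have "ennreal (norm (f x) powr p) \<le> ennreal (2 powr p) * (ennreal (?d x) + ?b)"
      by (simp add: ennreal_leI flip: ennreal_mult ennreal_plus)
    also have "\<dots> \<le> ennreal (2 powr p) * (?h x + ?b)"
      by (intro mult_left_mono add_right_mono cell_average_error_pointwise[OF f p m]) auto
    finally show ?thesis using True by simp
  qed
  have "(\<integral>\<^sup>+x. ennreal (norm (f x) powr p) \<partial>lborel) \<le> (\<integral>\<^sup>+x. ennreal (2 powr p) * (?h x + indicator \<Omega> x * ?b) \<partial>lborel)"
    by (intro nn_integral_mono pw)
  also have "\<dots> = ennreal (2 powr p) * ((\<integral>\<^sup>+x. ?h x \<partial>lborel) + emeasure lborel \<Omega> * ?b)"
  proof -
    have "(\<integral>\<^sup>+x. indicator \<Omega> x * ?b \<partial>lborel) = emeasure lborel \<Omega> * ?b"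
      by (subst nn_integral_multc) auto
    then show ?thesis by (subst nn_integral_cmult, measurable) (subst nn_integral_add, auto)
  qed
  also have "\<dots> \<le> ennreal (2 powr p) * (ennreal (?c)
      + emeasure lborel \<Omega> * ?b)"
    by (intro mult_left_mono add_right_mono cell_average_error[OF f p m]) auto
  also have "\<dots> = ennreal (2 powr p * (?c)
     + 2 powr p * ?t * measure lborel \<Omega>)"
    unfolding fin by (simp add: algebra_simps flip: ennreal_mult ennreal_plus)
  finally show ?thesis
    by (intro LpI_nn_integral(2)[of f lborel p]) auto
qed

lemma cell_integral_diff:
  assumes "test_fun \<Omega> f" "test_fun \<Omega> g"
  shows "cell_integral (\<lambda>x. f x - g x) (m, k) = cell_integral f (m, k) - cell_integral g (m, k)"
proof -
  have "integrable lborel (\<lambda>y. indicat_real {y. cell_index m y = k} y * h y)" if h: "test_fun \<Omega> h" for h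
  proof -
    have "integrable lborel h"
    proof (rule integrable_norm_cancel)
      show "integrable lborel (\<lambda>x. norm (h x))" using Lp_integrable[OF test_fun_Lp(1)[OF h, of 1]] by simp
    qed (use smooth_fun_measurable(1)[OF test_fun_smooth[OF h]] in simp)
    then have "integrable lborel (\<lambda>y. indicat_real {y. cell_index m y = k} y *\<^sub>R h y)"
      by (intro integrable_mult_indicator) auto
    then show ?thesis by simp
  qed
  then show ?thesis using assms by (simp add: cell_integral_def right_diff_distrib)
qed

lemma abs_cell_integral_le:
  fixes f :: "real^'n::finite \<Rightarrow> real"
  assumes f: "test_fun \<Omega> f" and p: "p > 1" and m: "m > 0"
  shows "\<bar>cell_integral f (m, k)\<bar> \<le> 2 * pint lborel p f powr (1 / p)"
proof -
  define Q where "Q = {y. cell_index m y = k}"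
  have [measurable]: "Q \<in> sets borel" unfolding Q_def by measurable
  have fin: "emeasure lborel Q < \<infinity>" and v: "measure lborel Q \<le> 1"
    unfolding Q_def using cell_measure[OF m] by auto
  note L = test_fun_Lp(1)[OF f]
  note [measurable] = smooth_fun_measurable(1)[OF test_fun_smooth[OF f]]
  define g where "g y = indicat_real Q y * \<bar>f y\<bar>" for y
  have [measurable]: "g \<in> borel_measurable borel" unfolding g_def by measurable
  have "integrable lborel (\<lambda>y. indicat_real Q y *\<^sub>R (norm (f y) powr p))"
    using Lp_integrable[OF L] p by (intro integrable_mult_indicator) auto
  moreover have e: "(\<lambda>y. indicat_real Q y *\<^sub>R (norm (f y) powr p)) = (\<lambda>y. g y powr p)"
    by (auto simp: g_def indicator_def fun_eq_iff)
  ultimately have intgp: "integrable lborel (\<lambda>y. g y powr p)" by simp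
  have "\<bar>cell_integral f (m, k)\<bar> \<le> (\<integral>y. \<bar>indicat_real Q y * f y\<bar> \<partial>lborel)"
    by (simp add: cell_integral_def Q_def integral_abs_bound del: abs_mult)
  also have "\<dots> = (\<integral>y. g y powr 1 \<partial>lborel)" by (simp add: g_def abs_mult)
  also have "\<dots> \<le> 2 * measure lborel Q powr (1 - 1 / p) * (\<integral>y. g y powr p \<partial>lborel) powr (1 / p)"
    using p intgp fin by (intro integral_powr_le(2)) (auto simp: g_def)
  also have "\<dots> \<le> 2 * 1 * pint lborel p f powr (1 / p)"
  proof (intro mult_mono order_refl powr_mono2)
    show "measure lborel Q powr (1 - 1 / p) \<le> 1" using v p by (intro powr_le1) auto
    show "(\<integral>y. g y powr p \<partial>lborel) \<le> pint lborel p f"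
      unfolding pint_def using p
      by (intro integral_mono intgp Lp_integrable[OF L]) (auto simp: g_def indicator_def)
  qed (use p in auto)
  finally show ?thesis by simp
qed

text \<open>Along a diagonal subsequence all cell integrals converge. Given \<epsilon>, the mesh is
  fixed first to make the averaging error small; then only finitely many cells matter.\<close>

lemma rellich:
  fixes \<Omega> :: "(real^'n::finite) set" and f :: "nat \<Rightarrow> real^'n \<Rightarrow> real"
  assumes p: "p > 1" and \<Omega>: "bounded \<Omega>" "open \<Omega>"
    and f: "\<And>k. test_fun \<Omega> (f k)" and M: "\<And>k. pint lborel p (grad (f k)) \<le> M"
  obtains r where "strict_mono (r :: nat \<Rightarrow> nat)"
    "\<And>\<epsilon>. \<epsilon> > 0 \<Longrightarrow> \<exists>N. \<forall>k\<ge>N. \<forall>l\<ge>N. pint lborel p (\<lambda>x. f (r k) x - f (r l) x) \<le> \<epsilon>"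
proof -
  obtain K where K: "K \<ge> 0" "\<And>f. test_fun \<Omega> f \<Longrightarrow> pint lborel p f \<le> K * pint lborel p (grad f)"
    using poincare_inequality[OF \<Omega>(1) p] by blast
  define S :: "(nat \<times> (int^'n)) set" where "S = {0<..} \<times> UNIV"
  have "norm (cell_integral (f j) y) \<le> 2 * (K * M) powr (1 / p)" if yS: "y \<in> S" for j y
  proof -
    obtain m k where y: "y = (m, k)" "m > 0" using yS by (cases y) (auto simp: S_def)
    have "pint lborel p (f j) \<le> K * M"
      using K(2)[OF f] mult_left_mono[OF M K(1)] order_trans by blast
    then have "pint lborel p (f j) powr (1 / p) \<le> (K * M) powr (1 / p)"
      using p by (intro powr_mono2) auto
    then show ?thesis using abs_cell_integral_le[OF f p y(2), of j k] by (simp add: y)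
  qed
  \<comment> \<open>\<open>function_convergent_subsequence\<close> is Cantor's diagonal argument,
    applied to the bounded cell integrals as functions on the countable set
    \<open>S\<close>.\<close>
  then obtain r :: "nat \<Rightarrow> nat" where r: "strict_mono r" "\<And>y. y \<in> S \<Longrightarrow> \<exists>l. (\<lambda>j. cell_integral (f (r j)) y) \<longlonglongrightarrow> l"
    using function_convergent_subsequence[of S "\<lambda>j. cell_integral (f j)" "2 * (K * M) powr (1 / p)"]
    by (metis countable_subset[OF subset_UNIV] uncountable_def countableI_type)
  have M0: "M \<ge> 0" using M[of 0] pint_nonneg[of lborel p "grad (f 0)"] by linarith
  show ?thesis
  proof (rule that[OF r(1)])
    fix \<epsilon> :: real assume \<epsilon>: "\<epsilon> > 0"
    \<comment> \<open>The averaging constant of \<open>pint_le_cell_integrals\<close> times the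
      bound 2^p (2M) for the energy of a difference.\<close>
    define C where "C = 2 powr p * (2 powr p * 4 ^ CARD('n)) * (2 powr p * (2 * M))"
    have "(\<lambda>m. C * (2 * real CARD('n) / real m) powr p) \<longlonglongrightarrow> C * 0 powr p"
      using p by (intro tendsto_mult tendsto_const tendsto_powr' lim_const_over_n) auto
    then have "\<forall>\<^sub>F m in sequentially. C * (2 * real CARD('n) / real m) powr p < \<epsilon> / 2"
      using \<epsilon> p by (intro order_tendstoD(2)) auto
    then have "\<forall>\<^sub>F m in sequentially. C * (2 * real CARD('n) / real m) powr p < \<epsilon> / 2 \<and> m > 0"
      using eventually_gt_at_top[of 0] by eventually_elim auto
    then obtain m :: nat where m: "C * (2 * real CARD('n) / real m) powr p < \<epsilon> / 2" "m > 0"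
      unfolding eventually_sequentially by auto
    \<comment> \<open>Chosen so that the contribution of the cell averages is at most \<epsilon>/2;
      the + 1 keeps the denominator positive when \<Omega> has measure 0.\<close>
    define \<eta> where "\<eta> = (\<epsilon> / 2 / (2 powr p * (measure lborel \<Omega> + 1))) powr (1 / p) / (2 * real m) ^ CARD('n)"
    let ?c = "2 powr p * 4 ^ CARD('n) * (2 * real CARD('n) / real m) powr p"
    let ?t = "(\<bar>\<eta>\<bar> * (2 * real m) ^ CARD('n)) powr p"
    let ?D = "\<lambda>y k l. \<bar>cell_integral (f (r k)) (m, y) - cell_integral (f (r l)) (m, y)\<bar>"
    have \<Omega>1: "measure lborel \<Omega> + 1 > 0" using measure_nonneg[of lborel \<Omega>] by linarith
    with \<epsilon> m have \<eta>: "\<eta> > 0" unfolding \<eta>_def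
      by (intro divide_pos_pos) auto
    have \<eta>': "2 powr p * ?t * measure lborel \<Omega> \<le> \<epsilon> / 2"
    proof -
      have "(\<bar>\<eta>\<bar> * (2 * real m) ^ CARD('n)) = (\<epsilon> / 2 / (2 powr p * (measure lborel \<Omega> + 1))) powr (1 / p)"
        using \<eta> m by (simp add: \<eta>_def)
      then have "?t = \<epsilon> / 2 / (2 powr p * (measure lborel \<Omega> + 1))"
        using p \<epsilon> by (simp add: powr_powr add_nonneg_pos)
      then have "2 powr p * ?t * measure lborel \<Omega> = \<epsilon> / 2 * (measure lborel \<Omega> / (measure lborel \<Omega> + 1))"
        by simp
      also have "\<dots> \<le> \<epsilon> / 2 * 1"
        using \<epsilon> \<Omega>1 by (intro mult_left_mono) (auto simp: divide_le_eq)
      finally show ?thesis by simp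
    qed
    have "\<forall>\<^sub>F N in sequentially. \<forall>y\<in>cell_index m ` \<Omega>. \<forall>k\<ge>N. \<forall>l\<ge>N.
        ?D y k l \<le> \<eta>"
    proof (intro eventually_ball_finite finite_cell_index_image \<Omega> ballI)
      fix y
      have "Cauchy (\<lambda>j. cell_integral (f (r j)) (m, y))"
        using r(2)[of "(m, y)"] m by (auto simp: S_def intro: LIMSEQ_imp_Cauchy)
      then obtain N where "\<forall>k\<ge>N. \<forall>l\<ge>N. norm (cell_integral (f (r k)) (m, y) - cell_integral (f (r l)) (m, y)) < \<eta>"
        using CauchyD[OF _ \<eta>] by blast
      then show "\<forall>\<^sub>F N in sequentially. \<forall>k\<ge>N. \<forall>l\<ge>N.
        ?D y k l \<le> \<eta>"
        unfolding eventually_sequentially by (intro exI[of _ N]) (auto intro: less_imp_le)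
    qed
    then obtain N where N: "\<And>y k l. y \<in> cell_index m ` \<Omega> \<Longrightarrow> k \<ge> N \<Longrightarrow> l \<ge> N \<Longrightarrow>
        ?D y k l \<le> \<eta>"
      unfolding eventually_sequentially by blast
    show "\<exists>N. \<forall>k\<ge>N. \<forall>l\<ge>N. pint lborel p (\<lambda>x. f (r k) x - f (r l) x) \<le> \<epsilon>"
    proof (intro exI allI impI)
      fix k l assume kl: "k \<ge> N" "l \<ge> N"
      let ?g = "\<lambda>x. f (r k) x - f (r l) x"
      have tg: "test_fun \<Omega> ?g" by (intro test_fun_diff f)
      have "pint lborel p (grad ?g) = pint lborel p (\<lambda>x. grad (f (r k)) x - grad (f (r l)) x)"
        by (simp add: pint_def grad_diff test_fun_differentiable[OF f])
      also have "\<dots> \<le> 2 powr p * (pint lborel p (grad (f (r k))) + pint lborel p (grad (f (r l))))"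
        using p by (intro Lp_diff test_fun_Lp[OF f]) auto
      also have "\<dots> \<le> 2 powr p * (2 * M)"
        using M[of "r k"] M[of "r l"] by (intro mult_left_mono) auto
      finally have E: "pint lborel p (grad ?g) \<le> 2 powr p * (2 * M)" .
      have "pint lborel p ?g \<le> 2 powr p * (?c * pint lborel p (grad ?g))
         + 2 powr p * ?t * measure lborel \<Omega>"
        using N kl by (intro pint_le_cell_integrals[OF tg p m(2) \<Omega>])
          (auto simp: cell_integral_diff[OF f f])
      also have "\<dots> \<le> 2 powr p * (?c * (2 powr p * (2 * M))) + \<epsilon> / 2"
        by (intro add_mono \<eta>' mult_left_mono E) auto
      also have "\<dots> = C * (2 * real CARD('n) / real m) powr p + \<epsilon> / 2"
        by (simp add: C_def)
      also have "\<dots> \<le> \<epsilon>" using m(1) by simp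
      finally show "pint lborel p ?g \<le> \<epsilon>" .
    qed
  qed
qed

section \<open>Compactness of the embedding into \<open>L^p(\<mu>)\<close>\<close>

lemma norm_sum_powr_disjoint:
  fixes v :: "nat \<Rightarrow> 'a::real_normed_vector"
  assumes "\<And>i j. i < N \<Longrightarrow> j < N \<Longrightarrow> v i \<noteq> 0 \<Longrightarrow> v j \<noteq> 0 \<Longrightarrow> i = j"
  shows "norm (\<Sum>j<N. v j) powr r \<le> (\<Sum>j<N. norm (v j) powr r)"
proof (cases "\<exists>i<N. v i \<noteq> 0")
  case True
  then obtain i where i: "i < N" "v i \<noteq> 0" by blast
  then have "v j = 0" if "j < N" "j \<noteq> i" for j using assms[of i j] that by blast
  then have "(\<Sum>j<N. v j) = (\<Sum>j<N. if j = i then v i else 0)" by (intro sum.cong) auto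
  also have "\<dots> = v i" using i by simp
  finally show ?thesis using i by (auto intro!: member_le_sum[of i "{..<N}" "\<lambda>j. norm (v j) powr r"])
qed (auto intro: sum_nonneg)

lemma set_integral_lebesgue_grad:
  assumes "test_fun \<Omega> f" "p > 0"
  shows "(LINT x:\<Omega>|lebesgue. norm (grad f x) powr p) = pint lborel p (grad f)"
proof -
  have "grad f x = 0" if "x \<notin> \<Omega>" for x using test_fun_support[OF assms(1)] that by blast
  then have "(LINT x:\<Omega>|lebesgue. norm (grad f x) powr p) = (\<integral>x. norm (grad f x) powr p \<partial>lebesgue)"
    unfolding set_lebesgue_integral_def using assms(2)
    by (intro Bochner_Integration.integral_cong) (auto simp: indicator_def)
  also have "\<dots> = pint lborel p (grad f)"
    using smooth_fun_measurable(2)[OF test_fun_smooth[OF assms(1)]] unfolding pint_def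
    by (intro integral_completion) measurable
  finally show ?thesis .
qed

locale mu_embedding =
  fixes \<Omega> :: "(real^'n::finite) set" and p q C :: real and \<mu> :: "(real^'n) measure"
  assumes open_\<Omega>: "open \<Omega>" and bounded_\<Omega>: "bounded \<Omega>"
    and p: "1 < p" "p \<le> real CARD('n)"
    and q: "p < q"
    and borel_\<mu>: "sets \<mu> = sets borel"
    and finite_\<mu>: "finite_measure \<mu>"
    and pos_\<mu>: "emeasure \<mu> \<Omega> > 0"
    and supp_\<mu>: "emeasure \<mu> (UNIV - \<Omega>) = 0"
    and C: "C > 0"
    and embed: "\<And>\<phi>. test_fun \<Omega> \<phi> \<Longrightarrow>
        (\<integral>x. \<bar>\<phi> x\<bar> powr q \<partial>\<mu>) powr (1 / q)
          \<le> C * (LINT x:\<Omega>|lebesgue. norm (grad \<phi> x) powr p) powr (1 / p)"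
begin

sublocale finite_measure \<mu> by (rule finite_\<mu>)

declare borel_\<mu>[measurable_cong]

abbreviation E :: "(real^'n \<Rightarrow> real) \<Rightarrow> real" where "E f \<equiv> pint lborel p (grad f)"

lemma p_pos: "0 < p" and q_pos: "0 < q" using p q by auto

lemma space_\<mu>: "space \<mu> = UNIV"
  using sets_eq_imp_space_eq[OF borel_\<mu>] by simp

lemma test_fun_Lp_\<mu>: "test_fun \<Omega> f \<Longrightarrow> r > 0 \<Longrightarrow> Lp \<mu> r f"
  by (rule test_fun_Lp(3)[OF _ _ finite_\<mu> borel_\<mu>])

lemma embed_powr:
  assumes "test_fun \<Omega> f" "r > 0"
  shows "pint \<mu> q f powr (r / q) \<le> C powr r * E f powr (r / p)"
proof -
  have "pint \<mu> q f powr (1 / q) \<le> C * E f powr (1 / p)"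
    using embed[OF assms(1)] set_integral_lebesgue_grad[OF assms(1) p_pos] by (simp add: pint_def)
  then have "(pint \<mu> q f powr (1 / q)) powr r \<le> (C * E f powr (1 / p)) powr r"
    using assms by (intro powr_mono2) auto
  then show ?thesis by (simp add: powr_powr powr_mult)
qed

text \<open>The gradient contributes s^(-p) and the volume s^n. The assumption p \<le> n enters
  here: it bounds s^(n-p) for s \<le> 1, so shrinking the bump does not raise the energy
  bound.\<close>

lemma energy_bump_le:
  fixes a :: "real^'n"
  assumes "0 < s" "s \<le> 1"
  shows "E (bump a s) \<le> (4 / bump_primitive 4) powr p * 4 ^ CARD('n)"
proof -
  define K where "K = 4 / bump_primitive 4"
  have K: "K > 0" using bump_primitive_pos by (simp add: K_def)
  define B where "B = cbox (a - (\<chi> i. 2 * s)) (a + (\<chi> i. 2 * s))"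
  have fin: "emeasure lborel B < \<infinity>" unfolding B_def by (intro emeasure_bounded_finite bounded_cbox)
  have mB: "measure lborel B = (4 * s) ^ CARD('n)"
    unfolding B_def using assms by (subst content_cbox_cart) (auto simp: interval_ne_empty_cart)
  have sub: "x \<in> B" if "norm (x - a) < 2 * s" for x
  proof -
    have "\<bar>x $ i - a $ i\<bar> \<le> 2 * s" for i
      using component_le_norm_cart[of "x - a" i] that by simp
    then show ?thesis by (auto simp: B_def mem_box_cart abs_le_iff algebra_simps)
  qed
  have "E (bump a s) \<le> (\<integral>x. (K / s) powr p * indicat_real B x \<partial>lborel)"
    unfolding pint_def
  proof (rule integral_mono)
    show "integrable lborel (\<lambda>x. norm (grad (bump a s) x) powr p)"
      using test_fun_Lp(2)[OF test_fun_bump[of s a UNIV] p_pos] assms by (simp add: Lp_def)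
    show "integrable lborel (\<lambda>x. (K / s) powr p * indicat_real B x)"
      using fin by (intro integrable_mult_right) (auto simp: B_def)
    fix x
    show "norm (grad (bump a s) x) powr p \<le> (K / s) powr p * indicat_real B x"
    proof (cases "norm (x - a) < 2 * s")
      case True
      have "norm (grad (bump a s) x) powr p \<le> (K / s) powr p"
        using norm_grad_bump_le[OF assms(1), of a x] p by (intro powr_mono2) (auto simp: K_def)
      then show ?thesis using sub[OF True] by simp
    qed (use grad_bump_eq_0[OF assms(1), of x a] in auto)
  qed
  also have "\<dots> = (K / s) powr p * (4 * s) ^ CARD('n)"
    using fin by (simp add: mB)
  also have "\<dots> = K powr p * 4 ^ CARD('n) * s powr (real CARD('n) - p)"
    using assms K by (simp add: powr_divide powr_diff powr_realpow power_mult_distrib)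
  also have "\<dots> \<le> K powr p * 4 ^ CARD('n) * 1"
    using assms p by (intro mult_left_mono powr_le1) auto
  finally show ?thesis by (simp add: K_def)
qed

text \<open>The average of \<open>N\<close> dyadic bumps around \<open>a\<close> is \<open>1\<close> at \<open>a\<close>, while the gradients have disjoint
  supports, so that its energy is of order \<open>N powr (1 - p)\<close>.\<close>
lemma measure_singleton_interior:
  assumes "a \<in> \<Omega>"
  shows "measure \<mu> {a} = 0"
proof -
  obtain e where e: "e > 0" "cball a e \<subseteq> \<Omega>" using open_\<Omega> assms open_contains_cball by blast
  define s0 where "s0 = min 1 (e / 2)"
  have s0: "0 < s0" "s0 \<le> 1" "2 * s0 \<le> e" using e by (auto simp: s0_def)
  define s where "s j = s0 / 2 ^ j" for j :: nat
  have s: "0 < s j" "s j \<le> s0" "s j \<le> 1" for j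
  proof -
    show "0 < s j" using s0 by (simp add: s_def)
    have "s0 / 2 ^ j \<le> s0 / 1" using s0 by (intro divide_left_mono) auto
    then show "s j \<le> s0" by (simp add: s_def)
    then show "s j \<le> 1" using s0 by simp
  qed
  \<comment> \<open>Halving the radii makes the open annuli s_j < |x - a| < 2 s_j, which contain the
    nonzero gradients, pairwise disjoint.\<close>
  have sd: "2 * s j \<le> s i" if "i < j" for i j
  proof -
    have "(2::real) ^ Suc i \<le> 2 ^ j" using that by (intro power_increasing) auto
    then have "s0 / 2 ^ j \<le> s0 / 2 ^ Suc i" using s0 by (intro divide_left_mono) auto
    then show ?thesis by (simp add: s_def)
  qed
  define K where "K = (4 / bump_primitive 4) powr p * 4 ^ CARD('n)"
  define \<phi> where "\<phi> N x = (1 / real N) * (\<Sum>j<N. bump a (s j) x)" for N x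
  let ?g = "\<lambda>j. grad (bump a (s j))"
  let ?M = "\<lambda>N. C powr q * (K * real N powr (1 - p)) powr (q / p)"
  have sm: "smooth_fun (bump a (s j))" for j by (rule smooth_fun_bump)
  have t\<phi>: "test_fun \<Omega> (\<phi> N)" for N
  proof (rule test_funI)
    show "smooth_fun (\<phi> N)" unfolding \<phi>_def by (intro smooth_fun_mult smooth_fun_const smooth_fun_sum sm)
    show "cball a e \<subseteq> \<Omega>" by (rule e)
    fix x assume "x \<notin> cball a e"
    then have "norm (x - a) \<ge> 2 * s j" for j using s(2)[of j] s0 by (simp add: dist_norm norm_minus_commute)
    then show "\<phi> N x = 0" by (simp add: \<phi>_def bump_eq_0 s)
  qed simp
  have E\<phi>: "E (\<phi> N) \<le> K * real N powr (1 - p)" if N: "N > 0" for N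
  proof -
    have g: "grad (\<phi> N) x = (1 / real N) *\<^sub>R (\<Sum>j<N. ?g j x)" for x
      unfolding \<phi>_def
      by (subst grad_scale) (auto simp: grad_sum sm intro!: smooth_fun_differentiable smooth_fun_sum)
    have Lj: "Lp lborel p (?g j)" for j
      using s by (intro test_fun_Lp[OF test_fun_bump[of "s j" a UNIV]] p_pos) auto
    have pw: "norm (grad (\<phi> N) x) powr p \<le> real N powr (- p) * (\<Sum>j<N. norm (?g j x) powr p)" for x
    proof -
      have "norm (\<Sum>j<N. ?g j x) powr p \<le> (\<Sum>j<N. norm (?g j x) powr p)"
      proof (rule norm_sum_powr_disjoint)
        fix i j assume nz: "?g i x \<noteq> 0" "?g j x \<noteq> 0"
        have "s k < norm (x - a) \<and> norm (x - a) < 2 * s k" if "?g k x \<noteq> 0" for k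
          using grad_bump_eq_0[OF s(1)[of k], of x a] that by (meson not_le)
        from this[OF nz(1)] this[OF nz(2)] show "i = j"
          using sd[of i j] sd[of j i] by (cases i j rule: linorder_cases) auto
      qed
      then have "(1 / real N) powr p * norm (\<Sum>j<N. ?g j x) powr p
          \<le> (1 / real N) powr p * (\<Sum>j<N. norm (?g j x) powr p)"
        by (intro mult_left_mono) auto
      moreover have "(1 / real N) powr p = real N powr (- p)"
        using N by (simp add: powr_divide powr_minus_divide)
      moreover have "norm (grad (\<phi> N) x) powr p = (1 / real N) powr p * norm (\<Sum>j<N. ?g j x) powr p"
        by (simp only: g norm_scaleR powr_mult) simp
      ultimately show ?thesis by simp
    qed
    have "E (\<phi> N) \<le> (\<integral>x. real N powr (- p) * (\<Sum>j<N. norm (?g j x) powr p) \<partial>lborel)"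
      unfolding pint_def
      by (intro integral_mono pw Lp_integrable[OF test_fun_Lp(2)[OF t\<phi> p_pos]] integrable_mult_right
          Bochner_Integration.integrable_sum Lp_integrable[OF Lj])
    also have "\<dots> = real N powr (- p) * (\<Sum>j<N. E (bump a (s j)))"
      using Lp_integrable[OF Lj] by (simp add: pint_def)
    also have "\<dots> \<le> real N powr (- p) * (\<Sum>j<N. K)"
      unfolding K_def by (intro mult_left_mono sum_mono energy_bump_le s) auto
    also have "\<dots> = K * real N powr (1 - p)"
      using N by (simp add: powr_diff powr_minus_divide)
    finally show ?thesis .
  qed
  \<comment> \<open>The embedding is tested with \<phi>_N, which equals 1 at a; as p > 1, the
    right-hand side tends to 0.\<close>
  have bd: "measure \<mu> {a} \<le> ?M N" if N: "N > 0" for N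
  proof -
    have "\<phi> N a = 1" using N s by (simp add: \<phi>_def bump_eq_1 less_imp_le)
    then have "measure \<mu> {a} = (\<integral>x. indicat_real {a} x * \<bar>\<phi> N x\<bar> powr q \<partial>\<mu>)"
    proof -
      have "(\<integral>x. indicat_real {a} x * \<bar>\<phi> N x\<bar> powr q \<partial>\<mu>) = (\<integral>x. indicat_real {a} x \<partial>\<mu>)"
        using \<open>\<phi> N a = 1\<close> by (intro Bochner_Integration.integral_cong) (auto simp: indicator_def)
      then show ?thesis using borel_\<mu> by (simp add: space_\<mu>)
    qed
    also have "\<dots> \<le> pint \<mu> q (\<phi> N)"
      unfolding pint_def
    proof (rule integral_mono)
      show i: "integrable \<mu> (\<lambda>x. norm (\<phi> N x) powr q)"
        by (rule Lp_integrable[OF test_fun_Lp_\<mu>[OF t\<phi> q_pos]])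
      have "integrable \<mu> (\<lambda>x. indicat_real {a} x *\<^sub>R (norm (\<phi> N x) powr q))"
        using borel_\<mu> by (intro integrable_mult_indicator i) auto
      then show "integrable \<mu> (\<lambda>x. indicat_real {a} x * \<bar>\<phi> N x\<bar> powr q)" by simp
    qed (auto simp: indicator_def)
    also have "\<dots> \<le> C powr q * E (\<phi> N) powr (q / p)"
      using embed_powr[OF t\<phi> q_pos, of N] q_pos by simp
    also have "\<dots> \<le> ?M N"
      using E\<phi>[OF N] p_pos q_pos by (intro mult_left_mono powr_mono2) auto
    finally show ?thesis .
  qed
  have "(\<lambda>N. real N powr (1 - p)) \<longlonglongrightarrow> 0"
    using p by (intro tendsto_neg_powr filterlim_real_sequentially) auto
  then have "(\<lambda>N. ?M N) \<longlonglongrightarrow> C powr q * (K * 0) powr (q / p)"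
    using p_pos q_pos by (intro tendsto_mult tendsto_const tendsto_powr') (auto simp: K_def)
  then have lim: "(\<lambda>N. ?M N) \<longlonglongrightarrow> 0" by simp
  have "measure \<mu> {a} \<le> 0"
    by (rule tendsto_lowerbound[OF lim]) (auto intro!: bd eventually_mono[OF eventually_gt_at_top[of 0]])
  then show ?thesis using measure_nonneg[of \<mu> "{a}"] by linarith
qed

lemma measure_singleton_eq_0: "measure \<mu> {a} = 0"
proof (cases "a \<in> \<Omega>")
  case False
  have "emeasure \<mu> {a} \<le> emeasure \<mu> (UNIV - \<Omega>)"
    using False open_\<Omega> by (intro emeasure_mono) (auto simp: borel_\<mu>)
  then show ?thesis using supp_\<mu> by (simp add: measure_def)
qed (rule measure_singleton_interior)

text \<open>Continuity from above makes some ball around each point small; a Lebesgue number of the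
  resulting cover of the compact closure of \<Omega> makes the radius uniform.\<close>

lemma measure_ball_uniformly_small:
  assumes "\<epsilon> > 0"
  obtains \<delta> where "\<delta> > 0" "\<And>z. measure \<mu> (ball z \<delta>) \<le> \<epsilon>"
proof -
  have ex: "\<exists>r>0. measure \<mu> (ball x r) \<le> \<epsilon>" for x
  proof -
    have "(\<lambda>i. measure \<mu> (ball x (1 / real (Suc i)))) \<longlonglongrightarrow> measure \<mu> (\<Inter>i. ball x (1 / real (Suc i)))"
      by (rule finite_Lim_measure_decseq)
        (auto simp: borel_\<mu> decseq_def intro!: subset_ball divide_left_mono)
    moreover have "(\<Inter>i. ball x (1 / real (Suc i))) = {x}"
    proof -
      have "y = x" if "\<And>i. dist x y < 1 / real (Suc i)" for y
      proof (rule ccontr)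
        assume "y \<noteq> x"
        then obtain i where "1 / real (Suc i) < dist x y" using nat_approx_posE[of "dist x y"] by auto
        with that[of i] show False by simp
      qed
      then show ?thesis by auto
    qed
    ultimately have "(\<lambda>i. measure \<mu> (ball x (1 / real (Suc i)))) \<longlonglongrightarrow> 0"
      by (simp add: measure_singleton_eq_0)
    then have "\<forall>\<^sub>F i in sequentially. measure \<mu> (ball x (1 / real (Suc i))) < \<epsilon>"
      using assms by (rule order_tendstoD(2))
    then obtain i where "measure \<mu> (ball x (1 / real (Suc i))) < \<epsilon>"
      by (auto simp: eventually_sequentially)
    then show ?thesis by (intro exI[of _ "1 / real (Suc i)"]) auto
  qed
  define \<G> where "\<G> = {ball x r | x r. r > 0 \<and> measure \<mu> (ball x r) \<le> \<epsilon>}"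
  have "compact (closure \<Omega>)" using bounded_\<Omega> by (simp add: compact_closure)
  moreover have "closure \<Omega> \<subseteq> \<Union>\<G>"
  proof
    fix x
    obtain r where "r > 0" "measure \<mu> (ball x r) \<le> \<epsilon>" using ex by blast
    then have "ball x r \<in> \<G>" "x \<in> ball x r" by (auto simp: \<G>_def)
    then show "x \<in> \<Union>\<G>" by blast
  qed
  moreover have "open G" if "G \<in> \<G>" for G using that by (auto simp: \<G>_def)
  ultimately obtain e where e: "e > 0" "\<And>x. x \<in> closure \<Omega> \<Longrightarrow> \<exists>G\<in>\<G>. ball x e \<subseteq> G"
    using Heine_Borel_lemma[of "closure \<Omega>" \<G>] by metis
  show ?thesis
  proof (rule that[of "e / 2"])
    show "e / 2 > 0" using e by simp
    fix z
    show "measure \<mu> (ball z (e / 2)) \<le> \<epsilon>"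
    \<comment> \<open>Half the Lebesgue number allows centers outside the closure: a ball that meets
      \<Omega> in y lies in \<open>ball y e\<close>, and one that misses \<Omega> is null.\<close>
    proof (cases "ball z (e / 2) \<inter> \<Omega> = {}")
      case True
      then have "emeasure \<mu> (ball z (e / 2)) \<le> emeasure \<mu> (UNIV - \<Omega>)"
        using open_\<Omega> by (intro emeasure_mono) (auto simp: borel_\<mu>)
      then show ?thesis using supp_\<mu> assms by (simp add: measure_def)
    next
      case False
      then obtain y where y: "dist z y < e / 2" "y \<in> \<Omega>" by auto
      then obtain G where G: "G \<in> \<G>" "ball y e \<subseteq> G" using e(2) closure_subset by blast
      have "ball z (e / 2) \<subseteq> ball y e"
      proof
        fix w assume "w \<in> ball z (e / 2)"
        then show "w \<in> ball y e" using y dist_triangle[of y w z] by (simp add: dist_commute)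
      qed
      then have "measure \<mu> (ball z (e / 2)) \<le> measure \<mu> G"
        using G by (intro finite_measure_mono) (auto simp: borel_\<mu> \<G>_def)
      also have "\<dots> \<le> \<epsilon>" using G by (auto simp: \<G>_def)
      finally show ?thesis .
    qed
  qed
qed

end

text \<open>Needed for integrating over the center z of a cutoff at fixed x; evenness turns the
  reflection into a translation.\<close>

lemma nn_integral_lborel_reflect_even:
  fixes x :: "'a::euclidean_space"
  assumes "h \<in> borel_measurable borel" "\<And>y. h (- y) = h y"
  shows "(\<integral>\<^sup>+z. h (x - z) \<partial>lborel) = (\<integral>\<^sup>+z. h z \<partial>lborel)"
proof -
  have "h (x - z) = h (- x + z)" for z using assms(2)[of "x - z"] by simp
  then show ?thesis using nn_integral_lborel_shift[OF assms(1), of "- x"] by simp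
qed

lemma norm_grad_bump_translate: "norm (grad (bump a s) x) = norm (grad (bump 0 s) (x - a))"
  and norm_grad_bump_reflect: "norm (grad (bump 0 s) (- y)) = norm (grad (bump 0 s) y)"
  by (simp_all add: grad_bump)

context mu_embedding
begin

text \<open>The gain from q > p: f times the cutoff lives in a ball of \<mu>-measure at most
  \<epsilon>, and Hoelder's inequality produces \<epsilon>^(1-p/q). The product rule adds the term
  without gradient of f. Writing the cutoff as a translate of one fixed bump makes both sides
  jointly measurable in x and z.\<close>

lemma localized_embedding:
  assumes f: "test_fun \<Omega> f" and s: "s > 0" and \<epsilon>: "measure \<mu> (ball z (2 * s)) \<le> \<epsilon>"
  shows "(\<integral>\<^sup>+x. ennreal (\<bar>f x\<bar> powr p * bump 0 s (x - z) powr p) \<partial>\<mu>)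
    \<le> ennreal (2 * \<epsilon> powr (1 - p / q) * C powr p * 2 powr p) *
      (\<integral>\<^sup>+x. ennreal (bump 0 s (x - z) powr p * norm (grad f x) powr p
        + \<bar>f x\<bar> powr p * norm (grad (bump 0 s) (x - z)) powr p) \<partial>lborel)"
proof -
  let ?e = "\<lambda>x. bump 0 s (x - z) powr p * norm (grad f x) powr p + \<bar>f x\<bar> powr p * norm (grad (bump 0 s) (x - z)) powr p"
  define g where "g x = f x * bump z s x" for x
  have tg: "test_fun \<Omega> g" unfolding g_def by (intro test_fun_mult_smooth f smooth_fun_bump)
  note [measurable] = smooth_fun_measurable[OF test_fun_smooth[OF f]] smooth_fun_measurable[OF smooth_fun_bump]
    smooth_fun_measurable[OF test_fun_smooth[OF tg]]
  have Lq: "integrable \<mu> (\<lambda>x. \<bar>g x\<bar> powr q)" and Lp: "Lp \<mu> p g"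
    using test_fun_Lp_\<mu>[OF tg] p_pos q_pos by (auto simp: Lp_def)
  have "(\<integral>x. \<bar>g x\<bar> powr p \<partial>\<mu>) \<le> 2 * measure \<mu> (ball z (2 * s)) powr (1 - p / q) * (\<integral>x. \<bar>g x\<bar> powr q \<partial>\<mu>) powr (p / q)"
  proof (rule integral_powr_le(2)[OF p_pos q _ _ _ _ _ Lq])
    show "ball z (2 * s) \<in> sets \<mu>" by (simp add: borel_\<mu>)
    show "emeasure \<mu> (ball z (2 * s)) < \<infinity>" by (simp add: less_top[symmetric])
    show "(\<lambda>x. \<bar>g x\<bar>) \<in> borel_measurable \<mu>" by measurable
    show "\<bar>g x\<bar> = 0" if "x \<notin> ball z (2 * s)" for x
      using that s bump_eq_0[of s x z] by (simp add: g_def dist_norm norm_minus_commute)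
  qed simp
  also have "\<dots> \<le> 2 * \<epsilon> powr (1 - p / q) * (C powr p * E g)"
  proof (intro mult_mono powr_mono2 \<epsilon>)
    show "(\<integral>x. \<bar>g x\<bar> powr q \<partial>\<mu>) powr (p / q) \<le> C powr p * E g"
      using embed_powr[OF tg p_pos] p_pos by (simp add: pint_def)
    show "0 \<le> 1 - p / q" using q q_pos by simp
  qed (use p_pos in auto)
  finally have 1: "pint \<mu> p g \<le> 2 * \<epsilon> powr (1 - p / q) * (C powr p * E g)" by (simp add: pint_def)
  have "(\<integral>\<^sup>+x. ennreal (\<bar>f x\<bar> powr p * bump 0 s (x - z) powr p) \<partial>\<mu>) = (\<integral>\<^sup>+x. ennreal (norm (g x) powr p) \<partial>\<mu>)"
    by (intro nn_integral_cong) (simp add: g_def abs_mult powr_mult bump_bounds bump_translate[of z])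
  also have "\<dots> = ennreal (pint \<mu> p g)" by (rule nn_integral_pint[OF Lp])
  also have "\<dots> \<le> ennreal (2 * \<epsilon> powr (1 - p / q) * C powr p) * ennreal (E g)"
    using 1 by (simp add: ennreal_leI mult.assoc flip: ennreal_mult)
  also have "ennreal (E g) = (\<integral>\<^sup>+x. ennreal (norm (grad g x) powr p) \<partial>lborel)"
    by (rule nn_integral_pint[OF test_fun_Lp(2)[OF tg p_pos], symmetric])
  also have "\<dots> \<le> (\<integral>\<^sup>+x. ennreal (2 powr p) * ennreal (?e x) \<partial>lborel)"
  proof (rule nn_integral_mono)
    fix x
    have "grad g x = bump z s x *\<^sub>R grad f x + f x *\<^sub>R grad (bump z s) x"
      unfolding g_def using grad_mult[OF test_fun_differentiable[OF f, of x] smooth_fun_differentiable[OF smooth_fun_bump[where a=z and s=s], of x]]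
      by simp
    then have "norm (grad g x) powr p \<le> 2 powr p * (norm (bump z s x *\<^sub>R grad f x) powr p + norm (f x *\<^sub>R grad (bump z s) x) powr p)"
      using p_pos by (simp only: norm_add_powr_le less_imp_le)
    also have "\<dots> = 2 powr p * (?e x)"
      using norm_grad_bump_translate[where a=z and s=s and x=x] by (simp add: powr_mult bump_bounds bump_translate[of z])
    finally show "ennreal (norm (grad g x) powr p) \<le> ennreal (2 powr p) * ennreal (?e x)"
      by (subst ennreal_mult[symmetric]) (auto intro: ennreal_leI)
  qed
  also have "\<dots> = ennreal (2 powr p) * (\<integral>\<^sup>+x. ennreal (?e x) \<partial>lborel)"
    by (rule nn_integral_cmult) measurable
  finally show ?thesis
    by (simp add: mult_left_mono mult.assoc ennreal_mult)
qed

text \<open>The localized embeddings are integrated over the center \<open>z\<close> of the cutoff; this replaces a covering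
  of \<open>\<Omega>\<close> by balls with bounded overlap.\<close>
lemma ehrling_inequality:
  assumes "\<epsilon> > 0"
  obtains K where "K \<ge> 0" "\<And>f. test_fun \<Omega> f \<Longrightarrow> pint \<mu> p f \<le> \<epsilon> * E f + K * pint lborel p f"
proof -
  have pq: "1 - p / q > 0" using q q_pos by simp
  define D where "D = 2 * C powr p * 2 powr p"
  have D: "D > 0" using C by (simp add: D_def)
  \<comment> \<open>Solves D \<eta>^(1-p/q) = \<epsilon>, so that the constant of
    \<open>localized_embedding\<close> becomes exactly \<epsilon>.\<close>
  define \<eta> where "\<eta> = (\<epsilon> / D) powr (1 / (1 - p / q))"
  have \<eta>: "\<eta> > 0" "\<eta> powr (1 - p / q) = \<epsilon> / D"
    using assms D pq by (auto simp: \<eta>_def powr_powr)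
  obtain \<delta> where \<delta>: "\<delta> > 0" "\<And>z. measure \<mu> (ball z \<delta>) \<le> \<eta>"
    using measure_ball_uniformly_small[OF \<eta>(1)] by blast
  define s where "s = \<delta> / 2"
  have s: "s > 0" "\<And>z. measure \<mu> (ball z (2 * s)) \<le> \<eta>" using \<delta> by (auto simp: s_def)
  have tb: "test_fun UNIV (bump (0 :: real^'n) s)" by (rule test_fun_bump[OF s(1)]) simp
  note Lb = test_fun_Lp(1,2)[OF tb p_pos]
  note [measurable] = smooth_fun_measurable[OF smooth_fun_bump]
  \<comment> \<open>By translation and reflection, integrating the cutoff terms over z gives these
    two numbers for every x; c must be positive because the final inequality is divided by
    it.\<close>
  define c where "c = pint lborel p (bump (0 :: real^'n) s)"
  define d where "d = pint lborel p (grad (bump (0 :: real^'n) s))"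
  have c: "c > 0"
  proof -
    have "c \<noteq> 0"
    proof
      assume "c = 0"
      then have "AE x in lborel. bump (0 :: real^'n) s x = 0" unfolding c_def using pint_eq_0_iff[OF Lb(1)] by simp
      then have "AE x in lborel. x \<notin> ball (0 :: real^'n) s"
        by eventually_elim (use bump_eq_1[OF s(1), of _ "0 :: real^'n"] in fastforce)
      then have "emeasure lborel (ball (0 :: real^'n) s) = 0"
        by (subst (asm) AE_iff_measurable[OF _ refl]) (auto simp: ball_def)
      then show False
        using content_ball_pos[OF s(1), of "0 :: real^'n"] by (simp add: measure_def)
    qed
    moreover have "c \<ge> 0" by (simp add: c_def)
    ultimately show ?thesis by simp
  qed
  have cn: "(\<integral>\<^sup>+z. ennreal (bump 0 s (x - z) powr p) \<partial>lborel) = ennreal c" for x :: "real^'n"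
  proof -
    have "(\<integral>\<^sup>+z. ennreal (bump 0 s (x - z) powr p) \<partial>lborel) = (\<integral>\<^sup>+z. ennreal (bump (0 :: real^'n) s z powr p) \<partial>lborel)"
      by (intro nn_integral_lborel_reflect_even[of "\<lambda>y :: real^'n. ennreal (bump 0 s y powr p)"]) (measurable, simp add: bump_reflect)
    also have "\<dots> = ennreal c" unfolding c_def using nn_integral_pint[OF Lb(1)] by (simp add: bump_bounds)
    finally show ?thesis .
  qed
  have dn: "(\<integral>\<^sup>+z. ennreal (norm (grad (bump 0 s) (x - z)) powr p) \<partial>lborel) = ennreal d" for x :: "real^'n"
  proof -
    have "(\<integral>\<^sup>+z. ennreal (norm (grad (bump 0 s) (x - z)) powr p) \<partial>lborel) = (\<integral>\<^sup>+z. ennreal (norm (grad (bump (0 :: real^'n) s) z) powr p) \<partial>lborel)"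
      by (intro nn_integral_lborel_reflect_even[of "\<lambda>y :: real^'n. ennreal (norm (grad (bump 0 s) y) powr p)"])
        (measurable, simp add: norm_grad_bump_reflect)
    also have "\<dots> = ennreal d" unfolding d_def by (rule nn_integral_pint[OF Lb(2)])
    finally show ?thesis .
  qed
  interpret pair: pair_sigma_finite "lborel :: (real^'n) measure" \<mu>
    by (intro pair_sigma_finite.intro sigma_finite_lborel sigma_finite_measure_axioms)
  show ?thesis
  proof
    \<comment> \<open>The cutoff scale s depends on \<epsilon>, and with it the ratio d/c in the
      lower-order constant.\<close>
    show "\<epsilon> * (d / c) \<ge> 0" using assms c by (simp add: d_def)
    fix f assume f: "test_fun \<Omega> f"
    let ?e = "\<lambda>x z. bump 0 s (x - z) powr p * norm (grad f x) powr p + \<bar>f x\<bar> powr p * norm (grad (bump 0 s) (x - z)) powr p"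
    note [measurable] = smooth_fun_measurable[OF test_fun_smooth[OF f]] smooth_fun_measurable[OF smooth_fun_bump]
    note Lf = test_fun_Lp(1,2)[OF f p_pos] test_fun_Lp_\<mu>[OF f p_pos]
    have "ennreal (c * pint \<mu> p f) = (\<integral>\<^sup>+x. ennreal (\<bar>f x\<bar> powr p) * ennreal c \<partial>\<mu>)"
      using nn_integral_pint[OF Lf(3)] c by (subst nn_integral_multc) (auto simp: ennreal_mult mult.commute)
    also have "\<dots> = (\<integral>\<^sup>+x. \<integral>\<^sup>+z. ennreal (\<bar>f x\<bar> powr p * bump 0 s (x - z) powr p) \<partial>lborel \<partial>\<mu>)"
      by (intro nn_integral_cong) (simp add: ennreal_mult nn_integral_cmult cn)
    also have "\<dots> = (\<integral>\<^sup>+z. \<integral>\<^sup>+x. ennreal (\<bar>f x\<bar> powr p * bump 0 s (x - z) powr p) \<partial>\<mu> \<partial>lborel)"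
      by (intro pair.Fubini') measurable
    also have "\<dots> \<le> (\<integral>\<^sup>+z. ennreal (2 * \<eta> powr (1 - p / q) * C powr p * 2 powr p) *
      (\<integral>\<^sup>+x. ennreal (?e x z) \<partial>lborel) \<partial>lborel)"
      by (intro nn_integral_mono localized_embedding[OF f s])
    also have "2 * \<eta> powr (1 - p / q) * C powr p * 2 powr p = \<epsilon>"
      using \<eta>(2) D C by (simp add: D_def field_simps)
    also have "(\<integral>\<^sup>+z. ennreal \<epsilon> *
      (\<integral>\<^sup>+x. ennreal (?e x z) \<partial>lborel) \<partial>lborel)
      = ennreal \<epsilon> * (\<integral>\<^sup>+z. (\<integral>\<^sup>+x. ennreal (?e x z) \<partial>lborel) \<partial>lborel)"
      by (rule nn_integral_cmult) measurable
    also have "(\<integral>\<^sup>+z. (\<integral>\<^sup>+x. ennreal (?e x z) \<partial>lborel) \<partial>lborel)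
      = (\<integral>\<^sup>+x. (\<integral>\<^sup>+z. ennreal (?e x z) \<partial>lborel) \<partial>lborel)"
      by (intro lborel_pair.Fubini') measurable
    also have "\<dots> = (\<integral>\<^sup>+x. ennreal c * ennreal (norm (grad f x) powr p) + ennreal d * ennreal (norm (f x) powr p) \<partial>lborel)"
    proof (rule nn_integral_cong)
      fix x
      have "(\<integral>\<^sup>+z. ennreal (?e x z) \<partial>lborel)
        = (\<integral>\<^sup>+z. ennreal (bump 0 s (x - z) powr p) * ennreal (norm (grad f x) powr p)
        + ennreal (norm (grad (bump 0 s) (x - z)) powr p) * ennreal (\<bar>f x\<bar> powr p) \<partial>lborel)"
        by (intro nn_integral_cong) (simp add: ennreal_mult mult.commute)
      also have "\<dots> = ennreal c * ennreal (norm (grad f x) powr p) + ennreal d * ennreal (norm (f x) powr p)"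
        by (subst nn_integral_add, measurable) (simp add: nn_integral_multc cn dn)
      finally show "(\<integral>\<^sup>+z. ennreal (?e x z) \<partial>lborel) = \<dots>" .
    qed
    also have "\<dots> = ennreal c * ennreal (E f) + ennreal d * ennreal (pint lborel p f)"
      using nn_integral_pint[OF Lf(1)] nn_integral_pint[OF Lf(2)]
      by (subst nn_integral_add, measurable) (simp add: nn_integral_cmult)
    also have "ennreal \<epsilon> * (ennreal c * ennreal (E f) + ennreal d * ennreal (pint lborel p f))
      = ennreal (\<epsilon> * (c * E f + d * pint lborel p f))"
      using assms c by (simp add: ennreal_mult ennreal_plus d_def)
    finally have "c * pint \<mu> p f \<le> \<epsilon> * (c * E f + d * pint lborel p f)"
      by (rule ennreal_le_iff[THEN iffD1, rotated]) (use assms c in \<open>simp add: d_def\<close>)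
    then show "pint \<mu> p f \<le> \<epsilon> * E f + \<epsilon> * (d / c) * pint lborel p f"
      using c by (simp add: field_simps)
  qed
qed

end

section \<open>Traces and the weak eigenvalue equation\<close>

text \<open>Estimates for test functions live on \<open>lborel\<close>, where Fubini and
  translations are at hand; limits live on the completed measure restricted to \<Omega>, as
  \<open>W0_trace\<close> requires. This lemma is the bridge.\<close>

lemma Lp_lebesgue_on:
  fixes f :: "real^'n::finite \<Rightarrow> 'b::euclidean_space"
  assumes "Lp lborel p f" "\<And>x. x \<notin> \<Omega> \<Longrightarrow> f x = 0" "open \<Omega>" "p > 0"
  shows "Lp (lebesgue_on \<Omega>) p f" "pint (lebesgue_on \<Omega>) p f = pint lborel p f"
proof -
  have m: "f \<in> borel_measurable lborel" using assms(1) by (rule Lp_measurable)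
  have mL: "f \<in> borel_measurable (lebesgue_on \<Omega>)"
    using m by (intro measurable_restrict_space1 measurable_completion)
  have s: "\<Omega> \<in> sets lebesgue" using assms(3) by auto
  have "(\<integral>\<^sup>+x. ennreal (norm (f x) powr p) \<partial>lebesgue_on \<Omega>) = (\<integral>\<^sup>+x. ennreal (norm (f x) powr p) * indicator \<Omega> x \<partial>lebesgue)"
    using s by (intro nn_integral_restrict_space) simp
  also have "\<dots> = (\<integral>\<^sup>+x. ennreal (norm (f x) powr p) \<partial>lebesgue)"
    using assms(2,4) by (intro nn_integral_cong) (auto simp: indicator_def)
  also have "\<dots> = (\<integral>\<^sup>+x. ennreal (norm (f x) powr p) \<partial>lborel)"
    using m by (intro nn_integral_completion)
  also have "\<dots> = ennreal (pint lborel p f)" by (rule nn_integral_pint[OF assms(1)])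
  finally have e: "(\<integral>\<^sup>+x. ennreal (norm (f x) powr p) \<partial>lebesgue_on \<Omega>) = ennreal (pint lborel p f)" .
  show L: "Lp (lebesgue_on \<Omega>) p f" using LpI_nn_integral(1)[OF mL, of p "pint lborel p f"] e by simp
  show "pint (lebesgue_on \<Omega>) p f = pint lborel p f" using nn_integral_pint[OF L] e by simp
qed

lemma test_fun_lebesgue_on:
  assumes "test_fun \<Omega> f" "open \<Omega>" "p > 0"
  shows "Lp (lebesgue_on \<Omega>) p f" "pint (lebesgue_on \<Omega>) p f = pint lborel p f"
    "Lp (lebesgue_on \<Omega>) p (grad f)" "pint (lebesgue_on \<Omega>) p (grad f) = pint lborel p (grad f)"
proof -
  have z: "f x = 0 \<and> grad f x = 0" if "x \<notin> \<Omega>" for x using test_fun_support[OF assms(1)] that by blast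
  show "Lp (lebesgue_on \<Omega>) p f" "pint (lebesgue_on \<Omega>) p f = pint lborel p f"
    using Lp_lebesgue_on[OF test_fun_Lp(1)[OF assms(1,3)] _ assms(2,3)] z by auto
  show "Lp (lebesgue_on \<Omega>) p (grad f)" "pint (lebesgue_on \<Omega>) p (grad f) = pint lborel p (grad f)"
    using Lp_lebesgue_on[OF test_fun_Lp(2)[OF assms(1,3)] _ assms(2,3)] z by auto
qed

lemma Lp_limit_nn_integral:
  assumes "p > 0" "\<And>k. Lp M p (f k)" "u \<in> borel_measurable M"
    and lim: "(\<lambda>k. \<integral>\<^sup>+x. ennreal (norm (f k x - u x) powr p) \<partial>M) \<longlonglongrightarrow> 0"
  shows "Lp M p u" "(\<lambda>k. pint M p (\<lambda>x. f k x - u x)) \<longlonglongrightarrow> 0"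
proof -
  note [measurable] = assms(3) Lp_measurable[OF assms(2)]
  have "\<forall>\<^sub>F k in sequentially. (\<integral>\<^sup>+x. ennreal (norm (f k x - u x) powr p) \<partial>M) < 1"
    using lim by (rule order_tendstoD(2)) simp
  then obtain k where "(\<integral>\<^sup>+x. ennreal (norm (f k x - u x) powr p) \<partial>M) < 1"
    by (auto simp: eventually_sequentially)
  then have "Lp M p (\<lambda>x. f k x - u x)"
    by (intro LpI_nn_integral(1)[of _ _ _ 1]) (auto intro: less_imp_le)
  from Lp_diff(1)[OF assms(1) assms(2)[of k] this] show L: "Lp M p u" by simp
  have "Lp M p (\<lambda>x. f k x - u x)" for k using assms L by (intro Lp_diff) auto
  then have "(\<lambda>k. ennreal (pint M p (\<lambda>x. f k x - u x))) \<longlonglongrightarrow> 0"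
    using lim by (simp add: nn_integral_pint)
  then show "(\<lambda>k. pint M p (\<lambda>x. f k x - u x)) \<longlonglongrightarrow> 0"
    by (subst (asm) ennreal_tendsto_0_iff) auto
qed

context mu_embedding
begin

abbreviation "L \<equiv> lebesgue_on \<Omega>"

lemmas test_fun_L = test_fun_lebesgue_on[OF _ open_\<Omega> p_pos]

lemma sets_\<Omega>: "\<Omega> \<in> sets lebesgue" using open_\<Omega> by auto

lemma set_nn_integral_L: "(\<integral>\<^sup>+x\<in>\<Omega>. f x \<partial>lebesgue) = (\<integral>\<^sup>+x. f x \<partial>L)"
  using sets_\<Omega> by (subst nn_integral_restrict_space) auto

text \<open>The trace is a limit in L^q(\<mu>), but the equation and the Rayleigh quotient use the
  exponent p; as \<mu> is finite and p < q, the same sequence converges in L^p(\<mu>).\<close>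

lemma W0_traceD:
  assumes "W0_trace \<Omega> p q \<mu> u G v"
  obtains \<phi> where "\<And>k. test_fun \<Omega> (\<phi> k)" "Lp L p u" "Lp L p G" "Lp \<mu> q v" "Lp \<mu> p v"
    "(\<lambda>k. pint L p (\<lambda>x. \<phi> k x - u x)) \<longlonglongrightarrow> 0"
    "(\<lambda>k. pint L p (\<lambda>x. grad (\<phi> k) x - G x)) \<longlonglongrightarrow> 0"
    "(\<lambda>k. pint \<mu> p (\<lambda>x. \<phi> k x - v x)) \<longlonglongrightarrow> 0"
proof -
  obtain \<phi> where \<phi>: "\<And>k. test_fun \<Omega> (\<phi> k)"
    "(\<lambda>k. \<integral>\<^sup>+x. ennreal (norm (\<phi> k x - u x) powr p) \<partial>L) \<longlonglongrightarrow> 0"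
    "(\<lambda>k. \<integral>\<^sup>+x. ennreal (norm (grad (\<phi> k) x - G x) powr p) \<partial>L) \<longlonglongrightarrow> 0"
    "(\<lambda>k. \<integral>\<^sup>+x. ennreal (norm (\<phi> k x - v x) powr q) \<partial>\<mu>) \<longlonglongrightarrow> 0"
    and m: "u \<in> borel_measurable lebesgue" "G \<in> borel_measurable lebesgue" "v \<in> borel_measurable \<mu>"
    using assms unfolding W0_trace_def set_nn_integral_L by auto
  have u: "Lp L p u" "(\<lambda>k. pint L p (\<lambda>x. \<phi> k x - u x)) \<longlonglongrightarrow> 0"
    using Lp_limit_nn_integral[OF p_pos test_fun_L(1)[OF \<phi>(1)] _ \<phi>(2)] m(1) by (auto intro: measurable_restrict_space1)
  have G: "Lp L p G" "(\<lambda>k. pint L p (\<lambda>x. grad (\<phi> k) x - G x)) \<longlonglongrightarrow> 0"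
    using Lp_limit_nn_integral[OF p_pos test_fun_L(3)[OF \<phi>(1)] _ \<phi>(3)] m(2) by (auto intro: measurable_restrict_space1)
  have v: "Lp \<mu> q v" "(\<lambda>k. pint \<mu> q (\<lambda>x. \<phi> k x - v x)) \<longlonglongrightarrow> 0"
    using Lp_limit_nn_integral[OF q_pos test_fun_Lp_\<mu>[OF \<phi>(1) q_pos] m(3) \<phi>(4)] by auto
  have "Lp \<mu> q (\<lambda>x. \<phi> k x - v x)" for k by (intro Lp_diff q_pos test_fun_Lp_\<mu> \<phi> v)
  from pint_tendsto_0_mono_exponent[OF p_pos q this v(2)]
  have "(\<lambda>k. pint \<mu> p (\<lambda>x. \<phi> k x - v x)) \<longlonglongrightarrow> 0" .
  with \<phi>(1) u G v Lp_mono_exponent(1)[OF p_pos q v(1)] show ?thesis by (intro that)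
qed

lemma W0_trace_inequality:
  assumes W: "W0_trace \<Omega> p q \<mu> u G v"
    and le: "\<And>f. test_fun \<Omega> f \<Longrightarrow> a * pint \<mu> p f \<le> b * E f + c * pint lborel p f"
  shows "a * pint \<mu> p v \<le> b * pint L p G + c * pint L p u"
proof -
  obtain \<phi> where \<phi>: "\<And>k. test_fun \<Omega> (\<phi> k)" "Lp L p u" "Lp L p G" "Lp \<mu> q v" "Lp \<mu> p v"
    "(\<lambda>k. pint L p (\<lambda>x. \<phi> k x - u x)) \<longlonglongrightarrow> 0"
    "(\<lambda>k. pint L p (\<lambda>x. grad (\<phi> k) x - G x)) \<longlonglongrightarrow> 0"
    "(\<lambda>k. pint \<mu> p (\<lambda>x. \<phi> k x - v x)) \<longlonglongrightarrow> 0"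
    by (rule W0_traceD[OF W]) (rule that)
  have "(\<lambda>k. pint lborel p (\<phi> k)) \<longlonglongrightarrow> pint L p u"
    using pint_tendsto[OF p(1) test_fun_L(1)[OF \<phi>(1)] \<phi>(2,6)] test_fun_L(2)[OF \<phi>(1)] by simp
  moreover have "(\<lambda>k. E (\<phi> k)) \<longlonglongrightarrow> pint L p G"
    using pint_tendsto[OF p(1) test_fun_L(3)[OF \<phi>(1)] \<phi>(3,7)] test_fun_L(4)[OF \<phi>(1)] by simp
  moreover have "(\<lambda>k. pint \<mu> p (\<phi> k)) \<longlonglongrightarrow> pint \<mu> p v"
    by (rule pint_tendsto[OF p(1) test_fun_Lp_\<mu>[OF \<phi>(1) p_pos] \<phi>(5,8)])
  ultimately show ?thesis
    using le[OF \<phi>(1)]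
    by (intro LIMSEQ_le[OF tendsto_mult_left tendsto_add[OF tendsto_mult_left tendsto_mult_left]]) auto
qed

lemma W0_trace_poincare:
  obtains K where "K \<ge> 0" "\<And>u G v. W0_trace \<Omega> p q \<mu> u G v \<Longrightarrow> pint L p u \<le> K * pint L p G"
proof -
  obtain K where K: "K \<ge> 0" "\<And>f. test_fun \<Omega> f \<Longrightarrow> pint lborel p f \<le> K * E f"
    using poincare_inequality[OF bounded_\<Omega> p(1)] by blast
  then show ?thesis
    using W0_trace_inequality[of _ _ _ 0 K "-1"] by (intro that[OF K(1)]) simp
qed

lemma W0_trace_ehrling:
  assumes "\<epsilon> > 0"
  obtains K where "K \<ge> 0" "\<And>u G v. W0_trace \<Omega> p q \<mu> u G v \<Longrightarrow> pint \<mu> p v \<le> \<epsilon> * pint L p G + K * pint L p u"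
proof -
  obtain K where K: "K \<ge> 0" "\<And>f. test_fun \<Omega> f \<Longrightarrow> pint \<mu> p f \<le> \<epsilon> * E f + K * pint lborel p f"
    using ehrling_inequality[OF assms] by blast
  then show ?thesis
    using W0_trace_inequality[of _ _ _ 1 \<epsilon> K] by (intro that[OF K(1)]) simp
qed

lemma W0_trace_rayleigh:
  assumes "\<And>f. test_fun \<Omega> f \<Longrightarrow> lam * pint \<mu> p f \<le> E f" "W0_trace \<Omega> p q \<mu> u G v"
  shows "lam * pint \<mu> p v \<le> pint L p G"
  using W0_trace_inequality[OF assms(2), of lam 1 0] assms(1) by simp

text \<open>Adding the same test function to the approximants leaves all three differences
  unchanged.\<close>

lemma W0_trace_add_test_fun:
  assumes W: "W0_trace \<Omega> p q \<mu> u G v" and \<psi>: "test_fun \<Omega> \<psi>"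
  shows "W0_trace \<Omega> p q \<mu> (\<lambda>x. u x + t * \<psi> x) (\<lambda>x. G x + t *\<^sub>R grad \<psi> x) (\<lambda>x. v x + t * \<psi> x)"
proof -
  obtain \<phi> where \<phi>: "\<And>k. test_fun \<Omega> (\<phi> k)"
    "(\<lambda>k. \<integral>\<^sup>+x\<in>\<Omega>. ennreal (\<bar>\<phi> k x - u x\<bar> powr p) \<partial>lebesgue) \<longlonglongrightarrow> 0"
    "(\<lambda>k. \<integral>\<^sup>+x\<in>\<Omega>. ennreal (norm (grad (\<phi> k) x - G x) powr p) \<partial>lebesgue) \<longlonglongrightarrow> 0"
    "(\<lambda>k. \<integral>\<^sup>+x. ennreal (\<bar>\<phi> k x - v x\<bar> powr q) \<partial>\<mu>) \<longlonglongrightarrow> 0"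
    and m: "u \<in> borel_measurable lebesgue" "G \<in> borel_measurable lebesgue" "v \<in> borel_measurable \<mu>"
    using W unfolding W0_trace_def by auto
  note mb = smooth_fun_measurable[OF test_fun_smooth[OF \<psi>]]
  have ml: "\<psi> \<in> borel_measurable lebesgue" "grad \<psi> \<in> borel_measurable lebesgue" "\<psi> \<in> borel_measurable \<mu>"
    using mb by (auto intro: measurable_completion)
  have g: "grad (\<lambda>x. \<phi> k x + t * \<psi> x) x = grad (\<phi> k) x + t *\<^sub>R grad \<psi> x" for k x
    using grad_add[OF test_fun_differentiable[OF \<phi>(1)] test_fun_differentiable[OF test_fun_scale[OF \<psi>]], where x=x]
      grad_scale[OF test_fun_differentiable[OF \<psi>], where x=x] by simp
  show ?thesis
    unfolding W0_trace_def
  proof (intro conjI exI[of _ "\<lambda>k x. \<phi> k x + t * \<psi> x"] allI)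
    show "test_fun \<Omega> (\<lambda>x. \<phi> k x + t * \<psi> x)" for k by (intro test_fun_add test_fun_scale \<phi> \<psi>)
  qed (use m ml \<phi>(2-4) in \<open>simp_all add: g\<close>)
qed

lemma p_form_real: "p_form p (a :: real) b = \<bar>a\<bar> powr (p - 2) * a * b"
  by (simp add: p_form_def)

lemma set_integral_p_form:
  "(LINT x:\<Omega>|lebesgue. norm (G x) powr (p - 2) * (G x \<bullet> H x)) = (\<integral>x. p_form p (G x) (H x) \<partial>L)"
  unfolding p_form_def set_lebesgue_integral_def using sets_\<Omega>
  by (subst integral_restrict_space) auto

lemma p_mu_eigenfunction_iff:
  "p_mu_eigenfunction \<Omega> p q \<mu> lam u \<longleftrightarrow>
     (\<exists>G v. W0_trace \<Omega> p q \<mu> u G v \<and> \<not> (AE x in lebesgue. x \<in> \<Omega> \<longrightarrow> u x = 0) \<and>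
        (\<forall>\<phi>. test_fun \<Omega> \<phi> \<longrightarrow> (\<integral>x. p_form p (G x) (grad \<phi> x) \<partial>L) = lam * (\<integral>x. p_form p (v x) (\<phi> x) \<partial>\<mu>)))"
  unfolding p_mu_eigenfunction_def set_integral_p_form p_form_real ..

lemma AE_L: "(AE x in L. P x) \<longleftrightarrow> (AE x in lebesgue. x \<in> \<Omega> \<longrightarrow> P x)"
  using sets_\<Omega> by (subst AE_restrict_space_iff) auto

text \<open>Testing the equation with approximations of \<open>u\<close> itself.\<close>
lemma p_mu_eigenvalue_energy:
  assumes "p_mu_eigenvalue \<Omega> p q \<mu> lam"
  obtains u G v where "W0_trace \<Omega> p q \<mu> u G v" "pint L p G = lam * pint \<mu> p v" "pint L p G > 0"
proof -
  obtain u G v where W: "W0_trace \<Omega> p q \<mu> u G v" and nz: "\<not> (AE x in lebesgue. x \<in> \<Omega> \<longrightarrow> u x = 0)"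
    and eq: "\<And>\<phi>. test_fun \<Omega> \<phi> \<Longrightarrow> (\<integral>x. p_form p (G x) (grad \<phi> x) \<partial>L) = lam * (\<integral>x. p_form p (v x) (\<phi> x) \<partial>\<mu>)"
    using assms unfolding p_mu_eigenvalue_def p_mu_eigenfunction_iff by blast
  obtain \<phi> where \<phi>: "\<And>k. test_fun \<Omega> (\<phi> k)" "Lp L p u" "Lp L p G" "Lp \<mu> q v" "Lp \<mu> p v"
    "(\<lambda>k. pint L p (\<lambda>x. \<phi> k x - u x)) \<longlonglongrightarrow> 0"
    "(\<lambda>k. pint L p (\<lambda>x. grad (\<phi> k) x - G x)) \<longlonglongrightarrow> 0"
    "(\<lambda>k. pint \<mu> p (\<lambda>x. \<phi> k x - v x)) \<longlonglongrightarrow> 0"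
    by (rule W0_traceD[OF W]) (rule that)
  have "(\<lambda>k. \<integral>x. p_form p (G x) (grad (\<phi> k) x) \<partial>L) \<longlonglongrightarrow> (\<integral>x. p_form p (G x) (G x) \<partial>L)"
    by (rule p_form_tendsto[OF p(1) \<phi>(3) test_fun_L(3)[OF \<phi>(1)] \<phi>(3,7)])
  moreover have "(\<lambda>k. \<integral>x. p_form p (v x) (\<phi> k x) \<partial>\<mu>) \<longlonglongrightarrow> (\<integral>x. p_form p (v x) (v x) \<partial>\<mu>)"
    by (rule p_form_tendsto[OF p(1) \<phi>(5) test_fun_Lp_\<mu>[OF \<phi>(1) p_pos] \<phi>(5,8)])
  then have "(\<lambda>k. lam * (\<integral>x. p_form p (v x) (\<phi> k x) \<partial>\<mu>)) \<longlonglongrightarrow> lam * (\<integral>x. p_form p (v x) (v x) \<partial>\<mu>)"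
    by (rule tendsto_mult_left)
  ultimately have "(\<integral>x. p_form p (G x) (G x) \<partial>L) = lam * (\<integral>x. p_form p (v x) (v x) \<partial>\<mu>)"
    unfolding eq[OF \<phi>(1)] by (rule LIMSEQ_unique)
  then have en: "pint L p G = lam * pint \<mu> p v" by (simp add: p_form_self pint_def)
  \<comment> \<open>Zero energy would force u = 0 by Poincare's inequality.\<close>
  have "pint L p G \<noteq> 0"
  proof
    assume 0: "pint L p G = 0"
    obtain K where "pint L p u \<le> K * pint L p G"
      using W0_trace_poincare W by metis
    then have "pint L p u = 0" using 0 pint_nonneg[of L p u] by simp
    then show False using nz pint_eq_0_iff[OF \<phi>(2)] AE_L[of "\<lambda>x. u x = 0"] by simp
  qed
  then have "pint L p G > 0" using pint_nonneg[of L p G] by linarith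
  with W en show ?thesis by (rule that)
qed

lemma p_mu_eigenvalue_pos:
  assumes "p_mu_eigenvalue \<Omega> p q \<mu> lam"
  shows "lam > 0"
proof -
  obtain u G v where "W0_trace \<Omega> p q \<mu> u G v" "pint L p G = lam * pint \<mu> p v" "pint L p G > 0"
    using p_mu_eigenvalue_energy[OF assms] by metis
  then show ?thesis using pint_nonneg[of \<mu> p v] by (metis zero_less_mult_pos2 zero_less_mult_iff not_le)
qed

lemma p_mu_eigenvalue_ge:
  assumes "\<And>f. test_fun \<Omega> f \<Longrightarrow> lam0 * pint \<mu> p f \<le> E f" "p_mu_eigenvalue \<Omega> p q \<mu> lam"
  shows "lam0 \<le> lam"
proof -
  obtain u G v where W: "W0_trace \<Omega> p q \<mu> u G v" "pint L p G = lam * pint \<mu> p v" "pint L p G > 0"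
    using p_mu_eigenvalue_energy[OF assms(2)] by metis
  have "lam0 * pint \<mu> p v \<le> lam * pint \<mu> p v"
    using W0_trace_rayleigh[OF assms(1) W(1)] W(2) by simp
  moreover have "pint \<mu> p v > 0"
    using W(2,3) p_mu_eigenvalue_pos[OF assms(2)] by (simp add: zero_less_mult_iff)
  ultimately show ?thesis by simp
qed

text \<open>The Rayleigh bound for the perturbed triple is squeezed between a tangent inequality at
  v, which bounds the \<mu>-integral from below, and one at the perturbed gradient, which bounds the
  energy from above. Dividing by p t and letting t \<rightarrow> 0 gives half of the
  equation.\<close>

lemma euler_lagrange_le:
  assumes W: "W0_trace \<Omega> p q \<mu> u G v" and ray: "\<And>f. test_fun \<Omega> f \<Longrightarrow> lam * pint \<mu> p f \<le> E f"
    and lam: "lam \<ge> 0" and eq: "pint L p G = lam * pint \<mu> p v" and \<psi>: "test_fun \<Omega> \<psi>"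
  shows "lam * (\<integral>x. p_form p (v x) (\<psi> x) \<partial>\<mu>) \<le> (\<integral>x. p_form p (G x) (grad \<psi> x) \<partial>L)"
proof -
  let ?A = "\<integral>x. p_form p (v x) (\<psi> x) \<partial>\<mu>"
  let ?B = "\<lambda>t. \<integral>x. p_form p (G x + t *\<^sub>R grad \<psi> x) (grad \<psi> x) \<partial>L"
  let ?G = "\<lambda>t x. G x + t *\<^sub>R grad \<psi> x"
  have LG: "Lp L p G" and Lv: "Lp \<mu> p v" using W0_traceD[OF W] by metis+
  have Lb: "Lp L p (grad \<psi>)" and L\<psi>: "Lp \<mu> p \<psi>"
    using test_fun_L(3)[OF \<psi>] test_fun_Lp_\<mu>[OF \<psi> p_pos] by auto
  have le: "lam * ?A \<le> ?B t"
    if t: "t > 0" for t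
  proof -
    have Lt: "Lp L p (?G t)" by (intro Lp_add p_pos LG Lp_scale Lb)
    have Lvt: "Lp \<mu> p (\<lambda>x. v x + t * \<psi> x)" by (intro Lp_add p_pos Lv Lp_mult L\<psi>)
    have i1: "integrable \<mu> (\<lambda>x. p_form p (v x) (\<psi> x))" by (rule Lp_p_form_integrable[OF p(1) Lv L\<psi>])
    have i2: "integrable L (\<lambda>x. p_form p (?G t x) (grad \<psi> x))"
      by (rule Lp_p_form_integrable[OF p(1) Lt Lb])
    have "pint \<mu> p v + p * t * ?A = (\<integral>x. norm (v x) powr p + p * t * p_form p (v x) (\<psi> x) \<partial>\<mu>)"
      using i1 Lp_integrable[OF Lv] by (simp add: pint_def)
    also have "\<dots> \<le> pint \<mu> p (\<lambda>x. v x + t * \<psi> x)"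
      unfolding pint_def
    proof (rule integral_mono)
      show "norm (v x) powr p + p * t * p_form p (v x) (\<psi> x) \<le> norm (v x + t * \<psi> x) powr p" for x
        using norm_powr_tangent[OF p(1), of "v x" "t * \<psi> x"] by (simp add: p_form_def algebra_simps)
    qed (use i1 Lp_integrable[OF Lv] Lp_integrable[OF Lvt] in auto)
    finally have "lam * (pint \<mu> p v + p * t * ?A) \<le> lam * pint \<mu> p (\<lambda>x. v x + t * \<psi> x)"
      using lam by (rule mult_left_mono)
    also have "\<dots> \<le> pint L p (?G t)"
      by (rule W0_trace_rayleigh[OF ray W0_trace_add_test_fun[OF W \<psi>]])
    also have "\<dots> \<le> pint L p G + p * t * ?B t"
    proof -
      have "pint L p (?G t)
        \<le> (\<integral>x. norm (G x) powr p + p * t * p_form p (?G t x) (grad \<psi> x) \<partial>L)"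
        unfolding pint_def
      proof (rule integral_mono)
        fix x
        \<comment> \<open>The tangent is based at the perturbed gradient and points back to G, so
          the form appears at \<open>?G t\<close> and needs the limit in t.\<close>
        show "norm (?G t x) powr p \<le> norm (G x) powr p + p * t * p_form p (?G t x) (grad \<psi> x)"
          using norm_powr_tangent[OF p(1), of "G x + t *\<^sub>R grad \<psi> x" "- (t *\<^sub>R grad \<psi> x)"]
          by (simp add: p_form_def algebra_simps)
      qed (use i2 Lp_integrable[OF LG] Lp_integrable[OF Lt] in auto)
      then show ?thesis using i2 Lp_integrable[OF LG] by (simp add: pint_def)
    qed
    \<comment> \<open>The terms without t cancel by \<open>eq\<close>, as the triple attains
      equality in the Rayleigh bound.\<close>
    finally have "(p * t) * (lam * ?A) \<le> (p * t) * ?B t"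
      using eq by (simp add: algebra_simps)
    then show ?thesis using t p_pos by (simp add: mult_le_cancel_left_pos)
  qed
  have "(\<lambda>k. \<integral>x. p_form p (G x + inverse (real (Suc k)) *\<^sub>R grad \<psi> x) (grad \<psi> x) \<partial>L) \<longlonglongrightarrow> (\<integral>x. p_form p (G x) (grad \<psi> x) \<partial>L)"
    by (rule Lp_p_form_perturb_tendsto[OF p(1) LG Lb LIMSEQ_inverse_real_of_nat]) (auto simp: field_simps)
  then show ?thesis
    by (rule LIMSEQ_le_const) (auto intro!: le exI[of _ 0])
qed

text \<open>The one-sided inequality for -\<psi> is the reverse inequality for \<psi>.\<close>

lemma euler_lagrange:
  assumes W: "W0_trace \<Omega> p q \<mu> u G v" and ray: "\<And>f. test_fun \<Omega> f \<Longrightarrow> lam * pint \<mu> p f \<le> E f"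
    and lam: "lam \<ge> 0" and eq: "pint L p G = lam * pint \<mu> p v" and \<psi>: "test_fun \<Omega> \<psi>"
  shows "(\<integral>x. p_form p (G x) (grad \<psi> x) \<partial>L) = lam * (\<integral>x. p_form p (v x) (\<psi> x) \<partial>\<mu>)"
proof (rule antisym)
  have "grad (\<lambda>x. (-1) * \<psi> x) x = - grad \<psi> x" for x
    using grad_scale[OF test_fun_differentiable[OF \<psi>], where c="-1" and x=x] by simp
  then show "(\<integral>x. p_form p (G x) (grad \<psi> x) \<partial>L) \<le> lam * (\<integral>x. p_form p (v x) (\<psi> x) \<partial>\<mu>)"
    using euler_lagrange_le[OF W ray lam eq test_fun_scale[OF \<psi>, of "-1"]]
    by (simp add: p_form_def)
qed (rule euler_lagrange_le[OF W ray lam eq \<psi>])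

end

section \<open>Existence of a minimizer\<close>

text \<open>A Cauchy condition for quantities that are not distances, such as p-th powers and the
  deficit of midpoints. Only upper bounds are asked for, since the deficit may be negative.\<close>

definition Cauchy_gauge :: "(nat \<Rightarrow> nat \<Rightarrow> real) \<Rightarrow> bool" where
  "Cauchy_gauge a \<longleftrightarrow> (\<forall>\<epsilon>>0. \<exists>N. \<forall>k\<ge>N. \<forall>l\<ge>N. a k l \<le> \<epsilon>)"

text \<open>The two-index counterpart of \<open>tendsto_eps_K\<close>; it links smallness in
  L^p(dx), in L^p(\<mu>), of the midpoint deficit and of the gradients.\<close>

lemma Cauchy_gauge_eps_K:
  assumes "Cauchy_gauge b" "c \<ge> 0"
    and *: "\<And>\<epsilon>. \<epsilon> > 0 \<Longrightarrow> \<exists>K\<ge>0. \<exists>N. \<forall>k\<ge>N. \<forall>l\<ge>N. a k l \<le> \<epsilon> * c + K * b k l"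
  shows "Cauchy_gauge a"
  unfolding Cauchy_gauge_def
proof (intro allI impI)
  fix e :: real assume e: "e > 0"
  define \<epsilon> where "\<epsilon> = e / (2 * (c + 1))"
  have "\<epsilon> > 0" using e assms by (simp add: \<epsilon>_def)
  from *[OF this] obtain K M where K: "K \<ge> 0" "\<forall>k\<ge>M. \<forall>l\<ge>M. a k l \<le> \<epsilon> * c + K * b k l"
    by (elim exE conjE)
  have \<epsilon>c: "\<epsilon> * c \<le> e / 2"
    using e assms by (simp add: \<epsilon>_def field_simps)
  have "e / 2 / (K + 1) > 0" using e K by simp
  then obtain N where N: "\<And>k l. k \<ge> N \<Longrightarrow> l \<ge> N \<Longrightarrow> b k l \<le> e / 2 / (K + 1)"
    using assms(1) unfolding Cauchy_gauge_def by metis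
  show "\<exists>N. \<forall>k\<ge>N. \<forall>l\<ge>N. a k l \<le> e"
  proof (intro exI[of _ "max M N"] allI impI)
    fix k l assume kl: "max M N \<le> k" "max M N \<le> l"
    have "K * b k l \<le> K * (e / 2 / (K + 1))" using N[of k l] kl K(1) by (intro mult_left_mono) auto
    also have "\<dots> \<le> e / 2" using K(1) e by (simp add: field_simps)
    finally show "a k l \<le> e" using K(2)[rule_format, of k l] kl \<epsilon>c by simp
  qed
qed

context mu_embedding
begin

text \<open>Needed for the Rayleigh quotient to have a nonempty domain. By Lindelof, countably many
  balls that carry a bump inside \<Omega> cover \<Omega>, so one of them has positive
  \<mu>-measure.\<close>

lemma exists_test_fun_pos:
  obtains f where "test_fun \<Omega> f" "pint \<mu> p f > 0"
proof -
  define \<F> where "\<F> = {ball a s | a s. s > 0 \<and> cball a (2 * s) \<subseteq> \<Omega>}"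
  have "open S" if "S \<in> \<F>" for S using that by (auto simp: \<F>_def)
  then obtain \<F>' where \<F>': "\<F>' \<subseteq> \<F>" "countable \<F>'" "\<Union>\<F>' = \<Union>\<F>"
    using Lindelof[of \<F>] by metis
  have "\<Omega> \<subseteq> \<Union>\<F>"
  proof
    fix a assume "a \<in> \<Omega>"
    then obtain e where "e > 0" "cball a e \<subseteq> \<Omega>" using open_\<Omega> open_contains_cball by blast
    then have "ball a (e / 2) \<in> \<F>" "a \<in> ball a (e / 2)" by (auto simp: \<F>_def intro!: exI[of _ a] exI[of _ "e/2"])
    then show "a \<in> \<Union>\<F>" by blast
  qed
  have "\<exists>B\<in>\<F>'. emeasure \<mu> B \<noteq> 0"
  proof (rule ccontr)
    assume "\<not> ?thesis"
    then have "\<And>B. B \<in> \<F>' \<Longrightarrow> B \<in> null_sets \<mu>" using \<F>'(1) by (auto simp: null_sets_def borel_\<mu> \<F>_def)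
    then have "(\<Union>B\<in>\<F>'. B) \<in> null_sets \<mu>" by (intro null_sets_UN' \<F>'(2))
    then have "emeasure \<mu> (\<Union>\<F>') = 0" by auto
    moreover have "emeasure \<mu> \<Omega> \<le> emeasure \<mu> (\<Union>\<F>')"
      unfolding \<F>'(3)
    proof (intro emeasure_mono)
      show "\<Union>\<F> \<in> sets \<mu>" unfolding borel_\<mu> by (intro borel_open open_Union) (auto simp: \<F>_def)
    qed fact
    ultimately show False using pos_\<mu> by simp
  qed
  then obtain a s where as: "s > 0" "cball a (2 * s) \<subseteq> \<Omega>" "emeasure \<mu> (ball a s) \<noteq> 0"
    using \<F>'(1) by (auto simp: \<F>_def)
  have t: "test_fun \<Omega> (bump a s)" by (rule test_fun_bump[OF as(1,2)])
  have "0 < measure \<mu> (ball a s)" using as(3) by (simp add: emeasure_eq_measure zero_less_measure_iff)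
  also have "\<dots> = (\<integral>x. indicat_real (ball a s) x \<partial>\<mu>)" by (simp add: space_\<mu>)
  also have "\<dots> \<le> pint \<mu> p (bump a s)"
    unfolding pint_def
  proof (rule integral_mono)
    show "integrable \<mu> (indicat_real (ball a s))" by (simp add: borel_\<mu> less_top[symmetric])
    show "integrable \<mu> (\<lambda>x. norm (bump a s x) powr p)" by (rule Lp_integrable[OF test_fun_Lp_\<mu>[OF t p_pos]])
    show "indicat_real (ball a s) x \<le> norm (bump a s x) powr p" for x
      using bump_eq_1[OF as(1), of x a] by (auto simp: indicator_def dist_norm norm_minus_commute)
  qed
  finally show ?thesis using t by (intro that)
qed

lemma test_fun_diff_grad:
  assumes "test_fun \<Omega> f" "test_fun \<Omega> g"
  shows "grad (\<lambda>x. f x - g x) = (\<lambda>x. grad f x - grad g x)"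
  using assms by (intro ext grad_diff test_fun_differentiable)

lemma minimizing_sequence_converges:
  assumes f: "\<And>k. test_fun \<Omega> (f k)" and ray: "\<And>f. test_fun \<Omega> f \<Longrightarrow> lam * pint \<mu> p f \<le> E f" and lam: "lam \<ge> 0"
    and norm1: "\<And>k. pint \<mu> p (f k) = 1" and Elim: "\<And>k. E (f k) \<le> lam + 1 / (real k + 1)"
    and N: "Cauchy_gauge (\<lambda>k l. pint lborel p (\<lambda>x. f k x - f l x))"
  shows "Cauchy_gauge (\<lambda>k l. E (\<lambda>x. f k x - f l x))"
    and "Cauchy_gauge (\<lambda>k l. pint \<mu> q (\<lambda>x. f k x - f l x))"
proof -
  let ?b = "\<lambda>k l. pint \<mu> p (\<lambda>x. (1/2) * (f k x + f l x))"
  let ?d = "\<lambda>k l x. f k x - f l x"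
  note td = test_fun_diff[OF f f]
  have Ebd: "E (f k) \<le> lam + 1" for k
    using Elim[of k] by (rule order_trans) (simp add: divide_le_eq)
  have Edbd: "E (?d k l) \<le> 2 powr p * (2 * (lam + 1))" for k l
  proof -
    have "E (?d k l) \<le> 2 powr p * (E (f k) + E (f l))"
      unfolding test_fun_diff_grad[OF f f] by (intro Lp_diff p_pos test_fun_Lp[OF f])
    also have "\<dots> \<le> 2 powr p * (2 * (lam + 1))" using Ebd[of k] Ebd[of l] by (intro mult_left_mono) auto
    finally show ?thesis .
  qed
  have B: "Cauchy_gauge (\<lambda>k l. pint \<mu> p (?d k l))"
  proof (rule Cauchy_gauge_eps_K[OF N])
    show "2 powr p * (2 * (lam + 1)) \<ge> 0" using lam by simp
    fix \<epsilon> :: real assume \<epsilon>: "\<epsilon> > 0"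
    obtain K where K: "K \<ge> 0" "\<And>f. test_fun \<Omega> f \<Longrightarrow> pint \<mu> p f \<le> \<epsilon> * E f + K * pint lborel p f"
      using ehrling_inequality[OF \<epsilon>] by blast
    have "pint \<mu> p (?d k l) \<le> \<epsilon> * (2 powr p * (2 * (lam + 1))) + K * pint lborel p (?d k l)" for k l
      using K(2)[OF td, of k l] mult_left_mono[OF Edbd[of k l] less_imp_le[OF \<epsilon>]] by linarith
    with K(1) show "\<exists>K\<ge>0. \<exists>N. \<forall>k\<ge>N. \<forall>l\<ge>N. pint \<mu> p (?d k l)
        \<le> \<epsilon> * (2 powr p * (2 * (lam + 1))) + K * pint lborel p (?d k l)" by blast
  qed
  have mid: "test_fun \<Omega> (\<lambda>x. (1/2) * (f k x + f l x))" for k l by (intro test_fun_scale test_fun_add f)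
  have gmid: "grad (\<lambda>x. (1/2) * (f k x + f l x)) x = (1/2) *\<^sub>R (grad (f k) x + grad (f l) x)" for k l x
    using grad_scale[OF test_fun_differentiable[OF test_fun_add[OF f f]], where c="1/2"]
      grad_add[OF test_fun_differentiable[OF f] test_fun_differentiable[OF f]] by simp
  text \<open>The midpoints are asymptotically normalized, so their energy is at least \<open>lam\<close> in the limit and
    uniform convexity applies.\<close>
  have def: "Cauchy_gauge (\<lambda>k l. lam * (1 - ?b k l))"
  proof (rule Cauchy_gauge_eps_K[OF B lam])
    fix \<epsilon> :: real assume \<epsilon>: "\<epsilon> > 0"
    obtain K where K: "K \<ge> 0" "\<And>g h :: real^'n \<Rightarrow> real. Lp \<mu> p g \<Longrightarrow> Lp \<mu> p h \<Longrightarrow>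
        \<bar>pint \<mu> p g - pint \<mu> p h\<bar> \<le> \<epsilon> * pint \<mu> p h + K * pint \<mu> p (\<lambda>x. g x - h x)"
      using pint_perturb[OF p(1) \<epsilon>] by metis
    have "lam * (1 - ?b k l) \<le> \<epsilon> * lam + lam * K * pint \<mu> p (?d k l)" for k l
    proof -
      have "\<bar>?b k l - 1\<bar>
          \<le> \<epsilon> * 1 + K * pint \<mu> p (\<lambda>x. (1/2) * (f k x + f l x) - f k x)"
        using K(2)[OF test_fun_Lp_\<mu>[OF mid p_pos, of k l] test_fun_Lp_\<mu>[OF f p_pos, of k]] by (simp add: norm1)
      \<comment> \<open>The midpoint differs from \<open>f k\<close> by half a difference of two
        members of the sequence, so its \<mu>-integral stays near 1.\<close>
      also have "pint \<mu> p (\<lambda>x. (1/2) * (f k x + f l x) - f k x) = pint \<mu> p (\<lambda>x. (- 1 / 2) * (f k x - f l x))"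
        by (simp add: algebra_simps)
      also have "\<dots> = \<bar>- 1 / 2\<bar> powr p * pint \<mu> p (?d k l)"
        by (rule Lp_mult(2)[OF test_fun_Lp_\<mu>[OF td p_pos]])
      also have "\<epsilon> * 1 + K * \<dots> \<le> \<epsilon> * 1 + K * (1 * pint \<mu> p (?d k l))"
        using K(1) p_pos by (intro add_left_mono mult_left_mono mult_right_mono powr_le1) auto
      finally have "1 - ?b k l \<le> \<epsilon> + K * pint \<mu> p (?d k l)"
        by simp
      from mult_left_mono[OF this lam] show ?thesis by (simp add: algebra_simps)
    qed
    moreover have "lam * K \<ge> 0" using lam K by simp
    ultimately show "\<exists>K\<ge>0. \<exists>N. \<forall>k\<ge>N. \<forall>l\<ge>N. lam * (1 - ?b k l)
        \<le> \<epsilon> * lam + K * pint \<mu> p (?d k l)" by blast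
  qed
  show EC: "Cauchy_gauge (\<lambda>k l. E (?d k l))"
  proof (rule Cauchy_gauge_eps_K[OF def])
    show "2 * (lam + 1) + 1 \<ge> 0" using lam by simp
    fix \<epsilon> :: real assume \<epsilon>: "\<epsilon> > 0"
    obtain K where K: "K \<ge> 0" "\<And>g h :: real^'n \<Rightarrow> real^'n. Lp lborel p g \<Longrightarrow> Lp lborel p h \<Longrightarrow>
      pint lborel p (\<lambda>x. g x - h x) \<le> \<epsilon> * (pint lborel p g + pint lborel p h)
      + K * ((pint lborel p g + pint lborel p h) / 2 - pint lborel p (\<lambda>x. (1/2) *\<^sub>R (g x + h x)))"
    proof (rule pint_uniformly_convex[OF p(1) \<epsilon>, where 'a="real^'n" and 'b="real^'n"])
      fix K :: real
      assume 1: "K \<ge> 0" and 2: "\<And>M. \<And>g h :: real^'n \<Rightarrow> real^'n. Lp M p g \<Longrightarrow> Lp M p h \<Longrightarrow>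
        pint M p (\<lambda>x. g x - h x) \<le> \<epsilon> * (pint M p g + pint M p h)
        + K * ((pint M p g + pint M p h) / 2 - pint M p (\<lambda>x. (1/2) *\<^sub>R (g x + h x)))"
      show thesis by (rule that[OF 1 2])
    qed
    \<comment> \<open>K is already fixed by \<epsilon>; from this index on, K times the excess 1/(k
      + 1) of the energy over lam is at most \<epsilon>.\<close>
    obtain N :: nat where N: "K / \<epsilon> \<le> real N" using real_arch_simple by blast
    have "E (?d k l) \<le> \<epsilon> * (2 * (lam + 1) + 1) + K * (lam * (1 - ?b k l))"
      if kl: "k \<ge> N" "l \<ge> N" for k l
    proof -
      have small: "K * (1 / (real j + 1)) \<le> \<epsilon>" if "j \<ge> N" for j
      proof -
        have "K \<le> \<epsilon> * real N" using N \<epsilon> by (simp add: field_simps)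
        also have "\<dots> \<le> \<epsilon> * (real j + 1)" using that \<epsilon> by (intro mult_left_mono) auto
        finally show ?thesis by (simp add: divide_le_eq)
      qed
      have "E (?d k l) \<le> \<epsilon> * (E (f k) + E (f l)) + K * ((E (f k) + E (f l)) / 2 - E (\<lambda>x. (1/2) * (f k x + f l x)))"
        using K(2)[OF test_fun_Lp(2)[OF f p_pos] test_fun_Lp(2)[OF f p_pos], of k l]
        by (simp only: test_fun_diff_grad[OF f f] gmid[abs_def])
      also have "\<dots> \<le> \<epsilon> * (2 * (lam + 1)) + K * ((E (f k) + E (f l)) / 2 - lam * ?b k l)"
        using ray[OF mid, of k l] Ebd[of k] Ebd[of l] K(1) \<epsilon> by (intro add_mono mult_left_mono) auto
      also have "K * ((E (f k) + E (f l)) / 2 - lam * ?b k l)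
          \<le> K * ((1 / (real k + 1) + 1 / (real l + 1)) / 2 + lam * (1 - ?b k l))"
      proof (intro mult_left_mono K(1))
        have "(E (f k) + E (f l)) / 2 \<le> ((lam + 1 / (real k + 1)) + (lam + 1 / (real l + 1))) / 2"
          by (intro divide_right_mono add_mono Elim) simp
        also have "\<dots> = (1 / (real k + 1) + 1 / (real l + 1)) / 2 + lam"
          by (simp add: add_divide_distrib)
        finally show "(E (f k) + E (f l)) / 2 - lam * ?b k l
          \<le> (1 / (real k + 1) + 1 / (real l + 1)) / 2 + lam * (1 - ?b k l)"
          by (simp add: right_diff_distrib)
      qed
      also have "\<dots> \<le> \<epsilon> + K * (lam * (1 - ?b k l))"
      proof -
        have avg: "K * ((a + b) / 2 + y) \<le> \<epsilon> + K * y" if "K * a \<le> \<epsilon>" "K * b \<le> \<epsilon>" for a b y :: real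
        proof -
          have "K * ((a + b) / 2 + y) = (K * a + K * b) / 2 + K * y" by (simp add: field_simps)
          also have "\<dots> \<le> (\<epsilon> + \<epsilon>) / 2 + K * y"
            by (intro add_right_mono divide_right_mono add_mono that) simp
          finally show ?thesis by simp
        qed
        show ?thesis by (rule avg[OF small[OF kl(1)] small[OF kl(2)]])
      qed
      finally show ?thesis by (simp add: algebra_simps)
    qed
    with K(1) show "\<exists>K\<ge>0. \<exists>N. \<forall>k\<ge>N. \<forall>l\<ge>N. E (?d k l)
        \<le> \<epsilon> * (2 * (lam + 1) + 1) + K * (lam * (1 - ?b k l))" by blast
  qed
  \<comment> \<open>Not a compactness statement: the embedding is applied to the differences, and
    the exponents p/q and q/p cancel.\<close>
  show "Cauchy_gauge (\<lambda>k l. pint \<mu> q (?d k l))"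
    unfolding Cauchy_gauge_def
  proof (intro allI impI)
    fix \<epsilon> :: real assume \<epsilon>: "\<epsilon> > 0"
    have pos: "(\<epsilon> / C powr q) powr (p / q) > 0" using \<epsilon> C by simp
    then obtain N where N: "\<And>k l. k \<ge> N \<Longrightarrow> l \<ge> N \<Longrightarrow> E (?d k l) \<le> (\<epsilon> / C powr q) powr (p / q)"
      using EC unfolding Cauchy_gauge_def by metis
    have "pint \<mu> q (?d k l) \<le> \<epsilon>" if kl: "k \<ge> N" "l \<ge> N" for k l
    proof -
      have "pint \<mu> q (?d k l) \<le> C powr q * E (?d k l) powr (q / p)"
        using embed_powr[OF td q_pos, of k l] q_pos by simp
      also have "\<dots> \<le> C powr q * ((\<epsilon> / C powr q) powr (p / q)) powr (q / p)"
        using N[OF kl] p_pos q_pos by (intro mult_left_mono powr_mono2) auto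
      also have "\<dots> = \<epsilon>" using \<epsilon> C p_pos q_pos by (simp add: powr_powr)
      finally show ?thesis .
    qed
    then show "\<exists>N. \<forall>k\<ge>N. \<forall>l\<ge>N. pint \<mu> q (?d k l) \<le> \<epsilon>" by blast
  qed
qed

text \<open>Completeness is used three times, once per limit, for one and the same sequence; this is
  how u, G and v become parts of one triple.\<close>

lemma W0_traceI:
  assumes f: "\<And>k. test_fun \<Omega> (f k)"
    and N: "Cauchy_gauge (\<lambda>k l. pint lborel p (\<lambda>x. f k x - f l x))"
    and EC: "Cauchy_gauge (\<lambda>k l. E (\<lambda>x. f k x - f l x))"
    and Q: "Cauchy_gauge (\<lambda>k l. pint \<mu> q (\<lambda>x. f k x - f l x))"
  obtains u G v where "W0_trace \<Omega> p q \<mu> u G v"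
    "(\<lambda>k. E (f k)) \<longlonglongrightarrow> pint L p G" "(\<lambda>k. pint \<mu> p (f k)) \<longlonglongrightarrow> pint \<mu> p v"
proof -
  note td = test_fun_diff[OF f f]
  obtain u where u: "Lp L p u" "(\<lambda>k. pint L p (\<lambda>x. f k x - u x)) \<longlonglongrightarrow> 0"
  proof (rule Lp_complete[OF p_pos test_fun_L(1)[OF f]])
    show "\<exists>N. \<forall>k\<ge>N. \<forall>l\<ge>N. pint L p (\<lambda>x. f k x - f l x) \<le> \<epsilon>" if "\<epsilon> > 0" for \<epsilon>
      using N that by (simp add: Cauchy_gauge_def test_fun_L(2)[OF td])
  qed
  obtain G where G: "Lp L p G" "(\<lambda>k. pint L p (\<lambda>x. grad (f k) x - G x)) \<longlonglongrightarrow> 0"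
  proof (rule Lp_complete[OF p_pos test_fun_L(3)[OF f]])
    show "\<exists>N. \<forall>k\<ge>N. \<forall>l\<ge>N. pint L p (\<lambda>x. grad (f k) x - grad (f l) x) \<le> \<epsilon>" if "\<epsilon> > 0" for \<epsilon>
      using EC that test_fun_L(4)[OF td] by (simp add: Cauchy_gauge_def test_fun_diff_grad[OF f f])
  qed
  obtain v where v: "Lp \<mu> q v" "(\<lambda>k. pint \<mu> q (\<lambda>x. f k x - v x)) \<longlonglongrightarrow> 0"
  proof (rule Lp_complete[OF q_pos test_fun_Lp_\<mu>[OF f q_pos]])
    show "\<exists>N. \<forall>k\<ge>N. \<forall>l\<ge>N. pint \<mu> q (\<lambda>x. f k x - f l x) \<le> \<epsilon>" if "\<epsilon> > 0" for \<epsilon>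
      using Q that by (simp add: Cauchy_gauge_def)
  qed
  \<comment> \<open>Limits on the restricted space are extended by zero to be Lebesgue measurable on
    the whole space.\<close>
  define u' where "u' x = indicator \<Omega> x *\<^sub>R u x" for x
  define G' where "G' x = indicator \<Omega> x *\<^sub>R G x" for x
  have m: "u' \<in> borel_measurable lebesgue" "G' \<in> borel_measurable lebesgue"
    using Lp_measurable[OF u(1)] Lp_measurable[OF G(1)] sets_\<Omega>
    unfolding u'_def G'_def by (auto simp: borel_measurable_restrict_space_iff)
  have spL: "x \<in> space L \<Longrightarrow> u' x = u x" "x \<in> space L \<Longrightarrow> G' x = G x" for x
    by (auto simp: u'_def G'_def space_restrict_space)
  have Ld: "Lp L p (\<lambda>x. f k x - u x)" "Lp L p (\<lambda>x. grad (f k) x - G x)" "Lp \<mu> q (\<lambda>x. f k x - v x)" for k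
    by (intro Lp_diff p_pos q_pos test_fun_L(1,3)[OF f] u G v test_fun_Lp_\<mu>[OF f q_pos])+
  have n: "(\<integral>\<^sup>+x. ennreal (\<bar>f k x - u' x\<bar> powr p) \<partial>L) = ennreal (pint L p (\<lambda>x. f k x - u x))"
    "(\<integral>\<^sup>+x. ennreal (norm (grad (f k) x - G' x) powr p) \<partial>L) = ennreal (pint L p (\<lambda>x. grad (f k) x - G x))"
    "(\<integral>\<^sup>+x. ennreal (\<bar>f k x - v x\<bar> powr q) \<partial>\<mu>) = ennreal (pint \<mu> q (\<lambda>x. f k x - v x))" for k
    unfolding nn_integral_pint[OF Ld(1), symmetric] nn_integral_pint[OF Ld(2), symmetric]
      nn_integral_pint[OF Ld(3), symmetric]
    by (intro nn_integral_cong; simp add: spL)+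
  have W: "W0_trace \<Omega> p q \<mu> u' G' v"
    unfolding W0_trace_def set_nn_integral_L
  proof (intro conjI exI[of _ f] allI)
    show "v \<in> borel_measurable \<mu>" by (rule Lp_measurable[OF v(1)])
  qed (use m f u(2) G(2) v(2) in \<open>simp_all add: n ennreal_tendsto_0_iff\<close>)
  have "pint L p G' = pint L p G"
    unfolding pint_def by (intro Bochner_Integration.integral_cong) (auto simp: spL)
  moreover have "(\<lambda>k. pint L p (grad (f k))) \<longlonglongrightarrow> pint L p G"
    by (rule pint_tendsto[OF p(1) test_fun_L(3)[OF f] G])
  ultimately have "(\<lambda>k. E (f k)) \<longlonglongrightarrow> pint L p G'" by (simp add: test_fun_L(4)[OF f])
  moreover have "(\<lambda>k. pint \<mu> p (f k)) \<longlonglongrightarrow> pint \<mu> p v"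
    by (rule pint_tendsto[OF p(1) test_fun_Lp_\<mu>[OF f p_pos] Lp_mono_exponent(1)[OF p_pos q v(1)]
          pint_tendsto_0_mono_exponent[OF p_pos q Ld(3) v(2)]])
  ultimately show ?thesis using W by (intro that)
qed

lemma minimizer_exists:
  obtains lam u G v where "lam \<ge> 0" "\<And>f. test_fun \<Omega> f \<Longrightarrow> lam * pint \<mu> p f \<le> E f"
    "W0_trace \<Omega> p q \<mu> u G v" "pint \<mu> p v = 1" "pint L p G = lam"
proof -
  \<comment> \<open>The infimum runs over test functions only; \<open>W0_trace_rayleigh\<close>
    extends the bound to all triples.\<close>
  define S where "S = {E f / pint \<mu> p f | f. test_fun \<Omega> f \<and> pint \<mu> p f > 0}"
  define lam where "lam = Inf S"
  have ne: "S \<noteq> {}" using exists_test_fun_pos by (auto simp: S_def)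
  have bdd: "bdd_below S" by (rule bdd_belowI[of _ 0]) (auto simp: S_def)
  have lam: "lam \<ge> 0" unfolding lam_def using ne by (intro cInf_greatest) (auto simp: S_def)
  have ray: "lam * pint \<mu> p f \<le> E f" if f: "test_fun \<Omega> f" for f
  proof (cases "pint \<mu> p f > 0")
    case True
    then have "lam \<le> E f / pint \<mu> p f"
      unfolding lam_def using f by (intro cInf_lower bdd) (auto simp: S_def)
    then show ?thesis using True by (simp add: field_simps)
  next
    case False
    then have "pint \<mu> p f = 0" using pint_nonneg[of \<mu> p f] by linarith
    then show ?thesis by simp
  qed
  have "\<exists>f. test_fun \<Omega> f \<and> pint \<mu> p f = 1 \<and> E f \<le> lam + 1 / (real k + 1)" for k :: nat
  proof -
    have "Inf S < lam + 1 / (real k + 1)" by (simp add: lam_def)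
    then obtain g where g: "test_fun \<Omega> g" "pint \<mu> p g > 0" "E g / pint \<mu> p g < lam + 1 / (real k + 1)"
      using cInf_lessD[OF ne] by (auto simp: S_def)
    \<comment> \<open>Numerator and denominator are both homogeneous of degree p, so rescaling to
      \<mu>-integral 1 turns the quotient into the energy.\<close>
    define c where "c = (1 / pint \<mu> p g) powr (1 / p)"
    have cp: "\<bar>c\<bar> powr p = 1 / pint \<mu> p g" using g(2) p_pos by (simp add: c_def powr_powr)
    have "pint \<mu> p (\<lambda>x. c * g x) = 1"
      using Lp_mult(2)[OF test_fun_Lp_\<mu>[OF g(1) p_pos], of c] cp g(2) by simp
    moreover have "E (\<lambda>x. c * g x) = E g / pint \<mu> p g"
    proof -
      have "grad (\<lambda>x. c * g x) = (\<lambda>x. c *\<^sub>R grad g x)"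
        by (intro ext grad_scale test_fun_differentiable[OF g(1)])
      then show ?thesis using Lp_scale(2)[OF test_fun_Lp(2)[OF g(1) p_pos], of c] cp by simp
    qed
    ultimately show ?thesis using g test_fun_scale[OF g(1), of c] by (intro exI[of _ "\<lambda>x. c * g x"]) auto
  qed
  then obtain f where f: "\<And>k. test_fun \<Omega> (f k)" "\<And>k. pint \<mu> p (f k) = 1" "\<And>k::nat. E (f k) \<le> lam + 1 / (real k + 1)"
    by metis
  have E1: "E (f k) \<le> lam + 1" for k
    using f(3)[of k] by (rule order_trans) (simp add: divide_le_eq)
  obtain r :: "nat \<Rightarrow> nat" where r: "strict_mono r"
    "\<And>\<epsilon>. \<epsilon> > 0 \<Longrightarrow> \<exists>N. \<forall>k\<ge>N. \<forall>l\<ge>N. pint lborel p (\<lambda>x. f (r k) x - f (r l) x) \<le> \<epsilon>"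
    by (rule rellich[OF p(1) bounded_\<Omega> open_\<Omega> f(1) E1]) (rule that)
  \<comment> \<open>The subsequence keeps the rate because r k \<ge> k.\<close>
  have E': "E (f (r k)) \<le> lam + 1 / (real k + 1)" for k
  proof -
    have "1 / (real (r k) + 1) \<le> 1 / (real k + 1)"
      using seq_suble[OF r(1), of k] by (intro divide_left_mono) auto
    then show ?thesis using f(3)[of "r k"] by linarith
  qed
  have N: "Cauchy_gauge (\<lambda>k l. pint lborel p (\<lambda>x. f (r k) x - f (r l) x))"
    unfolding Cauchy_gauge_def using r(2) by blast
  note C' = minimizing_sequence_converges[of "\<lambda>k. f (r k)", OF f(1) ray lam f(2) E' N]
  obtain u G v where W: "W0_trace \<Omega> p q \<mu> u G v"
    "(\<lambda>k. E (f (r k))) \<longlonglongrightarrow> pint L p G" "(\<lambda>k. pint \<mu> p (f (r k))) \<longlonglongrightarrow> pint \<mu> p v"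
    using W0_traceI[of "\<lambda>k. f (r k)", OF f(1) N C'] by metis
  have v: "pint \<mu> p v = 1" using W(3) f(2) by (simp add: LIMSEQ_const_iff)
  have "pint L p G \<le> lam + 0"
  proof (rule LIMSEQ_le[OF W(2)])
    show "(\<lambda>k. lam + 1 / (real k + 1)) \<longlonglongrightarrow> lam + 0"
      using LIMSEQ_inverse_real_of_nat by (intro tendsto_intros) (simp add: inverse_eq_divide add.commute)
  qed (use E' in auto)
  moreover have "lam \<le> pint L p G" using W0_trace_rayleigh[OF ray W(1)] v by simp
  ultimately have "pint L p G = lam" by simp
  with lam ray W(1) v show ?thesis by (intro that)
qed

text \<open>It remains to see that u is nonzero for Lebesgue measure, although the normalization
  concerns v: if u vanished, the \<epsilon>-inequality would bound the \<mu>-integral of v by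
  \<epsilon> lam, which contradicts its value 1 for small \<epsilon>.\<close>

lemma smallest_eigenvalue_exists:
  "\<exists>lam u. lam > 0 \<and> p_mu_eigenfunction \<Omega> p q \<mu> lam u \<and> (\<forall>lam'. p_mu_eigenvalue \<Omega> p q \<mu> lam' \<longrightarrow> lam \<le> lam')"
proof -
  obtain lam u G v where lam: "lam \<ge> 0" and ray: "\<And>f. test_fun \<Omega> f \<Longrightarrow> lam * pint \<mu> p f \<le> E f"
    and W: "W0_trace \<Omega> p q \<mu> u G v" and v: "pint \<mu> p v = 1" and G: "pint L p G = lam"
    using minimizer_exists by metis
  have "\<not> (AE x in lebesgue. x \<in> \<Omega> \<longrightarrow> u x = 0)"
  proof
    assume "AE x in lebesgue. x \<in> \<Omega> \<longrightarrow> u x = 0"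
    then have "AE x in L. u x = 0" by (simp add: AE_L)
    moreover have "Lp L p u" using W0_traceD[OF W] by metis
    ultimately have u0: "pint L p u = 0" by (simp add: pint_eq_0_iff)
    \<comment> \<open>This \<epsilon> makes the bound \<epsilon> lam less than 1/2.\<close>
    have "1 / (2 * (lam + 1)) > 0" using lam by simp
    then obtain K where "pint \<mu> p v \<le> 1 / (2 * (lam + 1)) * pint L p G + K * pint L p u"
      using W0_trace_ehrling W by metis
    then have "1 \<le> lam / (2 * (lam + 1))" by (simp add: u0 v G)
    then show False using lam by (simp add: field_simps)
  qed
  then have ef: "p_mu_eigenfunction \<Omega> p q \<mu> lam u"
    unfolding p_mu_eigenfunction_iff using W euler_lagrange[OF W ray lam] v G by auto
  then have "lam > 0" by (intro p_mu_eigenvalue_pos) (auto simp: p_mu_eigenvalue_def)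
  with ef show ?thesis using p_mu_eigenvalue_ge[OF ray] by blast
qed

end

theorem theorem4p1:
  fixes \<Omega> :: "(real^'n) set" and p q C :: real and \<mu> :: "(real^'n) measure"
  assumes n2: "CARD('n) \<ge> 2"
    and open_\<Omega>: "open \<Omega>" and bounded_\<Omega>: "bounded \<Omega>"
    and p: "1 < p" "p \<le> real CARD('n)"
    and q: "p < q" "p < real CARD('n) \<Longrightarrow> q \<le> real CARD('n) * p / (real CARD('n) - p)"
    and borel_\<mu>: "sets \<mu> = sets borel"
    and finite_\<mu>: "finite_measure \<mu>"
    and pos_\<mu>: "emeasure \<mu> \<Omega> > 0"
    and supp_\<mu>: "emeasure \<mu> (UNIV - \<Omega>) = 0"
    and C: "C > 0"
    and embed: "\<And>\<phi>. test_fun \<Omega> \<phi> \<Longrightarrow>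
        (\<integral>x. \<bar>\<phi> x\<bar> powr q \<partial>\<mu>) powr (1 / q)
          \<le> C * (LINT x:\<Omega>|lebesgue. norm (grad \<phi> x) powr p) powr (1 / p)"
  shows "(\<forall>lam. p_mu_eigenvalue \<Omega> p q \<mu> lam \<longrightarrow> lam > 0) \<and>
         (\<exists>lam u. lam > 0 \<and> p_mu_eigenfunction \<Omega> p q \<mu> lam u \<and>
            (\<forall>lam'. p_mu_eigenvalue \<Omega> p q \<mu> lam' \<longrightarrow> lam \<le> lam'))"
proof -
  interpret mu_embedding \<Omega> p q C \<mu>
    by (rule mu_embedding.intro) fact+
  show ?thesis using p_mu_eigenvalue_pos smallest_eigenvalue_exists by blast
qed

end
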